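(* Let $\alpha\in[-1,0)$ and let $B$ be a Blaschke product of degree $m$. Let $s\in(0,1)$ be such that the disc $s\mathbb{D}$ contains all the zeros of $B$, and let $\gamma_2:=\left(1-\frac{1}{N+1}\right)^{-\alpha/2}$, where the positive integer $N$ is large enough that $\|\gamma_2^{-1}B\|_{H^\infty(s\mathbb{D})}<1$. Let $\mathcal{M}$ be a nonzero nearly $T_B^{-1}$ invariant subspace of $\mathcal{D}_\alpha$ endowed with the norm $\|\cdot\|_2$, and let $G_0:=[g_1,g_2,\dots,g_l]^t$ be a matrix containing an orthonormal basis $(g_i)_{i\in\{1,\dots,l\}}$ of $\mathcal{M}\ominus(\mathcal{M}\cap T_B\mathcal{D}_\alpha)$. Then there exists a linear submanifold $\mathcal{N}\subset H^2(s\mathbb{D},\mathbb{C}^l)$ such that $\mathcal{M}=\mathcal{N}G_0$ on $s\mathbb{D}$ and for all $h\in\mathcal{M}$ there exists $q\in\mathcal{N}$ such that $h=qG_0$ on $s\mathbb{D}$ with $$\|h\|_2\ge\left(1-\left\|\gamma_2^{-1}B\right\|_{H^\infty(s\mathbb{D})}^2\right)^{1/2}\|q\|_{H^2(s\mathbb{D},\mathbb{C}^l)}.$$ Moreover, $\mathcal{N}$ is invariant under $T_{B^{-1}}$, and then $U_s(\mathcal{N})$ is invariant under $T_s^*:=U_sT_{B^{-1}}U_s^*$ in $H^2(\mathbb{D},\mathbb{C}^l)$.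
   Context: $\mathbb{D}$ is the open unit disc and $\mathbb{T}$ the unit circle. For real $\alpha$, the Dirichlet-type space $\mathcal{D}_\alpha=\mathcal{D}_\alpha(\mathbb{D})$ consists of all analytic $f(z)=\sum_{k\ge0}a_kz^k$ on $\mathbb{D}$ with $\sum_{k\ge0}|a_k|^2(k+1)^\alpha<\infty$. $B$ is a finite Blaschke product of degree $m\ge1$, $K_B=H^2(\mathbb{D})\ominus BH^2(\mathbb{D})$, and $T_B:\mathcal{D}_\alpha\to\mathcal{D}_\alpha$ is the (bounded) operator of multiplication by $B$. For $\alpha\in[-1,1]$, a function $f$ belongs to $\mathcal{D}_\alpha$ if and only if $f=\sum_{k\ge0}B^kh_k$ (convergence in $\mathcal{D}_\alpha$) with $h_k\in K_B$ and $\sum_{k\ge0}(k+1)^\alpha\|h_k\|_{H^2}^2<\infty$. For $\alpha\in[-1,0)$ and the fixed positive integer $N$, $\mathcal{D}_\alpha$ is endowed with the equivalent Hilbert space norm $$\|f\|_2^2:=\sum_{k=0}^{N-1}N^\alpha\|h_k\|_{H^2}^2+\sum_{k=N}^\infty(k+1)^\alpha\|h_k\|_{H^2}^2\qquad\Big(f=\sum_{k\ge0}B^kh_k,\ h_k\in K_B\Big),$$ and orthogonality and orthonormality in $\mathcal{D}_\alpha$ are with respect to the corresponding inner product. With respect to $\|\cdot\|_2$, $\gamma_2$ is the lower bound of $T_B$, i.e. the largest $c>0$ with $\|Bf\|_2\ge c\|f\|_2$ for all $f\in\mathcal{D}_\alpha$. "Subspace" means closed linear subspace; "linear (sub)manifold"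 means an algebraic linear subspace, not necessarily closed. A subspace $\mathcal{M}\subset\mathcal{D}_\alpha$ is nearly $T_B^{-1}$ invariant if, for every $g\in\mathcal{D}_\alpha$ with $Bg\in\mathcal{M}$, one has $g\in\mathcal{M}$. The integer $l:=\dim[\mathcal{M}\ominus(\mathcal{M}\cap T_B\mathcal{D}_\alpha)]$ satisfies $1\le l\le m$. $H^2(s\mathbb{D},\mathbb{C}^l)$ is the $\mathbb{C}^l$-valued Hardy space of the disc $s\mathbb{D}$, normalized so that $U_s:H^2(s\mathbb{D},\mathbb{C}^l)\to H^2(\mathbb{D},\mathbb{C}^l)$, $(U_sf)(z)=f(sz)$, is unitary. Its elements are rows $q=[q_1,\dots,q_l]$; $qG_0=\sum_{i=1}^l q_ig_i$ (pointwise products on $s\mathbb{D}$), and "$\mathcal{M}=\mathcal{N}G_0$ on $s\mathbb{D}$" means that the set of restrictions to $s\mathbb{D}$ of functions in $\mathcal{M}$ equals $\{qG_0:q\in\mathcal{N}\}$. $\|\cdot\|_{H^\infty(s\mathbb{D})}$ is the supremum norm over $s\mathbb{D}$. Since $B$ has no zeros on the circle $s\mathbb{T}$, $B^{-1}\in L^\infty(s\mathbb{T})$, and $T_{B^{-1}}$ is the Toeplitz operator on $H^2(s\mathbb{D},\mathbb{C}^l)$ given by $T_{B^{-1}}q=P_{H^2(s\mathbb{D},\mathbb{C}^l)}(B^{-1}q)$, where $P_{H^2(s\mathbb{D},\mathbb{C}^l)}$ is the orthogonal projection from $L^2(s\mathbb{T},\mathbb{C}^l)$ onto $H^2(s\mathbb{D},\mathbb{C}^l)$.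 *)

theory Defs
  imports "HOL-Analysis.Analysis"
begin

text \<open>
  Convention: a function on the disc \<open>r\<D>\<close> is represented by a total function on \<open>complex\<close> that
  vanishes off \<open>ball 0 r\<close>, so that equality of functions on the disc is equality in HOL.
  Sesquilinear forms are linear in the first argument.
\<close>

subsection \<open>Subspaces of function spaces\<close>

text \<open>The scalar multiplication is a parameter because the functions are scalar valued
  (\<open>(*)\<close>) or \<open>\<complex>\<^sup>l\<close> valued (\<open>(*s)\<close>).\<close>

definition linear_submanifold ::
  "(complex \<Rightarrow> 'v \<Rightarrow> 'v) \<Rightarrow> (complex \<Rightarrow> 'v::ab_group_add) set \<Rightarrow> (complex \<Rightarrow> 'v) set \<Rightarrow> bool" where
  "linear_submanifold scl V M \<longleftrightarrow>
     M \<subseteq> V \<and> (\<lambda>z. 0) \<in> M \<and>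
     (\<forall>f\<in>M. \<forall>g\<in>M. (\<lambda>z. f z + g z) \<in> M) \<and>
     (\<forall>c. \<forall>f\<in>M. (\<lambda>z. scl c (f z)) \<in> M)"

definition closed_subspace ::
  "((complex \<Rightarrow> complex) \<Rightarrow> real) \<Rightarrow> (complex \<Rightarrow> complex) set \<Rightarrow> (complex \<Rightarrow> complex) set \<Rightarrow> bool" where
  "closed_subspace nrm V M \<longleftrightarrow>
     linear_submanifold (*) V M \<and>
     (\<forall>F f. (\<forall>n::nat. F n \<in> M) \<longrightarrow> f \<in> V \<longrightarrow>
        (\<lambda>n. nrm (\<lambda>z. F n z - f z)) \<longlonglongrightarrow> 0 \<longrightarrow> f \<in> M)"

definition ominus :: "('f \<Rightarrow> 'f \<Rightarrow> complex) \<Rightarrow> 'f set \<Rightarrow> 'f set \<Rightarrow> 'f set" where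
  "ominus ip M L = {f \<in> M. \<forall>g\<in>L. ip f g = 0}"

definition orthonormal_basis ::
  "((complex \<Rightarrow> complex) \<Rightarrow> (complex \<Rightarrow> complex) \<Rightarrow> complex) \<Rightarrow> (complex \<Rightarrow> complex) set
     \<Rightarrow> ('l::finite \<Rightarrow> complex \<Rightarrow> complex) \<Rightarrow> bool" where
  "orthonormal_basis ip W g \<longleftrightarrow>
     (\<forall>i. g i \<in> W) \<and>
     (\<forall>i j. ip (g i) (g j) = (if i = j then 1 else 0)) \<and>
     (\<forall>f\<in>W. \<exists>c. f = (\<lambda>z. \<Sum>i\<in>UNIV. c i * g i z))"

definition hilbert_adjoint ::
  "'f set \<Rightarrow> ('f \<Rightarrow> 'f \<Rightarrow> complex) \<Rightarrow> ('h \<Rightarrow> 'h \<Rightarrow> complex) \<Rightarrow> ('f \<Rightarrow> 'h) \<Rightarrow> 'h \<Rightarrow> 'f" where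
  "hilbert_adjoint V ipV ipW A w = (THE v. v \<in> V \<and> (\<forall>u\<in>V. ipW (A u) w = ipV u v))"

subsection \<open>Dirichlet-type spaces and Hardy spaces\<close>

definition taylor_coeff :: "(complex \<Rightarrow> complex) \<Rightarrow> nat \<Rightarrow> complex" where
  "taylor_coeff f k = (deriv ^^ k) f 0 / fact k"

definition analytic_on_disc :: "real \<Rightarrow> (complex \<Rightarrow> complex) set" where
  "analytic_on_disc r = {f. f holomorphic_on ball 0 r \<and> (\<forall>z. z \<notin> ball 0 r \<longrightarrow> f z = 0)}"

definition dirichlet :: "real \<Rightarrow> (complex \<Rightarrow> complex) set" where
  "dirichlet \<alpha> = {f \<in> analytic_on_disc 1.
     summable (\<lambda>k. (cmod (taylor_coeff f k))\<^sup>2 * (real k + 1) powr \<alpha>)}"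

definition dirichlet_norm :: "real \<Rightarrow> (complex \<Rightarrow> complex) \<Rightarrow> real" where
  "dirichlet_norm \<alpha> f = sqrt (\<Sum>k. (cmod (taylor_coeff f k))\<^sup>2 * (real k + 1) powr \<alpha>)"

text \<open>\<open>H\<^sup>2(r\<D>)\<close>, normalized so that \<open>f \<mapsto> f(r \<cdot>)\<close> is unitary onto \<open>H\<^sup>2(\<D>)\<close>; the latter is the
  case \<open>r = 1\<close>.\<close>

definition hardy :: "real \<Rightarrow> (complex \<Rightarrow> complex) set" where
  "hardy r = {f \<in> analytic_on_disc r. summable (\<lambda>k. (cmod (taylor_coeff f k) * r ^ k)\<^sup>2)}"

definition hardy_inner :: "real \<Rightarrow> (complex \<Rightarrow> complex) \<Rightarrow> (complex \<Rightarrow> complex) \<Rightarrow> complex" where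
  "hardy_inner r f g =
     (\<Sum>k. (taylor_coeff f k * of_real (r ^ k)) * cnj (taylor_coeff g k * of_real (r ^ k)))"

definition hardy_norm :: "real \<Rightarrow> (complex \<Rightarrow> complex) \<Rightarrow> real" where
  "hardy_norm r f = sqrt (\<Sum>k. (cmod (taylor_coeff f k) * r ^ k)\<^sup>2)"

definition hardy_vec :: "real \<Rightarrow> (complex \<Rightarrow> complex ^ 'l) set" where
  "hardy_vec r = {q. \<forall>i. (\<lambda>z. q z $ i) \<in> hardy r}"

definition hardy_vec_inner ::
  "real \<Rightarrow> (complex \<Rightarrow> complex ^ 'l) \<Rightarrow> (complex \<Rightarrow> complex ^ 'l) \<Rightarrow> complex" where
  "hardy_vec_inner r p q = (\<Sum>i\<in>UNIV. hardy_inner r (\<lambda>z. p z $ i) (\<lambda>z. q z $ i))"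

definition hardy_vec_norm :: "real \<Rightarrow> (complex \<Rightarrow> complex ^ 'l) \<Rightarrow> real" where
  "hardy_vec_norm r q = sqrt (\<Sum>i\<in>UNIV. (hardy_norm r (\<lambda>z. q z $ i))\<^sup>2)"

definition Hinf_norm :: "real \<Rightarrow> (complex \<Rightarrow> complex) \<Rightarrow> real" where
  "Hinf_norm r f = (SUP z\<in>ball 0 r. cmod (f z))"

subsection \<open>Finite Blaschke products\<close>

definition blaschke_product :: "nat \<Rightarrow> (complex \<Rightarrow> complex) \<Rightarrow> bool" where
  "blaschke_product m B \<longleftrightarrow>
     (\<exists>c a. cmod c = 1 \<and> (\<forall>j<m. cmod (a j) < 1) \<and>
        (\<forall>z\<in>ball 0 1. B z = c * (\<Prod>j<m. (z - a j) / (1 - cnj (a j) * z))))"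

definition mult_op :: "(complex \<Rightarrow> complex) \<Rightarrow> (complex \<Rightarrow> complex) \<Rightarrow> complex \<Rightarrow> complex" where
  "mult_op B f = (\<lambda>z. B z * f z)"

definition model_space :: "(complex \<Rightarrow> complex) \<Rightarrow> (complex \<Rightarrow> complex) set" where
  "model_space B = ominus (hardy_inner 1) (hardy 1) (mult_op B ` hardy 1)"

subsection \<open>The norm \<open>\<parallel>\<cdot>\<parallel>\<^sub>2\<close>\<close>

definition blaschke_expansion ::
  "real \<Rightarrow> (complex \<Rightarrow> complex) \<Rightarrow> (complex \<Rightarrow> complex) \<Rightarrow> (nat \<Rightarrow> complex \<Rightarrow> complex) \<Rightarrow> bool" where
  "blaschke_expansion \<alpha> B f h \<longleftrightarrow>
     (\<forall>k. h k \<in> model_space B) \<and>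
     summable (\<lambda>k. (real k + 1) powr \<alpha> * (hardy_norm 1 (h k))\<^sup>2) \<and>
     (\<lambda>n. dirichlet_norm \<alpha> (\<lambda>z. f z - (\<Sum>k<n. B z ^ k * h k z))) \<longlonglongrightarrow> 0"

text \<open>For \<open>f \<in> dirichlet \<alpha>\<close> with \<open>\<alpha> \<in> [-1,1]\<close> and \<open>B\<close> a finite Blaschke product of degree at least
  one, the expansion exists and is unique.\<close>

definition blaschke_coeff ::
  "real \<Rightarrow> (complex \<Rightarrow> complex) \<Rightarrow> (complex \<Rightarrow> complex) \<Rightarrow> nat \<Rightarrow> complex \<Rightarrow> complex" where
  "blaschke_coeff \<alpha> B f = (THE h. blaschke_expansion \<alpha> B f h)"

definition weight2 :: "real \<Rightarrow> nat \<Rightarrow> nat \<Rightarrow> real" where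
  "weight2 \<alpha> N k = (if k < N then real N powr \<alpha> else (real k + 1) powr \<alpha>)"

definition norm2 :: "real \<Rightarrow> (complex \<Rightarrow> complex) \<Rightarrow> nat \<Rightarrow> (complex \<Rightarrow> complex) \<Rightarrow> real" where
  "norm2 \<alpha> B N f = sqrt (\<Sum>k. weight2 \<alpha> N k * (hardy_norm 1 (blaschke_coeff \<alpha> B f k))\<^sup>2)"

definition inner2 ::
  "real \<Rightarrow> (complex \<Rightarrow> complex) \<Rightarrow> nat \<Rightarrow> (complex \<Rightarrow> complex) \<Rightarrow> (complex \<Rightarrow> complex) \<Rightarrow> complex" where
  "inner2 \<alpha> B N f g =
     (\<Sum>k. of_real (weight2 \<alpha> N k) *
           hardy_inner 1 (blaschke_coeff \<alpha> B f k) (blaschke_coeff \<alpha> B g k))"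

definition nearly_inverse_invariant ::
  "real \<Rightarrow> (complex \<Rightarrow> complex) \<Rightarrow> (complex \<Rightarrow> complex) set \<Rightarrow> bool" where
  "nearly_inverse_invariant \<alpha> B M \<longleftrightarrow> (\<forall>g\<in>dirichlet \<alpha>. mult_op B g \<in> M \<longrightarrow> g \<in> M)"

subsection \<open>Toeplitz operators on \<open>H\<^sup>2(s\<D>,\<complex>\<^sup>l)\<close>\<close>

text \<open>Functions on the circle \<open>s\<T>\<close> are parametrized by the angle; normalized arc length.\<close>

definition circle_L2 :: "real \<Rightarrow> (complex \<Rightarrow> complex ^ 'l) set" where
  "circle_L2 s = {\<phi>.
     (\<lambda>\<theta>. \<phi> (of_real s * cis \<theta>)) \<in> borel_measurable (lebesgue_on {0..2*pi}) \<and>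
     integrable (lebesgue_on {0..2*pi}) (\<lambda>\<theta>. (norm (\<phi> (of_real s * cis \<theta>)))\<^sup>2)}"

definition circle_inner ::
  "real \<Rightarrow> (complex \<Rightarrow> complex ^ 'l) \<Rightarrow> (complex \<Rightarrow> complex ^ 'l) \<Rightarrow> complex" where
  "circle_inner s \<phi> \<psi> =
     integral\<^sup>L (lebesgue_on {0..2*pi})
       (\<lambda>\<theta>. \<Sum>i\<in>UNIV. \<phi> (of_real s * cis \<theta>) $ i * cnj (\<psi> (of_real s * cis \<theta>) $ i))
     / of_real (2 * pi)"

definition circle_norm :: "real \<Rightarrow> (complex \<Rightarrow> complex ^ 'l) \<Rightarrow> real" where
  "circle_norm s \<phi> =
     sqrt (integral\<^sup>L (lebesgue_on {0..2*pi}) (\<lambda>\<theta>. (norm (\<phi> (of_real s * cis \<theta>)))\<^sup>2) / (2 * pi))"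

text \<open>\<open>\<phi>\<close> is the boundary function of \<open>q\<close>: the limit in \<open>L\<^sup>2(s\<T>)\<close> of the dilates \<open>q(r \<cdot>)\<close> as
  \<open>r \<rightarrow> 1\<close> from below. It is determined by \<open>q\<close> up to null sets, and embeds \<open>H\<^sup>2(s\<D>)\<close>
  isometrically into \<open>L\<^sup>2(s\<T>)\<close>.\<close>

definition is_boundary_fun ::
  "real \<Rightarrow> (complex \<Rightarrow> complex ^ 'l) \<Rightarrow> (complex \<Rightarrow> complex ^ 'l) \<Rightarrow> bool" where
  "is_boundary_fun s q \<phi> \<longleftrightarrow>
     \<phi> \<in> circle_L2 s \<and>
     ((\<lambda>r. circle_norm s (\<lambda>\<zeta>. \<phi> \<zeta> - q (of_real r * \<zeta>))) \<longlongrightarrow> 0) (at_left 1)"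

definition boundary_fun :: "real \<Rightarrow> (complex \<Rightarrow> complex ^ 'l) \<Rightarrow> complex \<Rightarrow> complex ^ 'l" where
  "boundary_fun s q = (SOME \<phi>. is_boundary_fun s q \<phi>)"

text \<open>The orthogonal projection of \<open>L\<^sup>2(s\<T>,\<complex>\<^sup>l)\<close> onto \<open>H\<^sup>2(s\<D>,\<complex>\<^sup>l)\<close>, the result being regarded as a
  function on the disc.\<close>

definition hardy_proj :: "real \<Rightarrow> (complex \<Rightarrow> complex ^ 'l) \<Rightarrow> complex \<Rightarrow> complex ^ 'l" where
  "hardy_proj s \<phi> =
     (THE p. p \<in> hardy_vec s \<and>
        (\<exists>\<psi>. is_boundary_fun s p \<psi> \<and>
           (\<forall>u\<in>hardy_vec s. \<forall>\<upsilon>. is_boundary_fun s u \<upsilon> \<longrightarrow>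
              circle_inner s (\<lambda>\<zeta>. \<phi> \<zeta> - \<psi> \<zeta>) \<upsilon> = 0)))"

definition toeplitz ::
  "real \<Rightarrow> (complex \<Rightarrow> complex) \<Rightarrow> (complex \<Rightarrow> complex ^ 'l) \<Rightarrow> complex \<Rightarrow> complex ^ 'l" where
  "toeplitz s \<sigma> q = hardy_proj s (\<lambda>\<zeta>. \<sigma> \<zeta> *s boundary_fun s q \<zeta>)"

definition dilation :: "real \<Rightarrow> (complex \<Rightarrow> complex ^ 'l) \<Rightarrow> complex \<Rightarrow> complex ^ 'l" where
  "dilation s f = (\<lambda>z. f (of_real s * z))"

definition dilation_adjoint :: "real \<Rightarrow> (complex \<Rightarrow> complex ^ 'l) \<Rightarrow> complex \<Rightarrow> complex ^ 'l" where
  "dilation_adjoint s =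
     hilbert_adjoint (hardy_vec s) (hardy_vec_inner s) (hardy_vec_inner 1) (dilation s)"

definition row_mult ::
  "(complex \<Rightarrow> complex ^ 'l) \<Rightarrow> ('l::finite \<Rightarrow> complex \<Rightarrow> complex) \<Rightarrow> complex \<Rightarrow> complex" where
  "row_mult q g = (\<lambda>z. \<Sum>i\<in>UNIV. q z $ i * g i z)"

end

theory Submission
  imports Defs "HOL-Complex_Analysis.Complex_Analysis" "HOL-Real_Asymp.Real_Asymp"
begin

text \<open>
  For \<open>\<alpha> < 0\<close> the space \<open>\<D>\<^sub>\<alpha>\<close> is a sequence space in the Taylor coefficients, with decreasing weights.
  The Takenaka--Malmquist functions with \<open>m\<close>-periodic zeros form an orthonormal basis of \<open>H\<^sup>2\<close> adapted to
  \<open>H\<^sup>2 = \<Oplus> B\<^sup>k K\<^sub>B\<close>. By Cauchy estimates on one circle inside and one circle outside the unit circle, the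
  matrix of the change of basis decays exponentially off a sector, so it is bounded and invertible on
  the weighted space as well. Hence \<open>\<D>\<^sub>\<alpha>\<close> with the norm \<open>\<parallel>\<cdot>\<parallel>\<^sub>2\<close> is a weighted \<open>\<ell>\<^sup>2\<close> space on which \<open>T\<^sub>B\<close> is the
  shift by \<open>m\<close>, and \<open>\<gamma>\<^sub>2\<^sup>2\<close> is the smallest ratio of weights under the shift.

  By near invariance every \<open>h \<in> M\<close> is \<open>d\<^sub>0 G\<^sub>0 + B h\<^sub>1\<close> with an orthogonal sum and \<open>h\<^sub>1 \<in> M\<close>. Iteration gives
  constant rows \<open>d\<^sub>k\<close> with \<open>\<Sum> \<gamma>\<^sub>2\<^sup>2\<^sup>k |d\<^sub>k|\<^sup>2 \<le> \<parallel>h\<parallel>\<^sub>2\<^sup>2\<close>, so \<open>q = \<Sum> B\<^sup>k d\<^sub>k\<close> converges uniformly on the closure of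
  \<open>s\<D>\<close> and satisfies the norm bound by the Cauchy--Schwarz inequality. On \<open>s\<T>\<close> the function \<open>1 / B\<close>
  extends holomorphically to the exterior, with value \<open>cnj (B 0)\<close> at infinity. Therefore the Toeplitz
  operator maps \<open>q\<close> to \<open>\<Sum> B\<^sup>k d\<^sub>k\<^sub>+\<^sub>1 + cnj (B 0) d\<^sub>0\<close>, which is the row of \<open>h\<^sub>1 + cnj (B 0) d\<^sub>0 G\<^sub>0 \<in> M\<close>.
\<close>

subsection \<open>Square-summable sequences\<close>

text \<open>The expansion coefficients, boundary functions, projection and adjoint are
  \<open>THE\<close> or \<open>SOME\<close> terms, so each needs an existence and uniqueness proof
  before the claim says anything about it. On the weighted space the obstacle is that the change of
  basis is unitary only for the unweighted norm. As the weights decrease, summation by parts turns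
  unweighted bounds on initial segments into weighted ones, so Bessel's inequality stays usable, and
  dilating the index by a constant costs only a constant. Decay is needed for the matrix and for its
  adjoint: on |z| = 1/2 a product of n Blaschke factors is at most \<open>\<beta> ^ n\<close>, and
  on |z| = R > 1, inside the poles, at most \<open>b ^ n\<close>. Flattening the first N weights
  makes the smallest ratio under the shift the power -\<alpha> of N/(N+1), which is close to 1 for
  large N. This lower bound also controls the remainders B^n h_n: the norm of h_n grows at most like
  \<open>\<gamma>\<close> to the power -n, while |B|^n is at most
  \<open>(\<rho> * \<gamma>) ^ n\<close> on the disc. Injectivity of T_B makes h_1, and with it q,
  depend linearly on h, so the manifold is the image of M under a linear map.\<close>

definition ltwo :: "(nat \<Rightarrow> complex) set" where
  "ltwo = {x. summable (\<lambda>n. (cmod (x n))\<^sup>2)}"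

definition l2_inner :: "(nat \<Rightarrow> complex) \<Rightarrow> (nat \<Rightarrow> complex) \<Rightarrow> complex" where
  "l2_inner x y = (\<Sum>n. x n * cnj (y n))"

definition l2_norm_sq :: "(nat \<Rightarrow> complex) \<Rightarrow> real" where
  "l2_norm_sq x = (\<Sum>n. (cmod (x n))\<^sup>2)"

lemma summable_mult_L2:
  fixes a b :: "nat \<Rightarrow> real"
  assumes "summable (\<lambda>n. (a n)\<^sup>2)" "summable (\<lambda>n. (b n)\<^sup>2)"
  shows "summable (\<lambda>n. \<bar>a n * b n\<bar>)"
proof (rule summable_comparison_test'[where N = 0])
  show "summable (\<lambda>n. (a n)\<^sup>2 + (b n)\<^sup>2)" using assms by (rule summable_add)
  fix n
  have "2 * (\<bar>a n\<bar> * \<bar>b n\<bar>) \<le> (a n)\<^sup>2 + (b n)\<^sup>2"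
    using sum_squares_bound[of "\<bar>a n\<bar>" "\<bar>b n\<bar>"] by simp
  moreover have "0 \<le> \<bar>a n\<bar> * \<bar>b n\<bar>" by simp
  ultimately have "\<bar>a n\<bar> * \<bar>b n\<bar> \<le> (a n)\<^sup>2 + (b n)\<^sup>2" by linarith
  then show "norm \<bar>a n * b n\<bar> \<le> (a n)\<^sup>2 + (b n)\<^sup>2" by (simp add: abs_mult)
qed

lemma suminf_Cauchy_Schwarz:
  fixes a b :: "nat \<Rightarrow> real"
  assumes a: "summable (\<lambda>n. (a n)\<^sup>2)" and b: "summable (\<lambda>n. (b n)\<^sup>2)"
  shows "(\<Sum>n. \<bar>a n * b n\<bar>) \<le> sqrt (\<Sum>n. (a n)\<^sup>2) * sqrt (\<Sum>n. (b n)\<^sup>2)"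
proof (rule suminf_le_const[OF summable_mult_L2[OF a b]])
  fix N
  have "(\<Sum>n<N. \<bar>a n * b n\<bar>) = (\<Sum>n<N. \<bar>a n\<bar> * \<bar>b n\<bar>)" by (simp add: abs_mult)
  also have "\<dots> \<le> L2_set a {..<N} * L2_set b {..<N}"
    by (rule L2_set_mult_ineq)
  also have "\<dots> \<le> sqrt (\<Sum>n. (a n)\<^sup>2) * sqrt (\<Sum>n. (b n)\<^sup>2)"
    unfolding L2_set_def
    by (intro mult_mono real_sqrt_le_mono sum_le_suminf a b real_sqrt_ge_zero suminf_nonneg sum_nonneg) auto
  finally show "(\<Sum>n<N. \<bar>a n * b n\<bar>) \<le> sqrt (\<Sum>n. (a n)\<^sup>2) * sqrt (\<Sum>n. (b n)\<^sup>2)" .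
qed

lemma ltwo_summable [intro]:
  assumes "x \<in> ltwo" "y \<in> ltwo"
  shows "summable (\<lambda>n. x n * cnj (y n))"
proof (rule summable_norm_cancel)
  show "summable (\<lambda>n. norm (x n * cnj (y n)))"
    using summable_mult_L2[of "\<lambda>n. cmod (x n)" "\<lambda>n. cmod (y n)"] assms
    by (simp add: ltwo_def norm_mult)
qed

lemma ltwo_cmult: "x \<in> ltwo \<Longrightarrow> (\<lambda>n. c * x n) \<in> ltwo"
  by (simp add: ltwo_def norm_mult power_mult_distrib summable_mult)

lemma ltwo_add:
  assumes "x \<in> ltwo" "y \<in> ltwo"
  shows "(\<lambda>n. x n + y n) \<in> ltwo"
  unfolding ltwo_def
proof (rule CollectI, rule summable_comparison_test'[where N = 0])
  show "summable (\<lambda>n. 2 * (cmod (x n))\<^sup>2 + 2 * (cmod (y n))\<^sup>2)"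
    using assms by (intro summable_add summable_mult) (auto simp: ltwo_def)
  fix n
  have "(cmod (x n + y n))\<^sup>2 \<le> (cmod (x n) + cmod (y n))\<^sup>2"
    by (intro power_mono norm_triangle_ineq) auto
  also have "\<dots> \<le> 2 * (cmod (x n))\<^sup>2 + 2 * (cmod (y n))\<^sup>2"
    using sum_squares_bound[of "cmod (x n)" "cmod (y n)"] by (simp add: power2_sum)
  finally show "norm ((cmod (x n + y n))\<^sup>2) \<le> 2 * (cmod (x n))\<^sup>2 + 2 * (cmod (y n))\<^sup>2" by simp
qed

lemma ltwo_diff:
  assumes "x \<in> ltwo" "y \<in> ltwo"
  shows "(\<lambda>n. x n - y n) \<in> ltwo"
  using ltwo_add[OF assms(1) ltwo_cmult[OF assms(2), of "-1"]] by simp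

lemma ltwo_zero [simp]: "(\<lambda>n. 0) \<in> ltwo"
  by (simp add: ltwo_def)

lemma ltwo_sum: "(\<And>i. i \<in> I \<Longrightarrow> x i \<in> ltwo) \<Longrightarrow> (\<lambda>n. \<Sum>i\<in>I. c i * x i n) \<in> ltwo"
proof (induction I rule: infinite_finite_induct)
  case (insert i F)
  then have "(\<lambda>n. c i * x i n + (\<Sum>i\<in>F. c i * x i n)) \<in> ltwo"
    by (intro ltwo_add ltwo_cmult) auto
  with insert(1,2) show ?case by simp
qed auto

lemma l2_inner_add_left: "x \<in> ltwo \<Longrightarrow> y \<in> ltwo \<Longrightarrow> z \<in> ltwo \<Longrightarrow> l2_inner (\<lambda>n. x n + y n) z = l2_inner x z + l2_inner y z"
  unfolding l2_inner_def by (subst suminf_add) (auto simp: distrib_right)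

lemma l2_inner_diff_left: "x \<in> ltwo \<Longrightarrow> y \<in> ltwo \<Longrightarrow> z \<in> ltwo \<Longrightarrow> l2_inner (\<lambda>n. x n - y n) z = l2_inner x z - l2_inner y z"
  unfolding l2_inner_def by (subst suminf_diff) (auto simp: left_diff_distrib)

lemma l2_inner_cmult_left: "x \<in> ltwo \<Longrightarrow> z \<in> ltwo \<Longrightarrow> l2_inner (\<lambda>n. c * x n) z = c * l2_inner x z"
  unfolding l2_inner_def by (subst suminf_mult[symmetric]) (auto simp: mult.assoc)

lemma l2_inner_zero_left [simp]: "l2_inner (\<lambda>n. 0) z = 0"
  by (simp add: l2_inner_def)

lemma l2_inner_sum_left:
  "(\<And>i. i \<in> I \<Longrightarrow> x i \<in> ltwo) \<Longrightarrow> z \<in> ltwo \<Longrightarrow> l2_inner (\<lambda>n. \<Sum>i\<in>I. c i * x i n) z = (\<Sum>i\<in>I. c i * l2_inner (x i) z)"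
proof (induction I rule: infinite_finite_induct)
  case (insert i F)
  then have "l2_inner (\<lambda>n. c i * x i n + (\<Sum>i\<in>F. c i * x i n)) z = c i * l2_inner (x i) z + (\<Sum>i\<in>F. c i * l2_inner (x i) z)"
    by (subst l2_inner_add_left) (auto intro!: ltwo_cmult ltwo_sum simp: l2_inner_cmult_left)
  with insert(1,2) show ?case by simp
qed auto

lemma l2_inner_cnj: "x \<in> ltwo \<Longrightarrow> y \<in> ltwo \<Longrightarrow> l2_inner y x = cnj (l2_inner x y)"
proof -
  assume "x \<in> ltwo" "y \<in> ltwo"
  then have "(\<lambda>n. cnj (x n * cnj (y n))) sums cnj (l2_inner x y)"
    unfolding l2_inner_def by (intro sums_cnj[THEN iffD2] summable_sums ltwo_summable)
  then show "l2_inner y x = cnj (l2_inner x y)"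
    unfolding l2_inner_def[of y x] by (simp add: sums_iff mult.commute)
qed

lemma l2_inner_add_right: "x \<in> ltwo \<Longrightarrow> y \<in> ltwo \<Longrightarrow> z \<in> ltwo \<Longrightarrow> l2_inner z (\<lambda>n. x n + y n) = l2_inner z x + l2_inner z y"
  by (subst (1 2 3) l2_inner_cnj) (auto simp: ltwo_add l2_inner_add_left)

lemma l2_inner_cmult_right: "x \<in> ltwo \<Longrightarrow> z \<in> ltwo \<Longrightarrow> l2_inner z (\<lambda>n. c * x n) = cnj c * l2_inner z x"
  by (subst (1 2) l2_inner_cnj) (auto simp: ltwo_cmult l2_inner_cmult_left)

lemma l2_inner_sum_right:
  assumes "\<And>i. i \<in> I \<Longrightarrow> x i \<in> ltwo" "z \<in> ltwo"
  shows "l2_inner z (\<lambda>n. \<Sum>i\<in>I. c i * x i n) = (\<Sum>i\<in>I. cnj (c i) * l2_inner z (x i))"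
proof -
  have "l2_inner z (\<lambda>n. \<Sum>i\<in>I. c i * x i n) = cnj (\<Sum>i\<in>I. c i * l2_inner (x i) z)"
    using assms by (subst l2_inner_cnj) (auto simp: ltwo_sum l2_inner_sum_left)
  also have "\<dots> = (\<Sum>i\<in>I. cnj (c i) * l2_inner z (x i))"
    using assms by (auto intro!: sum.cong simp: l2_inner_cnj[of z])
  finally show ?thesis .
qed

lemma l2_inner_self: "x \<in> ltwo \<Longrightarrow> l2_inner x x = of_real (l2_norm_sq x)"
  unfolding l2_inner_def l2_norm_sq_def ltwo_def
  by (subst suminf_of_real) (auto simp flip: complex_norm_square)

lemma l2_norm_sq_nonneg [simp]: "x \<in> ltwo \<Longrightarrow> 0 \<le> l2_norm_sq x"
  unfolding l2_norm_sq_def ltwo_def by (auto intro: suminf_nonneg)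

lemma l2_norm_sq_component: "x \<in> ltwo \<Longrightarrow> (cmod (x n))\<^sup>2 \<le> l2_norm_sq x"
  unfolding l2_norm_sq_def ltwo_def using sum_le_suminf[of "\<lambda>n. (cmod (x n))\<^sup>2" "{n}"] by auto

lemma l2_norm_sq_eq_0D: "x \<in> ltwo \<Longrightarrow> l2_norm_sq x = 0 \<Longrightarrow> x n = 0"
  using l2_norm_sq_component[of x n] by simp

lemma l2_norm_sq_cmult: "x \<in> ltwo \<Longrightarrow> l2_norm_sq (\<lambda>n. c * x n) = (cmod c)\<^sup>2 * l2_norm_sq x"
  unfolding l2_norm_sq_def ltwo_def by (simp add: norm_mult power_mult_distrib suminf_mult)

lemma l2_norm_sq_add:
  assumes "x \<in> ltwo" "y \<in> ltwo"
  shows "l2_norm_sq (\<lambda>n. x n + y n) = l2_norm_sq x + l2_norm_sq y + 2 * Re (l2_inner x y)"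
proof -
  have "complex_of_real (l2_norm_sq (\<lambda>n. x n + y n)) = l2_inner x x + l2_inner y y + (l2_inner x y + cnj (l2_inner x y))"
    using assms by (simp add: l2_inner_self[symmetric] ltwo_add l2_inner_add_left l2_inner_add_right l2_inner_cnj[of x y])
  then show ?thesis
    using assms by (simp add: complex_eq_iff l2_inner_self)
qed

lemma l2_norm_sq_diff:
  assumes "x \<in> ltwo" "y \<in> ltwo"
  shows "l2_norm_sq (\<lambda>n. x n - y n) = l2_norm_sq x + l2_norm_sq y - 2 * Re (l2_inner x y)"
  using l2_norm_sq_add[OF assms(1) ltwo_cmult[OF assms(2), of "-1"]] l2_norm_sq_cmult[OF assms(2), of "-1"]
    l2_inner_cmult_right[OF assms(2,1), of "-1"] by simp

lemma l2_norm_sq_add_le: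
  assumes "x \<in> ltwo" "y \<in> ltwo"
  shows "l2_norm_sq (\<lambda>n. x n + y n) \<le> 2 * l2_norm_sq x + 2 * l2_norm_sq y"
  using l2_norm_sq_add[OF assms] l2_norm_sq_diff[OF assms] l2_norm_sq_nonneg[OF ltwo_diff[OF assms]] by linarith

text \<open>The values 1, -1, i and -i of \<open>c\<close> isolate the real and the imaginary part
  of the inner product. It upgrades norm preservation by multiplication operators to preservation of
  inner products.\<close>

lemma l2_inner_polarization:
  assumes x: "x \<in> ltwo" "y \<in> ltwo" "x' \<in> ltwo" "y' \<in> ltwo"
    and eq: "\<And>c. l2_norm_sq (\<lambda>n. x' n + c * y' n) = l2_norm_sq (\<lambda>n. x n + c * y n)"
  shows "l2_inner x' y' = l2_inner x y"
proof -
  have *: "l2_norm_sq x' + (cmod c)\<^sup>2 * l2_norm_sq y' + 2 * Re (cnj c * l2_inner x' y') =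
      l2_norm_sq x + (cmod c)\<^sup>2 * l2_norm_sq y + 2 * Re (cnj c * l2_inner x y)" for c
    using eq[of c] x by (simp add: l2_norm_sq_add ltwo_cmult l2_norm_sq_cmult l2_inner_cmult_right)
  from *[of 1] *[of "-1"] *[of \<i>] *[of "-\<i>"] show ?thesis
    by (simp add: complex_eq_iff)
qed

text \<open>Serves both the Takenaka-Malmquist expansion and the splitting of elements of
  \<open>M\<close>; \<open>v\<close> is the part orthogonal to all \<open>e i\<close>, and the
  coefficients are identified along with the energy.\<close>

lemma l2_norm_sq_Pythagoras:
  assumes fin: "finite I" and x: "x \<in> ltwo" and e: "\<And>i. i \<in> I \<Longrightarrow> e i \<in> ltwo"
    and on: "\<And>i j. i \<in> I \<Longrightarrow> j \<in> I \<Longrightarrow> l2_inner (e i) (e j) = (if i = j then 1 else 0)"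
    and v: "v \<in> ltwo" "\<And>i. i \<in> I \<Longrightarrow> l2_inner v (e i) = 0"
    and xv: "\<And>n. x n = (\<Sum>i\<in>I. c i * e i n) + v n"
  shows "l2_norm_sq x = (\<Sum>i\<in>I. (cmod (c i))\<^sup>2) + l2_norm_sq v" "\<And>i. i \<in> I \<Longrightarrow> l2_inner x (e i) = c i"
proof -
  define w where "w = (\<lambda>n. \<Sum>i\<in>I. c i * e i n)"
  have w: "w \<in> ltwo" unfolding w_def by (rule ltwo_sum[OF e])
  have we: "l2_inner w (e j) = c j" if "j \<in> I" for j
    unfolding w_def using that fin e
    by (subst l2_inner_sum_left) (auto simp: on if_distrib cong: if_cong)
  have "l2_inner v w = 0"
    unfolding w_def using e v by (subst l2_inner_sum_right) auto
  then have "l2_inner w v = 0" using w v by (simp add: l2_inner_cnj[of v w])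
  moreover have "l2_inner w w = of_real (\<Sum>i\<in>I. (cmod (c i))\<^sup>2)"
  proof -
    have "l2_inner w w = (\<Sum>i\<in>I. cnj (c i) * l2_inner w (e i))"
      using l2_inner_sum_right[of I e w c] e w unfolding w_def[symmetric] by simp
    also have "\<dots> = (\<Sum>i\<in>I. of_real ((cmod (c i))\<^sup>2))"
      by (intro sum.cong) (auto simp: we complex_norm_square mult.commute simp del: of_real_power)
    finally show ?thesis by simp
  qed
  moreover have "x = (\<lambda>n. w n + v n)" using xv by (auto simp: w_def)
  ultimately show "l2_norm_sq x = (\<Sum>i\<in>I. (cmod (c i))\<^sup>2) + l2_norm_sq v"
    using l2_norm_sq_add[OF w v(1)] w l2_inner_self[OF w] by (metis Re_complex_of_real add.right_neutral mult_zero_right of_real_eq_iff zero_complex.simps(1))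
  fix i assume "i \<in> I"
  then show "l2_inner x (e i) = c i"
    using \<open>x = _\<close> w v e we by (simp add: l2_inner_add_left)
qed

lemma l2_norm_sq_Bessel:
  assumes fin: "finite I" and x: "x \<in> ltwo" and e: "\<And>i. i \<in> I \<Longrightarrow> e i \<in> ltwo"
    and on: "\<And>i j. i \<in> I \<Longrightarrow> j \<in> I \<Longrightarrow> l2_inner (e i) (e j) = (if i = j then 1 else 0)"
  shows "(\<Sum>i\<in>I. (cmod (l2_inner x (e i)))\<^sup>2) \<le> l2_norm_sq x"
proof -
  define v where "v = (\<lambda>n. x n - (\<Sum>i\<in>I. l2_inner x (e i) * e i n))"
  have v: "v \<in> ltwo" unfolding v_def by (intro ltwo_diff ltwo_sum x e)
  have "l2_inner v (e j) = 0" if "j \<in> I" for j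
    unfolding v_def using that fin e x
    by (subst l2_inner_diff_left) (auto simp: on ltwo_sum l2_inner_sum_left if_distrib cong: if_cong)
  then have "l2_norm_sq x = (\<Sum>i\<in>I. (cmod (l2_inner x (e i)))\<^sup>2) + l2_norm_sq v"
    by (intro l2_norm_sq_Pythagoras[OF fin x e on v]) (auto simp: v_def)
  then show ?thesis using v by simp
qed

text \<open>Completeness: the limit is taken in each coordinate, and the Cauchy bound survives on
  finite sums and hence on the whole series.\<close>

lemma ltwo_Cauchy_limit:
  assumes F: "\<And>n. F n \<in> ltwo"
    and C: "\<And>\<epsilon>. 0 < \<epsilon> \<Longrightarrow> \<exists>K. \<forall>m\<ge>K. \<forall>n\<ge>K. l2_norm_sq (\<lambda>i. F m i - F n i) \<le> \<epsilon>"
  obtains x where "x \<in> ltwo" "(\<lambda>n. l2_norm_sq (\<lambda>i. F n i - x i)) \<longlonglongrightarrow> 0"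
proof -
  have "Cauchy (\<lambda>n. F n i)" for i
  proof (rule CauchyI)
    fix e :: real assume "0 < e"
    then obtain K where K: "\<forall>m\<ge>K. \<forall>n\<ge>K. l2_norm_sq (\<lambda>i. F m i - F n i) \<le> (e/2)\<^sup>2"
      using C[of "(e/2)\<^sup>2"] by auto
    have "cmod (F m i - F n i) < e" if "m \<ge> K" "n \<ge> K" for m n
    proof -
      have "(cmod (F m i - F n i))\<^sup>2 \<le> (e/2)\<^sup>2"
        using l2_norm_sq_component[OF ltwo_diff[OF F F], of m i n] K that by (meson order_trans)
      then have "cmod (F m i - F n i) \<le> e/2" using \<open>0 < e\<close> by (simp add: power2_le_iff_abs_le)
      then show ?thesis using \<open>0 < e\<close> by simp
    qed
    then show "\<exists>M. \<forall>m\<ge>M. \<forall>n\<ge>M. norm (F m i - F n i) < e" by blast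
  qed
  then have "\<exists>y. (\<lambda>n. F n i) \<longlonglongrightarrow> y" for i by (simp add: Cauchy_convergent_iff convergent_def)
  then obtain x where x: "\<And>i. (\<lambda>n. F n i) \<longlonglongrightarrow> x i" by metis
  \<comment> \<open>Fatou's argument: \<open>n\<close> is fixed and \<open>m\<close> tends to
    infinity inside a finite sum, where coordinatewise convergence suffices.\<close>
  have part: "(\<Sum>i<J. (cmod (F n i - x i))\<^sup>2) \<le> \<epsilon>"
    if K: "\<forall>m\<ge>K. \<forall>n\<ge>K. l2_norm_sq (\<lambda>i. F m i - F n i) \<le> \<epsilon>" "n \<ge> K" for J n K \<epsilon>
  proof (rule tendsto_upperbound)
    show "(\<lambda>m. \<Sum>i<J. (cmod (F n i - F m i))\<^sup>2) \<longlonglongrightarrow> (\<Sum>i<J. (cmod (F n i - x i))\<^sup>2)"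
      by (intro tendsto_intros x)
    show "\<forall>\<^sub>F m in sequentially. (\<Sum>i<J. (cmod (F n i - F m i))\<^sup>2) \<le> \<epsilon>"
      using eventually_ge_at_top[of K]
    proof eventually_elim
      case (elim m)
      have "(\<Sum>i<J. (cmod (F n i - F m i))\<^sup>2) \<le> l2_norm_sq (\<lambda>i. F n i - F m i)"
        unfolding l2_norm_sq_def using ltwo_diff[OF F F, of n m]
        by (intro sum_le_suminf) (auto simp: ltwo_def)
      then show ?case using K elim by force
    qed
  qed auto
  have diff: "(\<lambda>i. F n i - x i) \<in> ltwo \<and> l2_norm_sq (\<lambda>i. F n i - x i) \<le> \<epsilon>"
    if K: "\<forall>m\<ge>K. \<forall>n\<ge>K. l2_norm_sq (\<lambda>i. F m i - F n i) \<le> \<epsilon>" "n \<ge> K" for n K \<epsilon>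
  proof -
    have s: "summable (\<lambda>i. (cmod (F n i - x i))\<^sup>2)"
      by (rule summableI_nonneg_bounded[where x = \<epsilon>]) (use part[OF K] in auto)
    moreover have "l2_norm_sq (\<lambda>i. F n i - x i) \<le> \<epsilon>"
      unfolding l2_norm_sq_def by (rule suminf_le_const[OF s]) (use part[OF K] in auto)
    ultimately show ?thesis by (simp add: ltwo_def)
  qed
  obtain K where K: "\<forall>m\<ge>K. \<forall>n\<ge>K. l2_norm_sq (\<lambda>i. F m i - F n i) \<le> 1" using C[of 1] by auto
  then have xl: "x \<in> ltwo" using ltwo_diff[OF F[of K], of "\<lambda>i. F K i - x i"] diff[OF K, of K] by simp
  moreover have "(\<lambda>n. l2_norm_sq (\<lambda>i. F n i - x i)) \<longlonglongrightarrow> 0"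
  proof (rule LIMSEQ_I)
    fix r :: real assume "0 < r"
    then obtain K where K: "\<forall>m\<ge>K. \<forall>n\<ge>K. l2_norm_sq (\<lambda>i. F m i - F n i) \<le> r/2"
      using C[of "r/2"] by auto
    have "norm (l2_norm_sq (\<lambda>i. F n i - x i) - 0) < r" if "n \<ge> K" for n
      using diff[OF K that] \<open>0 < r\<close> by simp
    then show "\<exists>no. \<forall>n\<ge>no. norm (l2_norm_sq (\<lambda>i. F n i - x i) - 0) < r" by blast
  qed
  ultimately show ?thesis using that by blast
qed

text \<open>A minimizing sequence for the distance is Cauchy by the parallelogram law. Closedness is
  a sequential condition inside \<open>ltwo\<close>, since \<open>L\<close> will be the coordinate
  image of a space of functions.\<close>

lemma ltwo_projection:
  assumes L: "L \<subseteq> ltwo" "(\<lambda>n. 0) \<in> L"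
    and add: "\<And>x y. x \<in> L \<Longrightarrow> y \<in> L \<Longrightarrow> (\<lambda>n. x n + y n) \<in> L"
    and scl: "\<And>c x. x \<in> L \<Longrightarrow> (\<lambda>n. c * x n) \<in> L"
    and cl: "\<And>F x. (\<And>n. F n \<in> L) \<Longrightarrow> x \<in> ltwo \<Longrightarrow> (\<lambda>n::nat. l2_norm_sq (\<lambda>i. F n i - x i)) \<longlonglongrightarrow> 0 \<Longrightarrow> x \<in> L"
    and h: "h \<in> ltwo"
  obtains v where "v \<in> L" "\<And>w. w \<in> L \<Longrightarrow> l2_inner (\<lambda>n. h n - v n) w = 0"
proof -
  define D where "D = (\<lambda>v. l2_norm_sq (\<lambda>n. h n - v n))"
  define d where "d = Inf (D ` L)"
  have D0: "0 \<le> D v" if "v \<in> L" for v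
    unfolding D_def using that h L by (auto intro!: l2_norm_sq_nonneg ltwo_diff)
  have bdd: "bdd_below (D ` L)" using D0 by (auto intro!: bdd_belowI[of _ 0])
  have d: "d \<le> D v" if "v \<in> L" for v
    unfolding d_def using bdd that by (intro cInf_lower) auto
  have "\<exists>v\<in>L. D v < d + 1 / real (Suc n)" for n
    using cInf_lessD[of "D ` L" "d + 1 / real (Suc n)"] L unfolding d_def by auto
  then obtain F where F: "\<And>n. F n \<in> L" "\<And>n. D (F n) < d + 1 / real (Suc n)" by metis
  have Fl: "F n \<in> ltwo" for n using F L by auto
  \<comment> \<open>Parallelogram law: the midpoint of \<open>F m\<close> and \<open>F n\<close> is
    in \<open>L\<close>, so its squared distance to \<open>h\<close> is at least
    \<open>d\<close>.\<close>
  have par: "l2_norm_sq (\<lambda>i. F m i - F n i) \<le> 2 * D (F m) + 2 * D (F n) - 4 * d" for m n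
  proof -
    define x where "x = (\<lambda>i. h i - F m i)"
    define y where "y = (\<lambda>i. h i - F n i)"
    have xy: "x \<in> ltwo" "y \<in> ltwo" unfolding x_def y_def by (intro ltwo_diff h Fl)+
    have "(\<lambda>i. (1/2) * (F m i + F n i)) \<in> L" by (intro scl add F)
    then have "d \<le> l2_norm_sq (\<lambda>i. h i - (1/2) * (F m i + F n i))" using d unfolding D_def by blast
    also have "(\<lambda>i. h i - (1/2) * (F m i + F n i)) = (\<lambda>i. (1/2) * (x i + y i))"
      by (auto simp: x_def y_def field_simps)
    also have "l2_norm_sq \<dots> = l2_norm_sq (\<lambda>i. x i + y i) / 4"
      by (subst l2_norm_sq_cmult) (auto simp: ltwo_add xy norm_divide power2_eq_square)
    finally have "4 * d \<le> l2_norm_sq (\<lambda>i. x i + y i)" by simp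
    moreover have "l2_norm_sq (\<lambda>i. y i - x i) = l2_norm_sq (\<lambda>i. F m i - F n i)" by (simp add: x_def y_def)
    ultimately show ?thesis
      using l2_norm_sq_add[OF xy(2,1)] l2_norm_sq_diff[OF xy(2,1)] l2_norm_sq_add[OF xy]
      unfolding D_def x_def[symmetric] y_def[symmetric] by (simp add: add.commute)
  qed
  have "\<exists>K. \<forall>m\<ge>K. \<forall>n\<ge>K. l2_norm_sq (\<lambda>i. F m i - F n i) \<le> \<epsilon>" if "0 < \<epsilon>" for \<epsilon>
  proof -
    from that have "0 < \<epsilon> / 4" by simp
    then obtain K where K: "1 / real (Suc K) < \<epsilon> / 4" by (rule nat_approx_posE)
    have "l2_norm_sq (\<lambda>i. F m i - F n i) \<le> \<epsilon>" if "m \<ge> K" "n \<ge> K" for m n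
    proof -
      have "1 / real (Suc m) \<le> 1 / real (Suc K)" "1 / real (Suc n) \<le> 1 / real (Suc K)"
        using that by (auto simp: field_simps)
      then show ?thesis using par[of m n] F(2)[of m] F(2)[of n] K by linarith
    qed
    then show ?thesis by blast
  qed
  from ltwo_Cauchy_limit[OF Fl this] obtain v where v: "v \<in> ltwo" "(\<lambda>n. l2_norm_sq (\<lambda>i. F n i - v i)) \<longlonglongrightarrow> 0"
    by blast
  have vL: "v \<in> L" by (rule cl[OF F(1) v])
  have Dv: "D v \<le> d"
  proof (rule field_le_epsilon)
    fix e :: real assume e: "0 < e"
    \<comment> \<open>Triangle inequality for squared norms with a free parameter, from expanding
      the square of \<open>sqrt t * x - y / sqrt t\<close>. For fixed \<open>t\<close> the last term
      vanishes as \<open>n\<close> grows.\<close>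
    have key: "D v \<le> (1 + t) * D (F n) + (1 + 1/t) * l2_norm_sq (\<lambda>i. F n i - v i)" if "0 < t" for t n
    proof -
      define x where "x = (\<lambda>i. h i - F n i)"
      define y where "y = (\<lambda>i. F n i - v i)"
      have xy: "x \<in> ltwo" "y \<in> ltwo" unfolding x_def y_def by (intro ltwo_diff h Fl v)+
      define c d where "c = complex_of_real (sqrt t)" and "d = complex_of_real (1 / sqrt t)"
      have cd: "(cmod c)\<^sup>2 = t" "(cmod d)\<^sup>2 = 1 / t" "cnj d * c = 1"
        using that by (auto simp: c_def d_def norm_divide power_divide)
      have "0 \<le> l2_norm_sq (\<lambda>i. c * x i - d * y i)"
        by (intro l2_norm_sq_nonneg ltwo_diff ltwo_cmult xy)
      also have "\<dots> = t * l2_norm_sq x + 1 / t * l2_norm_sq y - 2 * Re (cnj d * c * l2_inner x y)"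
        using xy by (simp add: l2_norm_sq_diff ltwo_cmult l2_norm_sq_cmult l2_inner_cmult_left l2_inner_cmult_right cd(1,2) algebra_simps)
      finally have "l2_norm_sq (\<lambda>i. x i + y i) \<le> (1 + t) * l2_norm_sq x + (1 + 1/t) * l2_norm_sq y"
        unfolding cd(3) mult_1 using l2_norm_sq_add[OF xy] by (simp add: distrib_right)
      then show ?thesis by (simp add: D_def x_def y_def)
    qed
    \<comment> \<open>Makes \<open>t * d\<close> at most \<open>e / 2\<close>; the summand 1 covers
      \<open>d = 0\<close>.\<close>
    define t where "t = e / (2 * (d + 1))"
    have d0: "0 \<le> d" unfolding d_def using L D0 by (intro cInf_greatest) auto
    have t: "0 < t" "t * (d + 1) = e / 2" using e d0 by (auto simp: t_def field_simps)
    have "(\<lambda>n. (1 + t) * (d + 1 / real (Suc n)) + (1 + 1/t) * l2_norm_sq (\<lambda>i. F n i - v i)) \<longlonglongrightarrow>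
        (1 + t) * (d + 0) + (1 + 1/t) * 0"
      by (intro tendsto_intros v LIMSEQ_Suc[OF lim_1_over_n])
    then have "D v \<le> (1 + t) * (d + 0) + (1 + 1/t) * 0"
    proof (rule LIMSEQ_le_const)
      have "D v \<le> (1 + t) * (d + 1 / real (Suc n)) + (1 + 1/t) * l2_norm_sq (\<lambda>i. F n i - v i)" for n
      proof -
        have "(1 + t) * D (F n) \<le> (1 + t) * (d + 1 / real (Suc n))"
          using F(2)[of n] t(1) by (intro mult_left_mono) auto
        then show ?thesis using key[OF t(1), of n] by linarith
      qed
      then show "\<exists>N. \<forall>n\<ge>N. D v \<le> (1 + t) * (d + 1 / real (Suc n)) + (1 + 1/t) * l2_norm_sq (\<lambda>i. F n i - v i)"
        by blast
    qed
    then show "D v \<le> d + e" using t e by (simp add: algebra_simps)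
  qed
  have "l2_inner (\<lambda>n. h n - v n) w = 0" if w: "w \<in> L" for w
  proof -
    define x where "x = (\<lambda>i. h i - v i)"
    have x: "x \<in> ltwo" "w \<in> ltwo" unfolding x_def using h v w L by (auto intro: ltwo_diff)
    have ineq: "2 * Re (cnj c * l2_inner x w) \<le> (cmod c)\<^sup>2 * l2_norm_sq w" for c
    proof -
      have "(\<lambda>i. v i + c * w i) \<in> L" by (intro add vL scl w)
      then have "D v \<le> D (\<lambda>i. v i + c * w i)" using Dv d by force
      also have "D (\<lambda>i. v i + c * w i) = l2_norm_sq (\<lambda>i. x i - c * w i)"
        by (simp add: D_def x_def algebra_simps)
      also have "\<dots> = l2_norm_sq x + (cmod c)\<^sup>2 * l2_norm_sq w - 2 * Re (cnj c * l2_inner x w)"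
        using x by (simp add: l2_norm_sq_diff ltwo_cmult l2_norm_sq_cmult l2_inner_cmult_right)
      finally show ?thesis by (simp add: D_def x_def)
    qed
    have "l2_inner x w = 0"
    proof (rule ccontr)
      assume "l2_inner x w \<noteq> 0"
      then have p: "0 < (cmod (l2_inner x w))\<^sup>2" by simp
      \<comment> \<open>A first variation in the direction of \<open>w\<close>. With this
        \<open>a\<close> the quadratic term is smaller than the linear one, against minimality; the
        summand 1 covers \<open>w = 0\<close>.\<close>
      define a where "a = 1 / (l2_norm_sq w + 1)"
      have a: "0 < a" "a * l2_norm_sq w < 1" using l2_norm_sq_nonneg[OF x(2)] by (auto simp: a_def field_simps)
      have "2 * (a * (cmod (l2_inner x w))\<^sup>2) \<le> a\<^sup>2 * (cmod (l2_inner x w))\<^sup>2 * l2_norm_sq w"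
        using ineq[of "of_real a * l2_inner x w"] a
        by (simp add: norm_mult power_mult_distrib complex_norm_square[symmetric] mult.assoc mult.commute[of "cnj _"]
             del: of_real_power flip: of_real_mult)
      also have "\<dots> = (a * (cmod (l2_inner x w))\<^sup>2) * (a * l2_norm_sq w)" by (simp add: power2_eq_square)
      also have "\<dots> \<le> a * (cmod (l2_inner x w))\<^sup>2 * 1" using a p by (intro mult_left_mono) auto
      finally show False using a p by auto
    qed
    then show ?thesis by (simp add: x_def)
  qed
  with vL show ?thesis using that by blast
qed

subsection \<open>Taylor coefficients and circle means\<close>

lemma taylor_coeff_sums:
  assumes "f holomorphic_on ball 0 r" "z \<in> ball 0 r"
  shows "(\<lambda>k. taylor_coeff f k * z ^ k) sums f z"
  using holomorphic_power_series[OF assms] by (simp add: taylor_coeff_def)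

lemma taylor_coeff_unique:
  assumes "0 < r" "\<And>z. z \<in> ball 0 r \<Longrightarrow> (\<lambda>k. a k * z ^ k) sums f z"
  shows "taylor_coeff f k = a k"
proof -
  have "f has_fps_expansion Abs_fps a"
    by (rule has_fps_expansionI)
      (use assms in \<open>auto simp: eventually_nhds intro!: exI[of _ "ball 0 r"]\<close>)
  then have "fps_nth (Abs_fps a) k = (deriv ^^ k) f 0 / fact k"
    by (rule fps_nth_fps_expansion)
  then show ?thesis by (simp add: taylor_coeff_def)
qed

lemma taylor_coeff_cong:
  assumes "0 < r" "\<And>z. z \<in> ball 0 r \<Longrightarrow> f z = g z"
  shows "taylor_coeff f k = taylor_coeff g k"
  unfolding taylor_coeff_def
  by (subst higher_deriv_cong_ev[of f g 0 0])
    (use assms in \<open>auto simp: eventually_nhds intro!: exI[of _ "ball 0 r"]\<close>)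

lemma taylor_coeff_add:
  assumes "0 < r" "f holomorphic_on ball 0 r" "g holomorphic_on ball 0 r"
  shows "taylor_coeff (\<lambda>z. f z + g z) k = taylor_coeff f k + taylor_coeff g k"
  using higher_deriv_add[OF assms(2,3), of 0 k] assms(1) by (simp add: taylor_coeff_def add_divide_distrib)

lemma taylor_coeff_diff:
  assumes "0 < r" "f holomorphic_on ball 0 r" "g holomorphic_on ball 0 r"
  shows "taylor_coeff (\<lambda>z. f z - g z) k = taylor_coeff f k - taylor_coeff g k"
  using higher_deriv_diff[OF assms(2,3), of 0 k] assms(1) by (simp add: taylor_coeff_def diff_divide_distrib)

lemma taylor_coeff_cmult:
  assumes "0 < r" "f holomorphic_on ball 0 r"
  shows "taylor_coeff (\<lambda>z. c * f z) k = c * taylor_coeff f k"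
  using higher_deriv_cmult[OF assms(2), of 0 k] assms(1) by (simp add: taylor_coeff_def)

lemma taylor_coeff_const [simp]: "taylor_coeff (\<lambda>z. c) k = (if k = 0 then c else 0)"
  by (simp add: taylor_coeff_def)

lemma taylor_coeff_0 [simp]: "taylor_coeff f 0 = f 0"
  by (simp add: taylor_coeff_def)

lemma taylor_coeff_sum:
  assumes "0 < r" "\<And>i. i \<in> I \<Longrightarrow> f i holomorphic_on ball 0 r"
  shows "taylor_coeff (\<lambda>z. \<Sum>i\<in>I. c i * f i z) k = (\<Sum>i\<in>I. c i * taylor_coeff (f i) k)"
  using assms(2)
proof (induction I rule: infinite_finite_induct)
  case (insert x F)
  have "taylor_coeff (\<lambda>z. \<Sum>i\<in>insert x F. c i * f i z) k =
      taylor_coeff (\<lambda>z. c x * f x z + (\<Sum>i\<in>F. c i * f i z)) k"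
    using insert by simp
  also have "\<dots> = taylor_coeff (\<lambda>z. c x * f x z) k + taylor_coeff (\<lambda>z. \<Sum>i\<in>F. c i * f i z) k"
    by (rule taylor_coeff_add[OF assms(1)]) (use insert in \<open>auto intro!: holomorphic_intros\<close>)
  finally show ?case using insert by (simp add: taylor_coeff_cmult[OF assms(1)])
qed auto

lemma taylor_coeff_shift:
  assumes "0 < r" "f holomorphic_on ball 0 r"
  shows "taylor_coeff (\<lambda>z. z * f z) k = (if k = 0 then 0 else taylor_coeff f (k - 1))"
proof (rule taylor_coeff_unique[OF assms(1)])
  fix z :: complex assume "z \<in> ball 0 r"
  then have "(\<lambda>k. z * (taylor_coeff f k * z ^ k)) sums (z * f z)"
    by (intro sums_mult taylor_coeff_sums[OF assms(2)])
  then show "(\<lambda>k. (if k = 0 then 0 else taylor_coeff f (k - 1)) * z ^ k) sums (z * f z)"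
    using sums_Suc_imp[of "\<lambda>k. (if k = 0 then 0 else taylor_coeff f (k - 1)) * z ^ k" "z * f z"]
    by (simp add: mult.left_commute)
qed

lemma taylor_coeff_monomial: "taylor_coeff (\<lambda>z. z ^ n) k = (if k = n then 1 else 0)"
proof (rule taylor_coeff_unique[of 1])
  fix z :: complex
  show "(\<lambda>k. (if k = n then 1 else 0) * z ^ k) sums z ^ n"
    using sums_single[of n "\<lambda>k. z ^ k"] by (simp add: if_distrib[of "\<lambda>x. x * _"] cong: if_cong)
qed simp

lemma taylor_coeff_bound:
  assumes "0 < r" "f holomorphic_on ball 0 r" "continuous_on (cball 0 r) f"
    "\<And>z. cmod z = r \<Longrightarrow> cmod (f z) \<le> C"
  shows "cmod (taylor_coeff f k) \<le> C / r ^ k"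
proof -
  have "cmod ((deriv ^^ k) f 0) \<le> fact k * C / r ^ k"
    by (rule Cauchy_inequality) (use assms in auto)
  then show ?thesis
    by (simp add: taylor_coeff_def norm_divide field_simps)
qed

lemma analytic_on_disc_eqI:
  assumes "f \<in> analytic_on_disc r" "g \<in> analytic_on_disc r"
    "\<And>k. taylor_coeff f k = taylor_coeff g k"
  shows "f = g"
proof
  fix z
  show "f z = g z"
  proof (cases "z \<in> ball 0 r")
    case True
    with assms show ?thesis
      using taylor_coeff_sums[of f r z] taylor_coeff_sums[of g r z]
      by (auto simp: analytic_on_disc_def intro: sums_unique2)
  qed (use assms in \<open>auto simp: analytic_on_disc_def\<close>)
qed

text \<open>Cauchy's formula for higher derivatives in terms of the angle. Continuity up to the
  circle is enough, so it applies on the circle of radius \<open>s\<close> itself; for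
  \<open>n = 0\<close> it is the mean value property.\<close>

lemma taylor_coeff_circle:
  assumes "0 < t" "f holomorphic_on ball 0 t" "continuous_on (cball 0 t) f"
  shows "(LINT \<theta>|lebesgue_on {0..2*pi}. f (of_real t * cis \<theta>) * cis (- real n * \<theta>))
     = 2 * pi * (taylor_coeff f n * of_real t ^ n)"
proof -
  have c: "((\<lambda>u. f u / (u-0) ^ (Suc n)) has_contour_integral ((2 * pi * \<i>) / (fact n) * (deriv ^^ n) f 0))
           (circlepath 0 t)"
    by (rule Cauchy_has_contour_integral_higher_derivative_circlepath) (use assms in auto)
  define G where "G = (\<lambda>\<theta>. f (of_real t * cis \<theta>) * cis (- real n * \<theta>))"
  have cG: "continuous_on {0..2*pi} G"
    unfolding G_def
    by (intro continuous_intros continuous_on_compose2[OF assms(3)])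
      (use assms in \<open>auto simp: norm_mult\<close>)
  have "((\<lambda>x. f (circlepath 0 t x) / circlepath 0 t x ^ Suc n *
      vector_derivative (circlepath 0 t) (at x within {0..1})) has_integral
      (2 * pi * \<i>) / (fact n) * (deriv ^^ n) f 0) {0..1}"
    using c unfolding has_contour_integral_def by simp
  then have "((\<lambda>x. (2 * pi * \<i> / t ^ n) * G (2 * pi * x)) has_integral
      (2 * pi * \<i>) / (fact n) * (deriv ^^ n) f 0) {0..1}"
  proof (rule has_integral_eq[rotated])
    fix x :: real assume x: "x \<in> {0..1}"
    have e: "circlepath 0 t x = of_real t * cis (2 * pi * x)"
      by (simp add: circlepath cis_conv_exp mult_ac)
    have d: "vector_derivative (circlepath 0 t) (at x within {0..1}) = 2 * pi * \<i> * of_real t * cis (2 * pi * x)"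
      using x by (simp add: vector_derivative_circlepath01 cis_conv_exp mult_ac)
    have "cis (- real n * (2 * pi * x)) = inverse (cis (2 * pi * x) ^ n)"
      by (simp only: Complex.DeMoivre cis_inverse minus_mult_left[symmetric])
    then show "f (circlepath 0 t x) / circlepath 0 t x ^ Suc n *
      vector_derivative (circlepath 0 t) (at x within {0..1}) = (2 * pi * \<i> / t ^ n) * G (2 * pi * x)"
      unfolding e d G_def using assms(1) by (simp add: field_simps power_mult_distrib)
  qed
  then have "((\<lambda>x. (t ^ n / (2 * pi * \<i>)) * ((2 * pi * \<i> / t ^ n) * G (2 * pi * x))) has_integral
      (t ^ n / (2 * pi * \<i>)) * ((2 * pi * \<i>) / (fact n) * (deriv ^^ n) f 0)) {0..1}"
    by (rule has_integral_mult_right)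
  moreover have "(t ^ n / (2 * pi * \<i>)) * ((2 * pi * \<i> / t ^ n) * y) = y" for y
    using assms(1) by simp
  moreover have "(t ^ n / (2 * pi * \<i>)) * ((2 * pi * \<i>) / (fact n) * (deriv ^^ n) f 0) = t ^ n * taylor_coeff f n"
    by (simp add: taylor_coeff_def field_simps)
  ultimately have 1: "((\<lambda>x. G (2 * pi * x)) has_integral t ^ n * taylor_coeff f n) {0..1}"
    by (simp only:)
  \<comment> \<open>\<open>circlepath\<close> runs over the unit interval, the measure over
    \<open>{0..2*pi}\<close>; the stretch by \<open>2 * pi\<close> reconciles them.\<close>
  have im: "(\<lambda>x. x / (2 * pi)) ` {0..2 * pi} = {0..1}"
    by (auto simp: image_iff intro!: bexI[of _ "2 * pi * _"])
  have "(G has_integral (2 * pi) *\<^sub>R (t ^ n * taylor_coeff f n)) {0..2*pi}"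
    using has_integral_stretch_real_iff[of "2 * pi" G _ 0 "2*pi"] 1 unfolding im by simp
  then have "(G has_integral 2 * pi * (taylor_coeff f n * of_real t ^ n)) {0..2*pi}"
    by (simp add: scaleR_conv_of_real mult_ac)
  moreover have "integrable (lebesgue_on {0..2*pi}) G"
    by (rule continuous_imp_integrable_real[OF cG])
  ultimately show ?thesis
    unfolding G_def[symmetric]
    by (intro has_integral_unique[OF has_integral_integral_lebesgue_on]) auto
qed


section \<open>Quadratic means on circles\<close>

lemma circle_continuous:
  assumes "0 \<le> t" "continuous_on (cball 0 t) f"
  shows "continuous_on {0..2*pi} (\<lambda>\<theta>. f (of_real t * cis \<theta>))"
  by (intro continuous_intros continuous_on_compose2[OF assms(2)]) (use assms(1) in \<open>auto simp: norm_mult\<close>)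

text \<open>Expanding the square of \<open>f - P\<close> for the Taylor polynomial \<open>P\<close>
  of degree below \<open>n\<close> gives the bound, with no convergence of the Taylor series on the
  circle itself.\<close>

lemma circle_Bessel:
  assumes t: "0 < t" and f: "f holomorphic_on ball 0 t" "continuous_on (cball 0 t) f"
  shows "(\<Sum>k<n. (cmod (taylor_coeff f k) * t ^ k)\<^sup>2) * (2 * pi) \<le>
    (LINT \<theta>|lebesgue_on {0..2*pi}. (cmod (f (of_real t * cis \<theta>)))\<^sup>2)"
proof -
  define a where "a = (\<lambda>k. taylor_coeff f k * of_real t ^ k)"
  define P where "P = (\<lambda>z. \<Sum>k<n. taylor_coeff f k * z ^ k)"
  define S where "S \<theta> = P (of_real t * cis \<theta>)" for \<theta>
  define F where "F \<theta> = f (of_real t * cis \<theta>)" for \<theta>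
  have P: "P holomorphic_on A" "continuous_on A P" for A
    unfolding P_def by (intro holomorphic_intros continuous_intros)+
  have cF: "continuous_on {0..2*pi} F" and cS: "continuous_on {0..2*pi} S"
    unfolding F_def S_def using t f P by (intro circle_continuous; simp)+
  have tcP: "taylor_coeff P k = taylor_coeff f k" if "k < n" for k
    using that unfolding P_def
    by (subst taylor_coeff_sum[of 1]) (auto intro!: holomorphic_intros simp: taylor_coeff_monomial if_distrib cong: if_cong)
  have S: "cnj (S \<theta>) = (\<Sum>k<n. cnj (a k) * cis (- real k * \<theta>))" for \<theta>
    unfolding S_def P_def a_def
    by (simp add: power_mult_distrib Complex.DeMoivre cis_cnj mult_ac)
  \<comment> \<open>One computation for \<open>g = f\<close> and \<open>g = P\<close>, whose
    coefficients below \<open>n\<close> agree, so both inner products with \<open>S\<close> take the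
    same value.\<close>
  have key: "(LINT \<theta>|lebesgue_on {0..2*pi}. g (of_real t * cis \<theta>) * cnj (S \<theta>)) =
      of_real (2 * pi * (\<Sum>k<n. (cmod (a k))\<^sup>2))"
    if g: "g holomorphic_on ball 0 t" "continuous_on (cball 0 t) g"
      and tg: "\<And>k. k < n \<Longrightarrow> taylor_coeff g k = taylor_coeff f k" for g
  proof -
    have "(LINT \<theta>|lebesgue_on {0..2*pi}. g (of_real t * cis \<theta>) * cnj (S \<theta>)) =
      (LINT \<theta>|lebesgue_on {0..2*pi}. (\<Sum>k<n. cnj (a k) * (g (of_real t * cis \<theta>) * cis (- real k * \<theta>))))"
      unfolding S by (simp add: sum_distrib_left mult_ac)
    also have "\<dots> = (\<Sum>k<n. LINT \<theta>|lebesgue_on {0..2*pi}. cnj (a k) * (g (of_real t * cis \<theta>) * cis (- real k * \<theta>)))"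
      by (intro Bochner_Integration.integral_sum continuous_imp_integrable_real continuous_intros circle_continuous g)
        (use t in auto)
    also have "\<dots> = (\<Sum>k<n. cnj (a k) * (2 * pi * a k))"
    proof (intro sum.cong refl)
      fix k assume "k \<in> {..<n}"
      then show "(LINT \<theta>|lebesgue_on {0..2*pi}. cnj (a k) * (g (of_real t * cis \<theta>) * cis (- real k * \<theta>))) =
          cnj (a k) * (2 * pi * a k)"
        by (simp only: integral_mult_right_zero taylor_coeff_circle[OF t g] a_def tg lessThan_iff)
    qed
    also have "\<dots> = (\<Sum>k<n. of_real (2 * pi * (cmod (a k))\<^sup>2))"
      by (intro sum.cong refl) (simp add: complex_norm_square mult_ac del: of_real_power)
    finally show ?thesis by (simp add: sum_distrib_left)
  qed
  define A where "A = (\<Sum>k<n. (cmod (a k))\<^sup>2)"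
  have 1: "(LINT \<theta>|lebesgue_on {0..2*pi}. Re (F \<theta> * cnj (S \<theta>))) = 2 * pi * A"
    using key[OF f] cF cS unfolding F_def[symmetric] A_def[symmetric]
    by (subst integral_Re) (auto intro!: continuous_imp_integrable_real continuous_intros)
  have 2: "(LINT \<theta>|lebesgue_on {0..2*pi}. Re (S \<theta> * cnj (S \<theta>))) = 2 * pi * A"
    using key[OF P tcP] cS unfolding S_def[symmetric] A_def[symmetric]
    by (subst integral_Re) (auto intro!: continuous_imp_integrable_real continuous_intros)
  have "0 \<le> (LINT \<theta>|lebesgue_on {0..2*pi}. (cmod (F \<theta> - S \<theta>))\<^sup>2)"
    by (intro Bochner_Integration.integral_nonneg) auto
  also have "\<dots> = (LINT \<theta>|lebesgue_on {0..2*pi}. (cmod (F \<theta>))\<^sup>2 - 2 * Re (F \<theta> * cnj (S \<theta>)) + Re (S \<theta> * cnj (S \<theta>)))"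
    by (intro Bochner_Integration.integral_cong refl)
      (simp add: cmod_power2, simp add: power2_eq_square algebra_simps)
  also have "\<dots> = (LINT \<theta>|lebesgue_on {0..2*pi}. (cmod (F \<theta>))\<^sup>2) - 2 * (2 * pi * A) + 2 * pi * A"
  proof -
    have i: "integrable (lebesgue_on {0..2*pi}) (\<lambda>\<theta>. (cmod (F \<theta>))\<^sup>2)"
      "integrable (lebesgue_on {0..2*pi}) (\<lambda>\<theta>. Re (F \<theta> * cnj (S \<theta>)))"
      "integrable (lebesgue_on {0..2*pi}) (\<lambda>\<theta>. Re (S \<theta> * cnj (S \<theta>)))"
      by (intro continuous_imp_integrable_real continuous_intros cF cS)+
    show ?thesis
      by (subst Bochner_Integration.integral_add, (rule Bochner_Integration.integrable_diff i integrable_mult_right)+,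
          subst Bochner_Integration.integral_diff, (rule i integrable_mult_right)+)
        (simp only: integral_mult_right_zero 1 2)
  qed
  finally have "A * (2 * pi) \<le> (LINT \<theta>|lebesgue_on {0..2*pi}. (cmod (F \<theta>))\<^sup>2)" by (simp add: mult_ac)
  then show ?thesis
    using t by (simp add: A_def a_def F_def norm_mult norm_power)
qed

text \<open>The quadratic mean is at most the supremum. The components are added under the integral
  before the bound is used; bounding each of them by \<open>C\<close> would lose a factor depending
  on the dimension.\<close>

lemma hardy_vec_sup_bound:
  fixes Q :: "complex \<Rightarrow> complex ^ 'l"
  assumes t: "0 < t"
    and Q: "\<And>i. (\<lambda>z. Q z $ i) holomorphic_on ball 0 t" "continuous_on (cball 0 t) Q"
    and C: "\<And>z. z \<in> cball 0 t \<Longrightarrow> norm (Q z) \<le> C"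
  defines "q \<equiv> (\<lambda>z. if z \<in> ball 0 t then Q z else 0)"
  shows "q \<in> hardy_vec t" "hardy_vec_norm t q \<le> C"
proof -
  have C0: "0 \<le> C" using C[of 0] t by (auto intro: order_trans[OF norm_ge_zero])
  have Qi: "continuous_on (cball 0 t) (\<lambda>z. Q z $ i)" for i by (intro continuous_intros Q)
  have tc: "taylor_coeff (\<lambda>z. q z $ i) k = taylor_coeff (\<lambda>z. Q z $ i) k" for i k
    by (rule taylor_coeff_cong[OF t]) (simp add: q_def)
  define X where "X = (\<lambda>i k. (cmod (taylor_coeff (\<lambda>z. q z $ i) k) * t ^ k)\<^sup>2)"
  have part: "(\<Sum>i\<in>UNIV. \<Sum>k<n. X i k) \<le> C\<^sup>2" for n
  proof -
    have "(\<Sum>i\<in>UNIV. \<Sum>k<n. X i k) * (2 * pi) \<le>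
        (\<Sum>i\<in>UNIV. LINT \<theta>|lebesgue_on {0..2*pi}. (cmod (Q (of_real t * cis \<theta>) $ i))\<^sup>2)"
      unfolding X_def tc sum_distrib_right[where r = "2*pi"]
      by (intro sum_mono) (use circle_Bessel[OF t Q(1) Qi] in \<open>simp add: sum_distrib_right\<close>)
    also have "\<dots> = (LINT \<theta>|lebesgue_on {0..2*pi}. (\<Sum>i\<in>UNIV. (cmod (Q (of_real t * cis \<theta>) $ i))\<^sup>2))"
      using t by (intro Bochner_Integration.integral_sum[symmetric] continuous_imp_integrable_real continuous_intros circle_continuous Qi) auto
    also have "\<dots> \<le> (LINT \<theta>|lebesgue_on {0..2*pi}. C\<^sup>2)"
    proof (intro integral_mono)
      fix \<theta>
      have "(\<Sum>i\<in>UNIV. (cmod (Q (of_real t * cis \<theta>) $ i))\<^sup>2) = (norm (Q (of_real t * cis \<theta>)))\<^sup>2"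
        by (simp add: norm_vec_def L2_set_def sum_nonneg)
      also have "\<dots> \<le> C\<^sup>2" using t by (intro power_mono C) (auto simp: norm_mult)
      finally show "(\<Sum>i\<in>UNIV. (cmod (Q (of_real t * cis \<theta>) $ i))\<^sup>2) \<le> C\<^sup>2" .
    qed (use t in \<open>auto intro!: continuous_imp_integrable_real continuous_intros circle_continuous Q(2)\<close>)
    also have "\<dots> = C\<^sup>2 * (2 * pi)" by (simp add: measure_restrict_space)
    finally show ?thesis by simp
  qed
  have s: "summable (X i)" for i
  proof (rule summableI_nonneg_bounded[where x = "C\<^sup>2"])
    fix n
    have "(\<Sum>k<n. X i k) \<le> (\<Sum>i\<in>UNIV. \<Sum>k<n. X i k)"
      by (intro member_le_sum) (auto simp: X_def sum_nonneg)
    then show "(\<Sum>k<n. X i k) \<le> C\<^sup>2" using part[of n] by simp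
  qed (simp add: X_def)
  have "(\<lambda>z. q z $ i) holomorphic_on ball 0 t" for i
    using Q(1)[of i] by (rule holomorphic_transform) (simp add: q_def)
  then show "q \<in> hardy_vec t"
    using s unfolding hardy_vec_def hardy_def analytic_on_disc_def X_def by (simp add: q_def)
  have "(\<Sum>i\<in>UNIV. suminf (X i)) \<le> C\<^sup>2"
  proof (rule LIMSEQ_le_const2)
    show "(\<lambda>n. \<Sum>i\<in>UNIV. \<Sum>k<n. X i k) \<longlonglongrightarrow> (\<Sum>i\<in>UNIV. suminf (X i))"
      by (intro tendsto_sum summable_LIMSEQ s)
  qed (use part in blast)
  moreover have "(hardy_norm t (\<lambda>z. q z $ i))\<^sup>2 = suminf (X i)" for i
  proof -
    have "0 \<le> suminf (X i)" using s[of i] by (rule suminf_nonneg) (simp add: X_def)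
    moreover have "hardy_norm t (\<lambda>z. q z $ i) = sqrt (suminf (X i))"
      by (simp only: hardy_norm_def X_def)
    ultimately show ?thesis by simp
  qed
  ultimately show "hardy_vec_norm t q \<le> C"
    unfolding hardy_vec_norm_def using C0 by (intro real_le_lsqrt) simp_all
qed

subsection \<open>Matrices acting on weighted sequence spaces\<close>

text \<open>Square roots are used so that weighted norms and inner products become those of
  \<open>ltwo\<close>.\<close>

definition wscale :: "(nat \<Rightarrow> real) \<Rightarrow> (nat \<Rightarrow> complex) \<Rightarrow> nat \<Rightarrow> complex" where
  "wscale w x = (\<lambda>n. of_real (sqrt (w n)) * x n)"

definition wltwo :: "(nat \<Rightarrow> real) \<Rightarrow> (nat \<Rightarrow> complex) set" where
  "wltwo w = {x. wscale w x \<in> ltwo}"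

definition wpow :: "real \<Rightarrow> nat \<Rightarrow> real" where
  "wpow \<alpha> n = (real n + 1) powr \<alpha>"

lemma wpow_pos: "0 < wpow \<alpha> n"
  by (simp add: wpow_def)

lemma wscale_add: "wscale w (\<lambda>n. x n + y n) = (\<lambda>n. wscale w x n + wscale w y n)"
  by (simp add: wscale_def distrib_left)

lemma wscale_diff: "wscale w (\<lambda>n. x n - y n) = (\<lambda>n. wscale w x n - wscale w y n)"
  by (simp add: wscale_def right_diff_distrib)

lemma wscale_cmult: "wscale w (\<lambda>n. c * x n) = (\<lambda>n. c * wscale w x n)"
  by (simp add: wscale_def mult_ac)

lemma wltwo_add: "x \<in> wltwo w \<Longrightarrow> y \<in> wltwo w \<Longrightarrow> (\<lambda>n. x n + y n) \<in> wltwo w"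
  by (simp add: wltwo_def wscale_add ltwo_add)

lemma wltwo_cmult: "x \<in> wltwo w \<Longrightarrow> (\<lambda>n. c * x n) \<in> wltwo w"
  by (simp add: wltwo_def wscale_cmult ltwo_cmult)

lemma wltwo_finite: "finite {n. x n \<noteq> 0} \<Longrightarrow> x \<in> wltwo w"
  unfolding wltwo_def ltwo_def wscale_def
  by (auto intro!: summable_finite[of "{n. x n \<noteq> 0}"])

lemma norm_wscale: "0 \<le> w n \<Longrightarrow> (cmod (wscale w x n))\<^sup>2 = w n * (cmod (x n))\<^sup>2"
  by (simp add: wscale_def norm_mult power_mult_distrib)

text \<open>Summation by parts, in the form of an induction that proves more: the weighted sum of
  the differences is at least the last weight times their nonnegative plain sum.\<close>

lemma weighted_sum_mono:
  fixes A B w :: "nat \<Rightarrow> real"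
  assumes w: "\<And>k. 0 \<le> w k" "\<And>k. w (Suc k) \<le> w k"
    and AB: "\<And>j. (\<Sum>k<j. A k) \<le> (\<Sum>k<j. B k)"
  shows "(\<Sum>k<J. w k * A k) \<le> (\<Sum>k<J. w k * B k)"
proof -
  define D where "D = (\<lambda>k. B k - A k)"
  have D: "0 \<le> (\<Sum>k<j. D k)" for j using AB[of j] by (simp add: D_def sum_subtractf)
  have "w J * (\<Sum>k<J. D k) \<le> (\<Sum>k<J. w k * D k)"
  proof (induction J)
    case (Suc J)
    have "w (Suc J) * (\<Sum>k<Suc J. D k) \<le> w J * (\<Sum>k<Suc J. D k)"
      by (intro mult_right_mono w D)
    also have "\<dots> = w J * (\<Sum>k<J. D k) + w J * D J" by (simp add: distrib_left)
    also have "\<dots> \<le> (\<Sum>k<Suc J. w k * D k)" using Suc by simp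
    finally show ?case .
  qed simp
  moreover have "0 \<le> w J * (\<Sum>k<J. D k)" by (intro mult_nonneg_nonneg w D)
  ultimately show ?thesis by (simp add: D_def right_diff_distrib sum_subtractf)
qed

text \<open>Power weights are doubling. This pays for index dilations by \<open>C\<close>, and for
  passing between an index and the number of its block of length \<open>m\<close>.\<close>

lemma wpow_dilation:
  assumes "\<alpha> \<le> 0" "1 \<le> C" "i + 1 \<le> C * (k + 1)"
  shows "wpow \<alpha> k \<le> real C powr (- \<alpha>) * wpow \<alpha> i"
proof -
  have "real i + 1 \<le> real C * (real k + 1)"
    using assms(3) by (metis of_nat_1 of_nat_add of_nat_le_iff of_nat_mult)
  then have "(real i + 1) / real C \<le> real k + 1"
    using assms(2) by (simp add: field_simps)
  then have "(real k + 1) powr \<alpha> \<le> ((real i + 1) / real C) powr \<alpha>"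
    using assms by (intro powr_mono2') auto
  also have "\<dots> = real C powr (- \<alpha>) * (real i + 1) powr \<alpha>"
    using assms by (subst powr_divide) (auto simp: powr_minus field_simps)
  finally show ?thesis by (simp add: wpow_def)
qed

text \<open>The entries of \<open>X\<close> in the \<open>k\<close>-th block of length
  \<open>C\<close> are charged to index \<open>k\<close>, at the cost of
  \<open>wpow_dilation\<close>. The constant \<open>T\<close> is charged to index 0, where the
  weight is 1.\<close>

lemma weighted_dilation_bound:
  fixes X Y :: "nat \<Rightarrow> real"
  assumes \<alpha>: "\<alpha> \<le> 0" and C: "1 \<le> C" and X: "\<And>i. 0 \<le> X i" and T: "0 \<le> T"
    and le: "\<And>j. (\<Sum>k<j. Y k) \<le> 2 * (\<Sum>i<j*C. X i) + T"
  shows "(\<Sum>k<J. wpow \<alpha> k * Y k) \<le> 2 * real C powr (- \<alpha>) * (\<Sum>i<J*C. wpow \<alpha> i * X i) + T"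
proof -
  define B where "B = (\<lambda>k. 2 * (\<Sum>i\<in>{k*C..<k*C+C}. X i) + (if k = 0 then T else 0))"
  have TB: "(\<Sum>k<j. (if k = 0 then T else 0) :: real) = (if j = 0 then 0 else T)" for j :: nat
    by (cases j) (auto simp: sum.delta)
  have "(\<Sum>k<J. wpow \<alpha> k * Y k) \<le> (\<Sum>k<J. wpow \<alpha> k * B k)"
  proof (rule weighted_sum_mono)
    fix k show "0 \<le> wpow \<alpha> k" using wpow_pos[of \<alpha> k] by simp
    show "wpow \<alpha> (Suc k) \<le> wpow \<alpha> k"
      unfolding wpow_def using \<alpha> by (intro powr_mono2') auto
    show "(\<Sum>k<j. Y k) \<le> (\<Sum>k<j. B k)" for j
      unfolding B_def sum.distrib sum_distrib_left[symmetric] sum.nat_group TB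
      using le[of j] by (cases "j = 0") auto
  qed
  also have "\<dots> = 2 * (\<Sum>k<J. wpow \<alpha> k * (\<Sum>i\<in>{k*C..<k*C+C}. X i)) + (\<Sum>k<J. wpow \<alpha> k * (if k = 0 then T else 0))"
    by (simp add: B_def distrib_left sum.distrib sum_distrib_left mult_ac)
  also have "(\<Sum>k<J. wpow \<alpha> k * (if k = 0 then T else 0)) = (\<Sum>k<J. (if k = 0 then T else 0))"
    by (intro sum.cong) (auto simp: wpow_def)
  also have "\<dots> \<le> T" using T by (simp add: TB)
  also have "(\<Sum>k<J. wpow \<alpha> k * (\<Sum>i\<in>{k*C..<k*C+C}. X i)) \<le>
      (\<Sum>k<J. \<Sum>i\<in>{k*C..<k*C+C}. real C powr (- \<alpha>) * (wpow \<alpha> i * X i))"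
    unfolding sum_distrib_left
  proof (intro sum_mono)
    fix k i assume "i \<in> {k*C..<k*C+C}"
    then have "i + 1 \<le> C * (k + 1)" by (simp add: algebra_simps)
    from mult_right_mono[OF wpow_dilation[OF \<alpha> C this] X[of i]]
    show "wpow \<alpha> k * X i \<le> real C powr (- \<alpha>) * (wpow \<alpha> i * X i)" by (simp add: mult_ac)
  qed
  also have "\<dots> = real C powr (- \<alpha>) * (\<Sum>i<J*C. wpow \<alpha> i * X i)"
    unfolding sum.nat_group by (simp add: sum_distrib_left)
  finally show ?thesis by simp
qed

text \<open>The constants are uniform in \<open>n\<close>. Nothing is asked of the size of the
  entries with \<open>i\<close> below \<open>C * (n + 1)\<close>; there orthonormality takes
  over.\<close>

definition decaying_orthonormal :: "(nat \<Rightarrow> nat \<Rightarrow> complex) \<Rightarrow> bool" where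
  "decaying_orthonormal v \<longleftrightarrow> (\<forall>n. v n \<in> ltwo) \<and>
    (\<forall>n n'. l2_inner (v n) (v n') = (if n = n' then 1 else 0)) \<and>
    (\<exists>M C \<rho>. 0 \<le> M \<and> 1 \<le> C \<and> 0 < \<rho> \<and> \<rho> < 1 \<and>
      (\<forall>n i. C * (n + 1) \<le> i \<longrightarrow> cmod (v n i) \<le> M * \<rho> ^ i))"

text \<open>The series of \<open>l2_inner x (v n)\<close>, but intended for \<open>x\<close> in a
  larger weighted space, where convergence comes from the decay of \<open>v n\<close>.\<close>

definition coords :: "(nat \<Rightarrow> nat \<Rightarrow> complex) \<Rightarrow> (nat \<Rightarrow> complex) \<Rightarrow> nat \<Rightarrow> complex" where
  "coords v x n = (\<Sum>i. x i * cnj (v n i))"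

text \<open>Split \<open>x\<close> at the index \<open>C (n + 1)\<close>: the low part is controlled by Bessel's inequality, the high part by
  the decay. Since the weights decrease, bounds on the partial sums of squares suffice.\<close>

lemma coords_bounded:
  assumes v: "decaying_orthonormal v" and \<alpha>: "\<alpha> \<le> 0"
  obtains K where "0 \<le> K"
    "\<And>x n. x \<in> wltwo (wpow \<alpha>) \<Longrightarrow> summable (\<lambda>i. cmod (x i * cnj (v n i)))"
    "\<And>x. x \<in> wltwo (wpow \<alpha>) \<Longrightarrow> coords v x \<in> wltwo (wpow \<alpha>)"
    "\<And>x. x \<in> wltwo (wpow \<alpha>) \<Longrightarrow> l2_norm_sq (wscale (wpow \<alpha>) (coords v x)) \<le> K * l2_norm_sq (wscale (wpow \<alpha>) x)"
proof -
  from v obtain M C \<rho> where vl: "\<And>n. v n \<in> ltwo"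
    and on: "\<And>n n'. l2_inner (v n) (v n') = (if n = n' then 1 else 0)"
    and M: "0 \<le> M" and C: "1 \<le> C" and \<rho>: "0 < \<rho>" "\<rho> < 1"
    and dec: "\<And>n i. C * (n + 1) \<le> i \<Longrightarrow> cmod (v n i) \<le> M * \<rho> ^ i"
    unfolding decaying_orthonormal_def by blast
  \<comment> \<open>Majorant for the high part: the decay, divided by the root of the weight for
    Cauchy-Schwarz against the weighted \<open>x\<close>, with a spare factor
    \<open>sqrt (real i + 1)\<close> that pays for a sum over many rows.\<close>
  define e where "e = (\<lambda>i. M * sqrt (real i + 1) * \<rho> ^ i / sqrt (wpow \<alpha> i))"
  have e2: "(e i)\<^sup>2 = M\<^sup>2 * ((real i + 1) powr (1 - \<alpha>) * \<rho> ^ (2 * i))" for i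
    using wpow_pos[of \<alpha> i]
    by (simp add: e_def wpow_def power_mult_distrib power_divide powr_diff powr_minus field_simps power_mult flip: power_mult_distrib)
      (simp add: power2_eq_square power_mult_distrib power_even_eq algebra_simps)
  have se: "summable (\<lambda>i. (e i)\<^sup>2)"
    unfolding e2
  proof (intro summable_mult)
    define q where "q = 1 - \<alpha>"
    have q: "q > 0" using \<alpha> by (simp add: q_def)
    have "(\<lambda>i. (real i + 1) powr q * \<rho> ^ (2 * i)) \<in> O(\<lambda>i. \<rho> ^ i)"
      using q \<rho> by real_asymp
    moreover have "summable (\<lambda>i. norm (\<rho> ^ i))" using \<rho> by simp
    ultimately show "summable (\<lambda>i. (real i + 1) powr (1 - \<alpha>) * \<rho> ^ (2 * i))"
      unfolding q_def by (rule summable_comparison_test_bigo[rotated])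
  qed
  define E where "E = (\<Sum>i. (e i)\<^sup>2)"
  have E: "0 \<le> E" unfolding E_def using se by (rule suminf_nonneg) simp
  define K where "K = 2 * real C powr (- \<alpha>) + 2 * E"
  have K: "0 \<le> K" using E by (simp add: K_def)
  have main: "(\<forall>n. summable (\<lambda>i. cmod (x i * cnj (v n i)))) \<and> coords v x \<in> wltwo (wpow \<alpha>) \<and>
      l2_norm_sq (wscale (wpow \<alpha>) (coords v x)) \<le> K * l2_norm_sq (wscale (wpow \<alpha>) x)"
    if x: "x \<in> wltwo (wpow \<alpha>)" for x
  proof -
    define W where "W = l2_norm_sq (wscale (wpow \<alpha>) x)"
    define b where "b = (\<lambda>i. sqrt (wpow \<alpha> i) * cmod (x i))"
    have b2: "(b i)\<^sup>2 = (cmod (wscale (wpow \<alpha>) x i))\<^sup>2" for i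
      using wpow_pos[of \<alpha> i] by (simp add: b_def norm_wscale power_mult_distrib)
    have sb: "summable (\<lambda>i. (b i)\<^sup>2)" using x unfolding b2 wltwo_def ltwo_def by simp
    have W: "W = (\<Sum>i. (b i)\<^sup>2)" by (simp add: W_def l2_norm_sq_def b2)
    have W0: "0 \<le> W" unfolding W using sb by (rule suminf_nonneg) simp
    have eb: "\<bar>e i * b i\<bar> = sqrt (real i + 1) * (M * \<rho> ^ i * cmod (x i))" for i
      using wpow_pos[of \<alpha> i] M \<rho> by (simp add: e_def b_def abs_mult)
    have seb: "summable (\<lambda>i. \<bar>e i * b i\<bar>)" by (rule summable_mult_L2[OF se sb])
    define T where "T = (\<Sum>i. \<bar>e i * b i\<bar>)"
    have T: "0 \<le> T" "T\<^sup>2 \<le> E * W"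
    proof -
      show "0 \<le> T" unfolding T_def using seb by (rule suminf_nonneg) simp
      have "T \<le> sqrt E * sqrt W" unfolding T_def E_def W by (rule suminf_Cauchy_Schwarz[OF se sb])
      then have "T\<^sup>2 \<le> (sqrt E * sqrt W)\<^sup>2" using \<open>0 \<le> T\<close> by (rule power_mono)
      then show "T\<^sup>2 \<le> E * W" using E W0 by (simp add: power_mult_distrib)
    qed
    have dec': "cmod (x i * cnj (v n i)) \<le> M * \<rho> ^ i * cmod (x i)" if "C * (n + 1) \<le> i" for n i
      using mult_right_mono[OF dec[OF that], of "cmod (x i)"] by (simp add: norm_mult mult_ac)
    have dec'': "cmod (x i * cnj (v n i)) \<le> \<bar>e i * b i\<bar>" if "C * (n + 1) \<le> i" for n i
    proof -
      have "1 * (M * \<rho> ^ i * cmod (x i)) \<le> \<bar>e i * b i\<bar>"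
        unfolding eb using M \<rho> by (intro mult_right_mono) auto
      then show ?thesis using dec'[OF that] by simp
    qed
    have sv: "summable (\<lambda>i. cmod (x i * cnj (v n i)))" for n
      by (rule summable_comparison_test'[OF seb, of "C * (n + 1)"]) (use dec'' in auto)
    have "(\<Sum>n<j. (cmod (coords v x n))\<^sup>2) \<le> 2 * (\<Sum>i<j*C. (cmod (x i))\<^sup>2) + 2 * T\<^sup>2" for j
    proof -
      define lo where "lo = (\<lambda>i. if i < j * C then x i else 0)"
      define hi where "hi = (\<lambda>i. if i < j * C then 0 else x i)"
      have slo: "summable (\<lambda>i. lo i * cnj (v n i))" for n
        by (rule summable_finite[of "{..<j*C}"]) (auto simp: lo_def)
      have shi: "summable (\<lambda>i. cmod (hi i * cnj (v n i)))" for n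
        by (rule summable_comparison_test'[OF sv[of n], of 0]) (auto simp: hi_def)
      have split: "coords v x n = coords v lo n + coords v hi n" for n
        unfolding coords_def
        by (subst suminf_add[OF slo summable_norm_cancel[OF shi]])
          (auto intro!: suminf_cong simp: lo_def hi_def)
      have lol: "lo \<in> ltwo"
        unfolding ltwo_def by (auto intro!: summable_finite[of "{..<j*C}"] simp: lo_def split: if_splits)
      have "(\<Sum>n<j. (cmod (coords v lo n))\<^sup>2) = (\<Sum>n<j. (cmod (l2_inner lo (v n)))\<^sup>2)"
        by (simp add: coords_def l2_inner_def)
      also have "\<dots> \<le> l2_norm_sq lo" by (rule l2_norm_sq_Bessel) (use lol vl on in auto)
      also have "\<dots> = (\<Sum>i<j*C. (cmod (x i))\<^sup>2)"
        unfolding l2_norm_sq_def by (subst suminf_finite[of "{..<j*C}"]) (auto simp: lo_def)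
      finally have 1: "(\<Sum>n<j. (cmod (coords v lo n))\<^sup>2) \<le> (\<Sum>i<j*C. (cmod (x i))\<^sup>2)" .
      \<comment> \<open>Where \<open>hi\<close> is nonzero, \<open>i\<close> is at least
        \<open>j * C\<close> and so at least \<open>j\<close>: the spare root in \<open>e\<close>
        absorbs \<open>sqrt (real j)\<close>. Each of the \<open>j\<close> rows thus contributes at
        most the \<open>j\<close>-th part of the square of \<open>T\<close>.\<close>
      have 2: "real j * (cmod (coords v hi n))\<^sup>2 \<le> T\<^sup>2" if "n < j" for n
      proof -
        have "sqrt (real j) * cmod (coords v hi n) \<le> sqrt (real j) * (\<Sum>i. cmod (hi i * cnj (v n i)))"
          unfolding coords_def by (intro mult_left_mono summable_norm shi) auto
        also have "\<dots> = (\<Sum>i. sqrt (real j) * cmod (hi i * cnj (v n i)))"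
          by (rule suminf_mult[OF shi, symmetric])
        also have "\<dots> \<le> T"
          unfolding T_def
        proof (rule suminf_le[OF _ summable_mult[OF shi] seb])
          fix i
          show "sqrt (real j) * cmod (hi i * cnj (v n i)) \<le> \<bar>e i * b i\<bar>"
          proof (cases "i < j * C")
            case False
            have "C * (n + 1) \<le> C * j" using that by (intro mult_le_mono) auto
            then have "C * (n + 1) \<le> i" using False by (simp add: mult.commute)
            moreover have "j * 1 \<le> j * C" using C by (intro mult_le_mono) auto
            then have "real j \<le> real i + 1" using False by linarith
            ultimately show ?thesis
              unfolding eb using False dec'[of n i] by (intro mult_mono) (auto simp: hi_def)
          qed (auto simp: hi_def)
        qed
        finally have "(sqrt (real j) * cmod (coords v hi n))\<^sup>2 \<le> T\<^sup>2"
          by (intro power_mono) auto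
        then show ?thesis by (simp add: power_mult_distrib)
      qed
      have 3: "(\<Sum>n<j. (cmod (coords v hi n))\<^sup>2) \<le> T\<^sup>2"
      proof (cases "j = 0")
        case False
        have "real j * (\<Sum>n<j. (cmod (coords v hi n))\<^sup>2) \<le> (\<Sum>n<j. T\<^sup>2)"
          unfolding sum_distrib_left by (intro sum_mono 2) auto
        then show ?thesis using False by simp
      qed simp
      have "(\<Sum>n<j. (cmod (coords v x n))\<^sup>2) \<le>
          (\<Sum>n<j. 2 * (cmod (coords v lo n))\<^sup>2 + 2 * (cmod (coords v hi n))\<^sup>2)"
      proof (intro sum_mono)
        fix n
        have "(cmod (coords v x n))\<^sup>2 \<le> (cmod (coords v lo n) + cmod (coords v hi n))\<^sup>2"
          unfolding split by (intro power_mono norm_triangle_ineq) auto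
        also have "\<dots> \<le> 2 * (cmod (coords v lo n))\<^sup>2 + 2 * (cmod (coords v hi n))\<^sup>2"
          using sum_squares_bound[of "cmod (coords v lo n)" "cmod (coords v hi n)"] by (simp add: power2_sum)
        finally show "(cmod (coords v x n))\<^sup>2 \<le> 2 * (cmod (coords v lo n))\<^sup>2 + 2 * (cmod (coords v hi n))\<^sup>2" .
      qed
      then show ?thesis using 1 3 by (simp add: sum.distrib sum_distrib_left[symmetric])
    qed
    from weighted_dilation_bound[OF \<alpha> C _ _ this]
    have *: "(\<Sum>n<J. wpow \<alpha> n * (cmod (coords v x n))\<^sup>2) \<le>
      2 * real C powr (- \<alpha>) * (\<Sum>i<J*C. wpow \<alpha> i * (cmod (x i))\<^sup>2) + 2 * T\<^sup>2" for J by simp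
    have **: "(\<Sum>n<J. (cmod (wscale (wpow \<alpha>) (coords v x) n))\<^sup>2) \<le> K * W" for J
    proof -
      have "(\<Sum>i<J*C. wpow \<alpha> i * (cmod (x i))\<^sup>2) \<le> W"
      proof -
        have "(\<Sum>i<J*C. wpow \<alpha> i * (cmod (x i))\<^sup>2) = (\<Sum>i<J*C. (b i)\<^sup>2)"
          by (intro sum.cong refl) (simp add: b2 norm_wscale wpow_pos less_imp_le)
        also have "\<dots> \<le> W" unfolding W by (intro sum_le_suminf sb) auto
        finally show ?thesis .
      qed
      then have "2 * real C powr (- \<alpha>) * (\<Sum>i<J*C. wpow \<alpha> i * (cmod (x i))\<^sup>2) \<le> 2 * real C powr (- \<alpha>) * W"
        by (intro mult_left_mono) auto
      then have "2 * real C powr (- \<alpha>) * (\<Sum>i<J*C. wpow \<alpha> i * (cmod (x i))\<^sup>2) + 2 * T\<^sup>2 \<le> K * W"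
        using T by (simp add: K_def algebra_simps)
      then show ?thesis using *[of J] by (simp add: norm_wscale wpow_pos less_imp_le)
    qed
    have s: "summable (\<lambda>n. (cmod (wscale (wpow \<alpha>) (coords v x) n))\<^sup>2)"
      by (rule summableI_nonneg_bounded[OF _ **]) simp
    have "l2_norm_sq (wscale (wpow \<alpha>) (coords v x)) \<le> K * W"
      unfolding l2_norm_sq_def by (rule suminf_le_const[OF s **])
    with s sv show ?thesis by (simp add: W_def wltwo_def ltwo_def)
  qed
  show ?thesis by (rule that[OF K]) (use main in blast)+
qed

lemma coords_add:
  assumes v: "decaying_orthonormal v" and \<alpha>: "\<alpha> \<le> 0"
    and xy: "x \<in> wltwo (wpow \<alpha>)" "y \<in> wltwo (wpow \<alpha>)"
  shows "coords v (\<lambda>n. x n + c * y n) = (\<lambda>n. coords v x n + c * coords v y n)"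
proof
  fix n
  have "summable (\<lambda>i. cmod (x i * cnj (v n i)))" if "x \<in> wltwo (wpow \<alpha>)" for x
    by (rule coords_bounded[OF v \<alpha>]) (use that in blast)
  from this[THEN summable_norm_cancel] have s: "summable (\<lambda>i. x i * cnj (v n i))" "summable (\<lambda>i. y i * cnj (v n i))"
    using xy by auto
  show "coords v (\<lambda>n. x n + c * y n) n = coords v x n + c * coords v y n"
    unfolding coords_def suminf_mult[OF s(2), symmetric] suminf_add[OF s(1) summable_mult[OF s(2)]]
    by (simp add: algebra_simps)
qed

lemma wltwo_tail:
  assumes x: "x \<in> wltwo w"
  defines "d \<equiv> \<lambda>J n. if n < J then 0 else x n"
  shows "d J \<in> wltwo w" "(\<lambda>J. l2_norm_sq (wscale w (d J))) \<longlonglongrightarrow> 0"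
proof -
  show d: "d J \<in> wltwo w" for J
    unfolding wltwo_def ltwo_def
  proof (rule CollectI, rule CollectI, rule summable_comparison_test'[of "\<lambda>n. (cmod (wscale w x n))\<^sup>2" 0])
    show "summable (\<lambda>n. (cmod (wscale w x n))\<^sup>2)" using x by (simp add: wltwo_def ltwo_def)
  qed (auto simp: d_def wscale_def)
  have "l2_norm_sq (wscale w (d J)) = (\<Sum>n. (cmod (wscale w x (n + J)))\<^sup>2)" for J
  proof -
    have "l2_norm_sq (wscale w (d J)) = (\<Sum>n. (cmod (wscale w (d J) (n + J)))\<^sup>2) + (\<Sum>n<J. (cmod (wscale w (d J) n))\<^sup>2)"
      unfolding l2_norm_sq_def by (rule suminf_split_initial_segment) (use d[of J] in \<open>simp add: wltwo_def ltwo_def\<close>)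
    then show ?thesis by (simp add: wscale_def d_def)
  qed
  moreover have "(\<lambda>J. \<Sum>n. (cmod (wscale w x (n + J)))\<^sup>2) \<longlonglongrightarrow> 0"
    by (rule suminf_exist_split2) (use x in \<open>simp add: wltwo_def ltwo_def\<close>)
  ultimately show "(\<lambda>J. l2_norm_sq (wscale w (d J))) \<longlonglongrightarrow> 0" by simp
qed

text \<open>For finitely supported sequences the inversion is the orthonormality of the columns; the
  general case follows by density and boundedness.\<close>

lemma coords_inverse:
  assumes v: "decaying_orthonormal v" and v': "decaying_orthonormal (\<lambda>i n. cnj (v n i))"
    and \<alpha>: "\<alpha> \<le> 0" and x: "x \<in> wltwo (wpow \<alpha>)"
  shows "coords (\<lambda>i n. cnj (v n i)) (coords v x) = x"
proof -
  define u where "u = (\<lambda>i n. cnj (v n i))"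
  have u: "decaying_orthonormal u" using v' by (simp add: u_def)
  obtain K where K: "0 \<le> K" "\<And>x n. x \<in> wltwo (wpow \<alpha>) \<Longrightarrow> summable (\<lambda>i. cmod (x i * cnj (v n i)))"
    "\<And>x. x \<in> wltwo (wpow \<alpha>) \<Longrightarrow> coords v x \<in> wltwo (wpow \<alpha>)"
    "\<And>x. x \<in> wltwo (wpow \<alpha>) \<Longrightarrow> l2_norm_sq (wscale (wpow \<alpha>) (coords v x)) \<le> K * l2_norm_sq (wscale (wpow \<alpha>) x)"
    by (rule coords_bounded[OF v \<alpha>]) (rule that; blast)
  obtain K' where K': "0 \<le> K'" "\<And>x n. x \<in> wltwo (wpow \<alpha>) \<Longrightarrow> summable (\<lambda>i. cmod (x i * cnj (u n i)))"
    "\<And>x. x \<in> wltwo (wpow \<alpha>) \<Longrightarrow> coords u x \<in> wltwo (wpow \<alpha>)"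
    "\<And>x. x \<in> wltwo (wpow \<alpha>) \<Longrightarrow> l2_norm_sq (wscale (wpow \<alpha>) (coords u x)) \<le> K' * l2_norm_sq (wscale (wpow \<alpha>) x)"
    by (rule coords_bounded[OF u \<alpha>]) (rule that; blast)
  define S where "S = (\<lambda>x. coords u (coords v x))"
  have S_add: "S (\<lambda>n. x n + c * y n) = (\<lambda>n. S x n + c * S y n)"
    if "x \<in> wltwo (wpow \<alpha>)" "y \<in> wltwo (wpow \<alpha>)" for x y c
    unfolding S_def using that K(3)
    by (simp add: coords_add[OF v \<alpha>] coords_add[OF u \<alpha>])
  define cut where "cut = (\<lambda>J i. if i < J then x i else 0)"
  have cutw: "cut J \<in> wltwo (wpow \<alpha>)" for J
    by (rule wltwo_finite, rule finite_subset[of _ "{..<J}"]) (auto simp: cut_def)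
  have unit: "S (\<lambda>n. if n = j then 1 else 0) = (\<lambda>n. if n = j then 1 else 0)" for j :: nat
  proof
    fix i
    have "coords v (\<lambda>n. if n = j then 1 else 0) n = u j n" for n
      unfolding coords_def u_def by (subst suminf_finite[of "{j}"]) auto
    then have "coords v (\<lambda>n. if n = j then 1 else 0) = u j" by auto
    then have "S (\<lambda>n. if n = j then 1 else 0) i = l2_inner (u j) (u i)"
      by (simp add: S_def coords_def[of u] l2_inner_def)
    then show "S (\<lambda>n. if n = j then 1 else 0) i = (if i = j then 1 else 0)"
      using u by (auto simp: decaying_orthonormal_def)
  qed
  have Scut: "S (cut J) = cut J" for J
  proof (induction J)
    case 0
    have "cut 0 = (\<lambda>n. 0)" by (simp add: cut_def)
    then show ?case by (simp add: S_def coords_def)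
  next
    case (Suc J)
    have e: "cut (Suc J) = (\<lambda>n. cut J n + x J * (if n = J then 1 else 0))"
      by (auto simp: cut_def less_Suc_eq)
    show ?case
      unfolding e by (subst S_add[OF cutw]) (auto simp: Suc unit intro!: wltwo_finite)
  qed
  show ?thesis
  proof
    fix i
    define d where "d J = (\<lambda>n. if n < J then 0 else x n)" for J
    have d: "d J \<in> wltwo (wpow \<alpha>)" for J unfolding d_def by (rule wltwo_tail[OF x])
    have lim: "(\<lambda>J. l2_norm_sq (wscale (wpow \<alpha>) (d J))) \<longlonglongrightarrow> 0" unfolding d_def by (rule wltwo_tail[OF x])
    have bound: "wpow \<alpha> i * (cmod (S x i - x i))\<^sup>2 \<le> K' * (K * l2_norm_sq (wscale (wpow \<alpha>) (d J)))" if "i < J" for J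
    proof -
      have "S (\<lambda>n. x n + (-1) * cut J n) = (\<lambda>n. S x n + (-1) * S (cut J) n)"
        by (rule S_add[OF x cutw])
      moreover have "d J = (\<lambda>n. x n + (-1) * cut J n)" by (auto simp: d_def cut_def)
      ultimately have "S (d J) i = S x i - x i" using that by (simp add: Scut) (simp add: cut_def)
      then have "wpow \<alpha> i * (cmod (S x i - x i))\<^sup>2 = (cmod (wscale (wpow \<alpha>) (S (d J)) i))\<^sup>2"
        by (simp add: norm_wscale wpow_pos less_imp_le)
      also have "\<dots> \<le> l2_norm_sq (wscale (wpow \<alpha>) (S (d J)))"
        by (rule l2_norm_sq_component) (use K'(3)[OF K(3)[OF d[of J]]] in \<open>simp add: S_def wltwo_def\<close>)
      also have "\<dots> \<le> K' * l2_norm_sq (wscale (wpow \<alpha>) (coords v (d J)))"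
        unfolding S_def by (rule K'(4)[OF K(3)[OF d]])
      also have "\<dots> \<le> K' * (K * l2_norm_sq (wscale (wpow \<alpha>) (d J)))"
        by (intro mult_left_mono K(4) d K'(1))
      finally show ?thesis .
    qed
    have "wpow \<alpha> i * (cmod (S x i - x i))\<^sup>2 \<le> 0"
    proof (rule LIMSEQ_le_const)
      show "(\<lambda>J. K' * (K * l2_norm_sq (wscale (wpow \<alpha>) (d J)))) \<longlonglongrightarrow> 0"
        using tendsto_mult_right_zero[OF tendsto_mult_right_zero[OF lim]] by simp
      show "\<exists>N. \<forall>n\<ge>N. wpow \<alpha> i * (cmod (S x i - x i))\<^sup>2 \<le> K' * (K * l2_norm_sq (wscale (wpow \<alpha>) (d n)))"
        using bound by (auto intro!: exI[of _ "Suc i"])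
    qed
    then have "(cmod (S x i - x i))\<^sup>2 \<le> 0" using wpow_pos[of \<alpha> i] by (simp add: mult_le_0_iff)
    then show "coords (\<lambda>i n. cnj (v n i)) (coords v x) i = x i"
      unfolding S_def u_def by simp
  qed
qed

subsection \<open>The Hardy space of the disc\<close>

text \<open>Unlike \<open>hardy 1\<close> this asks nothing off the disc, so explicit formulas can
  be used without truncating them.\<close>

definition h2 :: "(complex \<Rightarrow> complex) \<Rightarrow> bool" where
  "h2 f \<longleftrightarrow> f holomorphic_on ball 0 1 \<and> taylor_coeff f \<in> ltwo"

lemma h2_hol: "h2 f \<Longrightarrow> f holomorphic_on ball 0 1"
  and h2_ltwo: "h2 f \<Longrightarrow> taylor_coeff f \<in> ltwo"
  by (auto simp: h2_def)

lemma taylor_coeff_cong1: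
  assumes "\<And>z. z \<in> ball 0 1 \<Longrightarrow> f z = g z"
  shows "taylor_coeff f = taylor_coeff g"
  by (rule ext, rule taylor_coeff_cong[OF zero_less_one]) (rule assms)

lemma taylor_coeff_add1:
  "f holomorphic_on ball 0 1 \<Longrightarrow> g holomorphic_on ball 0 1 \<Longrightarrow>
    taylor_coeff (\<lambda>z. f z + g z) = (\<lambda>k. taylor_coeff f k + taylor_coeff g k)"
  by (rule ext) (rule taylor_coeff_add[OF zero_less_one])

lemma taylor_coeff_diff1:
  "f holomorphic_on ball 0 1 \<Longrightarrow> g holomorphic_on ball 0 1 \<Longrightarrow>
    taylor_coeff (\<lambda>z. f z - g z) = (\<lambda>k. taylor_coeff f k - taylor_coeff g k)"
  by (rule ext) (rule taylor_coeff_diff[OF zero_less_one])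

lemma taylor_coeff_cmult1:
  "f holomorphic_on ball 0 1 \<Longrightarrow> taylor_coeff (\<lambda>z. c * f z) = (\<lambda>k. c * taylor_coeff f k)"
  by (rule ext) (rule taylor_coeff_cmult[OF zero_less_one])

lemma taylor_coeff_sum1:
  "(\<And>i. i \<in> I \<Longrightarrow> f i holomorphic_on ball 0 1) \<Longrightarrow>
    taylor_coeff (\<lambda>z. \<Sum>i\<in>I. c i * f i z) = (\<lambda>k. \<Sum>i\<in>I. c i * taylor_coeff (f i) k)"
  by (rule ext) (rule taylor_coeff_sum[OF zero_less_one])

lemma h2_cong:
  assumes "h2 f" "\<And>z. z \<in> ball 0 1 \<Longrightarrow> f z = g z"
  shows "h2 g"
  using assms holomorphic_transform[of f "ball 0 1" g] taylor_coeff_cong1[of f g]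
  by (auto simp: h2_def)

lemma h2_add: "h2 f \<Longrightarrow> h2 g \<Longrightarrow> h2 (\<lambda>z. f z + g z)"
  by (auto simp: h2_def taylor_coeff_add1 intro!: holomorphic_intros ltwo_add)

lemma h2_diff: "h2 f \<Longrightarrow> h2 g \<Longrightarrow> h2 (\<lambda>z. f z - g z)"
  by (auto simp: h2_def taylor_coeff_diff1 intro!: holomorphic_intros ltwo_diff)

lemma h2_cmult: "h2 f \<Longrightarrow> h2 (\<lambda>z. c * f z)"
  by (auto simp: h2_def taylor_coeff_cmult1 intro!: holomorphic_intros ltwo_cmult)

lemma h2_sum: "(\<And>i. i \<in> I \<Longrightarrow> h2 (f i)) \<Longrightarrow> h2 (\<lambda>z. \<Sum>i\<in>I. c i * f i z)"
  unfolding h2_def by (auto simp: taylor_coeff_sum1 intro!: holomorphic_intros ltwo_sum)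

lemma hardy_1_iff: "f \<in> hardy 1 \<longleftrightarrow> h2 f \<and> (\<forall>z. z \<notin> ball 0 1 \<longrightarrow> f z = 0)"
  by (auto simp: hardy_def h2_def analytic_on_disc_def ltwo_def)

lemma hardy_inner_1: "hardy_inner 1 f g = l2_inner (taylor_coeff f) (taylor_coeff g)"
  by (simp add: hardy_inner_def l2_inner_def)

lemma hardy_norm_1: "hardy_norm 1 f = sqrt (l2_norm_sq (taylor_coeff f))"
  by (simp add: hardy_norm_def l2_norm_sq_def)

section \<open>Multiplication and division by a Moebius factor\<close>

lemma moebius_denominator_nonzero:
  assumes "cmod a < 1" "cmod z \<le> 1"
  shows "1 - cnj a * z \<noteq> 0"
proof
  assume "1 - cnj a * z = 0"
  then have "cmod (cnj a * z) = 1" by (metis eq_iff_diff_eq_0 norm_one)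
  moreover have "cmod a * cmod z \<le> cmod a * 1" using assms by (intro mult_left_mono) auto
  ultimately show False using assms by (simp add: norm_mult)
qed

lemma taylor_coeff_linear_mult:
  assumes "g holomorphic_on ball 0 1"
  shows "taylor_coeff (\<lambda>z. (p * z + q) * g z) k =
    q * taylor_coeff g k + (if k = 0 then 0 else p * taylor_coeff g (k - 1))"
proof -
  have "taylor_coeff (\<lambda>z. q * g z + p * (z * g z)) k =
      taylor_coeff (\<lambda>z. q * g z) k + taylor_coeff (\<lambda>z. p * (z * g z)) k"
    by (rule taylor_coeff_add[OF zero_less_one]) (intro holomorphic_intros assms)+
  also have "taylor_coeff (\<lambda>z. p * (z * g z)) k = p * taylor_coeff (\<lambda>z. z * g z) k"
    by (rule taylor_coeff_cmult[OF zero_less_one]) (intro holomorphic_intros assms)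
  finally show ?thesis
    using assms by (simp add: taylor_coeff_cmult[OF zero_less_one] taylor_coeff_shift[OF zero_less_one] algebra_simps)
qed

text \<open>The coefficients of \<open>g\<close> satisfy a recursion that is solved forwards: each
  one is a coefficient of the product plus \<open>a\<close> times the next one. Iteration sums a
  geometric series, and the remainder vanishes because the radius of convergence is at least
  1.\<close>

lemma division_coeff_bound:
  assumes g: "g holomorphic_on ball 0 1" and a: "cmod a < 1"
    and \<epsilon>: "\<And>i. k < i \<Longrightarrow> cmod (taylor_coeff (\<lambda>z. (z - a) * g z) i) \<le> \<epsilon>"
  shows "cmod (taylor_coeff g k) \<le> \<epsilon> / (1 - cmod a)"
proof -
  define G where "G = taylor_coeff g"
  have v: "taylor_coeff (\<lambda>z. (z - a) * g z) (Suc i) = G i - a * G (Suc i)" for i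
    using taylor_coeff_linear_mult[OF g, of 1 "-a" "Suc i"] by (simp add: G_def)
  have \<epsilon>0: "0 \<le> \<epsilon>" using \<epsilon>[of "Suc k"] norm_ge_zero order_trans by blast
  have step: "cmod (G i) \<le> \<epsilon> + cmod a * cmod (G (Suc i))" if "k \<le> i" for i
  proof -
    have "cmod (G i) \<le> cmod (G i - a * G (Suc i)) + cmod (a * G (Suc i))"
      using norm_triangle_ineq[of "G i - a * G (Suc i)" "a * G (Suc i)"] by simp
    then show ?thesis using \<epsilon>[of "Suc i"] that by (simp add: v norm_mult)
  qed
  have it: "cmod (G k) \<le> \<epsilon> / (1 - cmod a) + cmod a ^ J * cmod (G (k + J))" for J
  proof (induction J)
    case 0
    then show ?case using \<epsilon>0 a by simp
  next
    case (Suc J)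
    have "cmod (G k) \<le> \<epsilon> * (\<Sum>j<J. cmod a ^ j) + cmod a ^ J * cmod (G (k + J))" for J
    proof (induction J)
      case (Suc J)
      have "cmod a ^ J * cmod (G (k + J)) \<le> cmod a ^ J * (\<epsilon> + cmod a * cmod (G (Suc (k + J))))"
        by (intro mult_left_mono step) auto
      with Suc show ?case by (simp add: algebra_simps)
    qed simp
    from this[of "Suc J"] have "cmod (G k) \<le> \<epsilon> * (\<Sum>j<Suc J. cmod a ^ j) + cmod a ^ Suc J * cmod (G (k + Suc J))" .
    moreover have "(\<Sum>j<Suc J. cmod a ^ j) \<le> 1 / (1 - cmod a)"
      using a sum_le_suminf[OF summable_geometric, of "cmod a" "{..<Suc J}"]
      by (simp only: suminf_geometric abs_norm_cancel real_norm_def) auto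
    then have "\<epsilon> * (\<Sum>j<Suc J. cmod a ^ j) \<le> \<epsilon> / (1 - cmod a)"
      using mult_left_mono[OF _ \<epsilon>0] by fastforce
    ultimately show ?case by linarith
  qed
  \<comment> \<open>A radius between \<open>cmod a\<close> and 1, where the power series of
    \<open>g\<close> converges and its terms tend to 0; it is positive also for
    \<open>a = 0\<close>.\<close>
  define r where "r = (1 + cmod a) / 2"
  have r: "0 < r" "cmod a \<le> r" "r < 1" using a by (auto simp: r_def add_pos_nonneg)
  have "(\<lambda>i. G i * of_real r ^ i) \<longlonglongrightarrow> 0"
    using taylor_coeff_sums[OF g, of "of_real r"] r unfolding G_def by (intro summable_LIMSEQ_zero) (auto simp: sums_iff)
  then have "(\<lambda>i. cmod (G i) * r ^ i) \<longlonglongrightarrow> 0"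
    using r by (subst (asm) tendsto_norm_zero_iff[symmetric]) (simp add: norm_mult norm_power)
  then have "(\<lambda>J. cmod (G (J + k)) * r ^ (J + k)) \<longlonglongrightarrow> 0" by (rule LIMSEQ_ignore_initial_segment)
  from tendsto_divide[OF this tendsto_const[of "r ^ k"]] r
  have lim: "(\<lambda>J. r ^ J * cmod (G (k + J))) \<longlonglongrightarrow> 0"
    by (simp add: power_add field_simps add.commute)
  have "cmod (G k) \<le> \<epsilon> / (1 - cmod a) + 0"
  proof (rule LIMSEQ_le_const)
    show "(\<lambda>J. \<epsilon> / (1 - cmod a) + r ^ J * cmod (G (k + J))) \<longlonglongrightarrow> \<epsilon> / (1 - cmod a) + 0"
      by (intro tendsto_intros lim)
    have "cmod (G k) \<le> \<epsilon> / (1 - cmod a) + r ^ J * cmod (G (k + J))" for J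
    proof -
      have "cmod a ^ J * cmod (G (k + J)) \<le> r ^ J * cmod (G (k + J))"
        using r by (intro mult_right_mono power_mono) auto
      then show ?thesis using it[of J] by linarith
    qed
    then show "\<exists>N. \<forall>n\<ge>N. cmod (G k) \<le> \<epsilon> / (1 - cmod a) + r ^ n * cmod (G (k + n))" by blast
  qed
  then show ?thesis by (simp add: G_def)
qed

text \<open>The two sums differ by a telescoping series because
  \<open>|x - a y|\<^sup>2 - |y - cnj a x|\<^sup>2 = (1 - |a|\<^sup>2) (|x|\<^sup>2 - |y|\<^sup>2)\<close>.\<close>

lemma moebius_partial_sums:
  assumes g: "g holomorphic_on ball 0 1"
  shows "(\<Sum>k<Suc n. (cmod (taylor_coeff (\<lambda>z. (z - a) * g z) k))\<^sup>2) + (1 - (cmod a)\<^sup>2) * (cmod (taylor_coeff g n))\<^sup>2 =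
    (\<Sum>k<Suc n. (cmod (taylor_coeff (\<lambda>z. (1 - cnj a * z) * g z) k))\<^sup>2)"
proof -
  define G where "G = taylor_coeff g"
  have v: "taylor_coeff (\<lambda>z. (z - a) * g z) k = (if k = 0 then 0 else G (k - 1)) - a * G k" for k
    using taylor_coeff_linear_mult[OF g, of 1 "-a" k] by (simp add: G_def)
  have w: "taylor_coeff (\<lambda>z. (1 - cnj a * z) * g z) k = G k - (if k = 0 then 0 else cnj a * G (k - 1))" for k
    using taylor_coeff_linear_mult[OF g, of "- cnj a" 1 k] by (simp add: G_def algebra_simps)
  have alg: "(cmod (x - a * y))\<^sup>2 + (1 - (cmod a)\<^sup>2) * (cmod y)\<^sup>2 =
      (1 - (cmod a)\<^sup>2) * (cmod x)\<^sup>2 + (cmod (y - cnj a * x))\<^sup>2" for x y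
    by (simp add: cmod_power2) (simp add: power2_eq_square algebra_simps)
  show ?thesis
    unfolding v w G_def[symmetric]
  proof (induction n)
    case 0
    then show ?case by (simp add: norm_mult power_mult_distrib algebra_simps)
  next
    case (Suc n)
    then show ?case using alg[of "G n" "G (Suc n)"] by simp
  qed
qed

text \<open>In the identity for partial sums the boundary term tends to 0 by
  \<open>division_coeff_bound\<close>. As \<open>g\<close> is merely holomorphic, this serves both
  the isometry property and the division by a factor.\<close>

lemma moebius_quotient_ltwo:
  assumes g: "g holomorphic_on ball 0 1" and a: "cmod a < 1"
    and v: "taylor_coeff (\<lambda>z. (z - a) * g z) \<in> ltwo"
  shows "taylor_coeff (\<lambda>z. (1 - cnj a * z) * g z) \<in> ltwo"
    "l2_norm_sq (taylor_coeff (\<lambda>z. (1 - cnj a * z) * g z)) = l2_norm_sq (taylor_coeff (\<lambda>z. (z - a) * g z))"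
proof -
  define V where "V = taylor_coeff (\<lambda>z. (z - a) * g z)"
  define W where "W = taylor_coeff (\<lambda>z. (1 - cnj a * z) * g z)"
  define G where "G = taylor_coeff g"
  have V: "V \<in> ltwo" using v by (simp add: V_def)
  have eq: "(\<Sum>k<Suc n. (cmod (V k))\<^sup>2) + (1 - (cmod a)\<^sup>2) * (cmod (G n))\<^sup>2 = (\<Sum>k<Suc n. (cmod (W k))\<^sup>2)" for n
    unfolding V_def W_def G_def by (rule moebius_partial_sums[OF g])
  have bd: "cmod (G k) \<le> \<epsilon> / (1 - cmod a)" if "\<And>i. k < i \<Longrightarrow> cmod (V i) \<le> \<epsilon>" for k \<epsilon>
    unfolding G_def by (rule division_coeff_bound[OF g a]) (use that in \<open>simp add: V_def\<close>)
  have "V \<longlonglongrightarrow> 0"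
  proof -
    have "(\<lambda>k. (cmod (V k))\<^sup>2) \<longlonglongrightarrow> 0" using V by (intro summable_LIMSEQ_zero) (simp add: ltwo_def)
    then have "(\<lambda>k. sqrt ((cmod (V k))\<^sup>2)) \<longlonglongrightarrow> sqrt 0" by (intro tendsto_intros)
    then show ?thesis by (simp add: tendsto_norm_zero_iff)
  qed
  have G0: "G \<longlonglongrightarrow> 0"
  proof (rule LIMSEQ_I)
    fix r :: real assume r: "0 < r"
    define e where "e = r / 2 * (1 - cmod a)"
    have "0 < e" using r a by (simp add: e_def)
    then obtain K where K: "\<And>i. K \<le> i \<Longrightarrow> norm (V i - 0) < e"
      using LIMSEQ_D[OF \<open>V \<longlonglongrightarrow> 0\<close>] by blast
    have "norm (G n - 0) < r" if "K \<le> n" for n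
    proof -
      have "cmod (G n) \<le> e / (1 - cmod a)" by (rule bd) (use K that in \<open>force intro: less_imp_le\<close>)
      also have "\<dots> = r / 2" using a by (simp add: e_def field_simps)
      finally show ?thesis using r by simp
    qed
    then show "\<exists>no. \<forall>n\<ge>no. norm (G n - 0) < r" by blast
  qed
  have "(\<lambda>n. \<Sum>k<Suc n. (cmod (V k))\<^sup>2) \<longlonglongrightarrow> l2_norm_sq V"
    unfolding l2_norm_sq_def using V by (intro LIMSEQ_Suc summable_LIMSEQ) (simp add: ltwo_def)
  then have "(\<lambda>n. (\<Sum>k<Suc n. (cmod (V k))\<^sup>2) + (1 - (cmod a)\<^sup>2) * (cmod (G n))\<^sup>2) \<longlonglongrightarrow>
      l2_norm_sq V + (1 - (cmod a)\<^sup>2) * (cmod 0)\<^sup>2"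
    by (intro tendsto_intros G0)
  then have "(\<lambda>n. \<Sum>k<Suc n. (cmod (W k))\<^sup>2) \<longlonglongrightarrow> l2_norm_sq V" unfolding eq by simp
  then have "(\<lambda>n. \<Sum>k<n. (cmod (W k))\<^sup>2) \<longlonglongrightarrow> l2_norm_sq V" by (subst (asm) filterlim_sequentially_Suc)
  then have "(\<lambda>k. (cmod (W k))\<^sup>2) sums l2_norm_sq V" by (simp add: sums_def)
  then show "taylor_coeff (\<lambda>z. (1 - cnj a * z) * g z) \<in> ltwo"
    "l2_norm_sq (taylor_coeff (\<lambda>z. (1 - cnj a * z) * g z)) = l2_norm_sq (taylor_coeff (\<lambda>z. (z - a) * g z))"
    unfolding V_def[symmetric] W_def[symmetric] by (auto simp: ltwo_def l2_norm_sq_def sums_iff)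
qed

definition moebius :: "complex \<Rightarrow> complex \<Rightarrow> complex \<Rightarrow> complex" where
  "moebius \<gamma> a z = \<gamma> * ((z - a) / (1 - cnj a * z))"

text \<open>The reproducing kernel of H^2 at \<open>a\<close>, normalized to norm one.\<close>

definition szego :: "complex \<Rightarrow> complex \<Rightarrow> complex" where
  "szego a z = of_real (sqrt (1 - (cmod a)\<^sup>2)) / (1 - cnj a * z)"

definition h2_isometric :: "(complex \<Rightarrow> complex) \<Rightarrow> bool" where
  "h2_isometric P \<longleftrightarrow> P holomorphic_on ball 0 1 \<and>
    (\<forall>f. h2 f \<longrightarrow> h2 (\<lambda>z. P z * f z) \<and> l2_norm_sq (taylor_coeff (\<lambda>z. P z * f z)) = l2_norm_sq (taylor_coeff f))"

lemma moebius_holomorphic: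
  assumes "cmod a < 1" shows "moebius \<gamma> a holomorphic_on ball 0 1"
  unfolding moebius_def[abs_def] using moebius_denominator_nonzero[OF assms]
  by (auto intro!: holomorphic_intros)

text \<open>Membership of the product comes from the sign of the boundary term in the partial sums;
  equality of the norms then follows from \<open>moebius_quotient_ltwo\<close>.\<close>

lemma moebius_isometric:
  assumes a: "cmod a < 1" and \<gamma>: "cmod \<gamma> = 1"
  shows "h2_isometric (moebius \<gamma> a)"
  unfolding h2_isometric_def
proof (intro conjI allI impI moebius_holomorphic[OF a])
  fix f assume f: "h2 f"
  \<comment> \<open>With this \<open>g\<close>, \<open>moebius_partial_sums\<close> compares the
    product with the factor, namely \<open>(z - a) * g z\<close>, to
    \<open>\<gamma> * f z\<close>.\<close>
  define g where "g z = \<gamma> * f z / (1 - cnj a * z)" for z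
  have nz: "1 - cnj a * z \<noteq> 0" if "z \<in> ball 0 1" for z
    using moebius_denominator_nonzero[OF a] that by simp
  have g: "g holomorphic_on ball 0 1"
    unfolding g_def[abs_def] using nz by (auto intro!: holomorphic_intros h2_hol[OF f])
  have w: "taylor_coeff (\<lambda>z. (1 - cnj a * z) * g z) = taylor_coeff (\<lambda>z. \<gamma> * f z)"
    by (rule taylor_coeff_cong1) (use nz in \<open>simp add: g_def\<close>)
  have v: "taylor_coeff (\<lambda>z. (z - a) * g z) = taylor_coeff (\<lambda>z. moebius \<gamma> a z * f z)"
    by (rule taylor_coeff_cong1) (use nz in \<open>simp add: g_def moebius_def\<close>)
  have wl: "taylor_coeff (\<lambda>z. (1 - cnj a * z) * g z) \<in> ltwo"
    unfolding w using h2_cmult[OF f] by (simp add: h2_def)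
  have vl: "taylor_coeff (\<lambda>z. (z - a) * g z) \<in> ltwo"
    unfolding ltwo_def
  proof (rule CollectI, rule summableI_nonneg_bounded)
    fix n
    have "(\<Sum>k<n. (cmod (taylor_coeff (\<lambda>z. (z - a) * g z) k))\<^sup>2) \<le>
        (\<Sum>k<Suc n. (cmod (taylor_coeff (\<lambda>z. (z - a) * g z) k))\<^sup>2)" by simp
    also have "\<dots> \<le> (\<Sum>k<Suc n. (cmod (taylor_coeff (\<lambda>z. (1 - cnj a * z) * g z) k))\<^sup>2)"
    proof -
      have "(cmod a)\<^sup>2 \<le> 1" using a by (simp add: abs_square_le_1)
      then have "0 \<le> (1 - (cmod a)\<^sup>2) * (cmod (taylor_coeff g n))\<^sup>2" by (intro mult_nonneg_nonneg) auto
      then show ?thesis using moebius_partial_sums[OF g, of a n] by linarith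
    qed
    also have "\<dots> \<le> l2_norm_sq (taylor_coeff (\<lambda>z. (1 - cnj a * z) * g z))"
      unfolding l2_norm_sq_def using wl by (intro sum_le_suminf) (auto simp: ltwo_def)
    finally show "(\<Sum>k<n. (cmod (taylor_coeff (\<lambda>z. (z - a) * g z) k))\<^sup>2) \<le>
      l2_norm_sq (taylor_coeff (\<lambda>z. (1 - cnj a * z) * g z))" .
  qed simp
  then show "h2 (\<lambda>z. moebius \<gamma> a z * f z)"
    unfolding h2_def v by (intro conjI holomorphic_intros moebius_holomorphic a h2_hol f)
  show "l2_norm_sq (taylor_coeff (\<lambda>z. moebius \<gamma> a z * f z)) = l2_norm_sq (taylor_coeff f)"
    using moebius_quotient_ltwo(2)[OF g a vl] f \<gamma>
    unfolding v w by (simp add: h2_def taylor_coeff_cmult1 l2_norm_sq_cmult)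
qed

text \<open>The singularity of \<open>f z / (z - a)\<close> is removable, and multiplying this
  quotient by the denominator of the factor gives \<open>r\<close> up to a unimodular constant. That
  \<open>r\<close> stays in H^2 is \<open>moebius_quotient_ltwo\<close>.\<close>

lemma moebius_division:
  assumes a: "cmod a < 1" and \<gamma>: "cmod \<gamma> = 1" and f: "h2 f" "f a = 0"
  obtains r where "h2 r" "\<And>z. z \<in> ball 0 1 \<Longrightarrow> f z = moebius \<gamma> a z * r z"
proof -
  define g where "g z = (if z = a then deriv f a else (f z - f a) / (z - a))" for z
  have g: "g holomorphic_on ball 0 1"
    unfolding g_def[abs_def] by (rule pole_lemma) (use a h2_hol[OF f(1)] in auto)
  have nz: "1 - cnj a * z \<noteq> 0" if "z \<in> ball 0 1" for z
    using moebius_denominator_nonzero[OF a] that by simp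
  have fg: "f z = (z - a) * g z" for z using f(2) by (simp add: g_def)
  then have "taylor_coeff (\<lambda>z. (z - a) * g z) \<in> ltwo" using f(1) by (simp add: h2_def fg[symmetric])
  from moebius_quotient_ltwo(1)[OF g a this]
  have "h2 (\<lambda>z. (1 - cnj a * z) * g z)"
    unfolding h2_def by (intro conjI holomorphic_intros g)
  then have "h2 (\<lambda>z. inverse \<gamma> * ((1 - cnj a * z) * g z))" by (rule h2_cmult)
  moreover have "f z = moebius \<gamma> a z * (inverse \<gamma> * ((1 - cnj a * z) * g z))" if "z \<in> ball 0 1" for z
  proof -
    have "x * y = \<gamma> * (x / d) * (inverse \<gamma> * (d * y))" if "d \<noteq> 0" for x y d
    proof -
      have "\<gamma> * inverse \<gamma> = 1" using \<gamma> by (intro right_inverse) auto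
      moreover have "\<gamma> * (x / d) * (inverse \<gamma> * (d * y)) = \<gamma> * inverse \<gamma> * (x / d * d * y)"
        by (simp only: mult_ac)
      ultimately show ?thesis using that by simp
    qed
    from this[OF nz[OF that]] show ?thesis by (simp only: fg moebius_def)
  qed
  ultimately show ?thesis using that by blast
qed

lemma h2_isometricD:
  "h2_isometric P \<Longrightarrow> P holomorphic_on ball 0 1"
  "h2_isometric P \<Longrightarrow> h2 f \<Longrightarrow> h2 (\<lambda>z. P z * f z)"
  "h2_isometric P \<Longrightarrow> h2 f \<Longrightarrow> l2_norm_sq (taylor_coeff (\<lambda>z. P z * f z)) = l2_norm_sq (taylor_coeff f)"
  by (auto simp: h2_isometric_def)

lemma h2_isometric_l2_inner:
  assumes P: "h2_isometric P" and fg: "h2 f" "h2 g"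
  shows "l2_inner (taylor_coeff (\<lambda>z. P z * f z)) (taylor_coeff (\<lambda>z. P z * g z)) = l2_inner (taylor_coeff f) (taylor_coeff g)"
proof (rule l2_inner_polarization)
  fix c
  have "(\<lambda>n. taylor_coeff (\<lambda>z. P z * f z) n + c * taylor_coeff (\<lambda>z. P z * g z) n) =
      taylor_coeff (\<lambda>z. P z * f z + c * (P z * g z))"
    using h2_hol[OF h2_isometricD(2)[OF P fg(1)]] h2_hol[OF h2_isometricD(2)[OF P fg(2)]]
    by (subst taylor_coeff_add1) (auto simp: taylor_coeff_cmult1 intro!: holomorphic_on_mult[OF holomorphic_on_const])
  also have "\<dots> = taylor_coeff (\<lambda>z. P z * (f z + c * g z))" by (simp add: algebra_simps)
  finally have "l2_norm_sq (\<lambda>n. taylor_coeff (\<lambda>z. P z * f z) n + c * taylor_coeff (\<lambda>z. P z * g z) n) =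
      l2_norm_sq (taylor_coeff (\<lambda>z. f z + c * g z))"
    using h2_isometricD(3)[OF P h2_add[OF fg(1) h2_cmult[OF fg(2)]]] by simp
  also have "taylor_coeff (\<lambda>z. f z + c * g z) = (\<lambda>n. taylor_coeff f n + c * taylor_coeff g n)"
    using h2_hol[OF fg(1)] h2_hol[OF fg(2)]
    by (subst taylor_coeff_add1) (auto simp: taylor_coeff_cmult1 intro!: holomorphic_on_mult[OF holomorphic_on_const])
  finally show "l2_norm_sq (\<lambda>n. taylor_coeff (\<lambda>z. P z * f z) n + c * taylor_coeff (\<lambda>z. P z * g z) n) =
      l2_norm_sq (\<lambda>n. taylor_coeff f n + c * taylor_coeff g n)" .
qed (use h2_isometricD(2)[OF P] fg h2_ltwo in auto)

lemma h2_isometric_one: "h2_isometric (\<lambda>z. 1)"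
  by (simp add: h2_isometric_def)

lemma h2_isometric_mult:
  assumes P: "h2_isometric P" and Q: "h2_isometric Q" shows "h2_isometric (\<lambda>z. P z * Q z)"
  unfolding h2_isometric_def
proof (intro conjI allI impI)
  show "(\<lambda>z. P z * Q z) holomorphic_on ball 0 1"
    using P Q by (auto simp: h2_isometric_def intro!: holomorphic_intros)
  fix f assume f: "h2 f"
  note * = h2_isometricD(2)[OF Q f]
  show "h2 (\<lambda>z. P z * Q z * f z)" using h2_isometricD(2)[OF P *] by (simp add: mult.assoc)
  show "l2_norm_sq (taylor_coeff (\<lambda>z. P z * Q z * f z)) = l2_norm_sq (taylor_coeff f)"
    using h2_isometricD(3)[OF P *] h2_isometricD(3)[OF Q f] by (simp add: mult.assoc)
qed

lemma h2_isometric_prod: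
  "(\<And>i. i \<in> I \<Longrightarrow> h2_isometric (P i)) \<Longrightarrow> h2_isometric (\<lambda>z. \<Prod>i\<in>I. P i z)"
proof (induction I rule: infinite_finite_induct)
  case (insert i F)
  then have "h2_isometric (\<lambda>z. P i z * (\<Prod>i\<in>F. P i z))" by (intro h2_isometric_mult) auto
  with insert(1,2) show ?case by simp
qed (auto simp: h2_isometric_one)

lemma szego_taylor_coeff:
  assumes "cmod a < 1"
  shows "taylor_coeff (szego a) = (\<lambda>k. of_real (sqrt (1 - (cmod a)\<^sup>2)) * cnj a ^ k)"
proof
  fix k
  show "taylor_coeff (szego a) k = of_real (sqrt (1 - (cmod a)\<^sup>2)) * cnj a ^ k"
  proof (rule taylor_coeff_unique[OF zero_less_one])
    fix z :: complex assume z: "z \<in> ball 0 1"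
    have "cmod a * cmod z \<le> cmod a * 1" using z by (intro mult_left_mono) auto
    then have "cmod (cnj a * z) < 1" using assms by (simp add: norm_mult)
    from sums_mult[OF geometric_sums[OF this]]
    show "(\<lambda>k. of_real (sqrt (1 - (cmod a)\<^sup>2)) * cnj a ^ k * z ^ k) sums szego a z"
      by (simp add: szego_def power_mult_distrib mult.assoc)
  qed
qed

lemma h2_szego:
  assumes "cmod a < 1" shows "h2 (szego a)"
  unfolding h2_def
proof
  show "szego a holomorphic_on ball 0 1"
    unfolding szego_def[abs_def] using moebius_denominator_nonzero[OF assms]
    by (auto intro!: holomorphic_intros)
  have "(cmod a)\<^sup>2 < 1" using assms by (simp add: abs_square_less_1)
  then show "taylor_coeff (szego a) \<in> ltwo"
    unfolding szego_taylor_coeff[OF assms] ltwo_def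
    by (auto simp: norm_mult norm_power power_mult_distrib power_mult[symmetric] mult.commute[of _ 2] intro!: summable_mult)
      (simp add: power_mult)
qed

lemma szego_reproducing:
  assumes a: "cmod a < 1" and f: "h2 f"
  shows "l2_inner (taylor_coeff f) (taylor_coeff (szego a)) = of_real (sqrt (1 - (cmod a)\<^sup>2)) * f a"
proof -
  have "(\<lambda>k. of_real (sqrt (1 - (cmod a)\<^sup>2)) * (taylor_coeff f k * a ^ k)) sums (of_real (sqrt (1 - (cmod a)\<^sup>2)) * f a)"
    by (intro sums_mult taylor_coeff_sums[of _ 1] h2_hol[OF f]) (use a in simp)
  then show ?thesis
    unfolding l2_inner_def szego_taylor_coeff[OF a] by (simp add: sums_iff mult_ac)
qed

lemma szego_self: "cmod a < 1 \<Longrightarrow> of_real (sqrt (1 - (cmod a)\<^sup>2)) * szego a a = 1"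
proof -
  assume "cmod a < 1"
  then have s: "(cmod a)\<^sup>2 < 1" by (simp add: abs_square_less_1)
  have e: "1 - cnj a * a = of_real (1 - (cmod a)\<^sup>2)"
    by (simp add: complex_norm_square mult.commute del: of_real_power)
  have "of_real (sqrt (1 - (cmod a)\<^sup>2)) * szego a a =
      (of_real (sqrt (1 - (cmod a)\<^sup>2) * sqrt (1 - (cmod a)\<^sup>2) / (1 - (cmod a)\<^sup>2)) :: complex)"
    unfolding szego_def e by (simp only: of_real_mult of_real_divide times_divide_eq_right)
  also have "\<dots> = 1" using s by simp
  finally show ?thesis .
qed

text \<open>Every coefficient is at most the norm, and the factor 2 sums the geometric series of
  ratio 1/2.\<close>

lemma h2_pointwise_bound:
  assumes f: "h2 f" and z: "cmod z \<le> 1/2"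
  shows "cmod (f z) \<le> 2 * sqrt (l2_norm_sq (taylor_coeff f))"
proof -
  have "(\<lambda>k. taylor_coeff f k * z ^ k) sums f z" using z by (intro taylor_coeff_sums[of _ 1] h2_hol[OF f]) auto
  moreover have "(\<lambda>k. sqrt (l2_norm_sq (taylor_coeff f)) * (1/2) ^ k) sums (sqrt (l2_norm_sq (taylor_coeff f)) * (1 / (1 - 1/2)))"
    by (intro sums_mult geometric_sums) auto
  moreover have "cmod (taylor_coeff f k * z ^ k) \<le> sqrt (l2_norm_sq (taylor_coeff f)) * (1/2) ^ k" for k
    unfolding norm_mult norm_power
    using z l2_norm_sq_component[OF h2_ltwo[OF f], of k] h2_ltwo[OF f]
    by (intro mult_mono power_mono) (auto intro: real_le_rsqrt)
  ultimately have "cmod (f z) \<le> sqrt (l2_norm_sq (taylor_coeff f)) * (1 / (1 - 1/2))"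
    by (metis (no_types, lifting) norm_suminf_le sums_iff)
  then show ?thesis by simp
qed

subsection \<open>The Takenaka--Malmquist system\<close>

locale blaschke =
  fixes m :: nat and B :: "complex \<Rightarrow> complex" and c :: complex and a :: "nat \<Rightarrow> complex"
  assumes m: "1 \<le> m" and c: "cmod c = 1" and a: "\<And>j. j < m \<Longrightarrow> cmod (a j) < 1"
    and B: "\<And>z. z \<in> ball 0 1 \<Longrightarrow> B z = c * (\<Prod>j<m. (z - a j) / (1 - cnj (a j) * z))"
begin

definition zero :: "nat \<Rightarrow> complex" where "zero n = a (n mod m)"

definition factor :: "nat \<Rightarrow> complex \<Rightarrow> complex" where
  "factor n = moebius (if n mod m = 0 then c else 1) (zero n)"

definition Psi :: "nat \<Rightarrow> complex \<Rightarrow> complex" where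
  "Psi n z = (\<Prod>i<n. factor i z)"

text \<open>The Takenaka--Malmquist system with \<open>m\<close>-periodic zeros; the constant \<open>c\<close> is put into every
  \<open>m\<close>-th factor so that \<open>tm (k * m + j) = B\<^sup>k tm j\<close>.\<close>

definition tm :: "nat \<Rightarrow> complex \<Rightarrow> complex" where
  "tm n z = Psi n z * szego (zero n) z"

definition tmc :: "nat \<Rightarrow> nat \<Rightarrow> complex" where
  "tmc n = taylor_coeff (tm n)"

lemma zero_less1: "cmod (zero n) < 1"
  unfolding zero_def using a m by simp

lemma factor_isometric: "h2_isometric (factor n)"
  unfolding factor_def by (rule moebius_isometric[OF zero_less1]) (simp add: c)

lemma Psi_isometric: "h2_isometric (Psi n)"
proof -
  have "Psi n = (\<lambda>z. \<Prod>i<n. factor i z)" by (auto simp: Psi_def)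
  then show ?thesis by (simp add: h2_isometric_prod factor_isometric)
qed

lemma h2_tm: "h2 (tm n)"
  using h2_isometricD(2)[OF Psi_isometric h2_szego[OF zero_less1]] unfolding tm_def[abs_def] by blast

lemma tm_hol: "tm n holomorphic_on ball 0 1"
  by (rule h2_hol[OF h2_tm])

lemma tmc_ltwo: "tmc n \<in> ltwo"
  unfolding tmc_def by (rule h2_ltwo[OF h2_tm])

text \<open>\<open>Psi n\<close> is isometric and cancels; what remains is the reproducing property
  of the Szego kernel.\<close>

lemma l2_inner_Psi_tm:
  assumes "h2 r"
  shows "l2_inner (taylor_coeff (\<lambda>z. Psi n z * r z)) (tmc n) = of_real (sqrt (1 - (cmod (zero n))\<^sup>2)) * r (zero n)"
  unfolding tmc_def tm_def[abs_def] h2_isometric_l2_inner[OF Psi_isometric assms h2_szego[OF zero_less1]]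
  by (rule szego_reproducing[OF zero_less1 assms])

lemma factor_zero: "factor n (zero n) = 0"
  by (simp add: factor_def moebius_def)

text \<open>\<open>Psi n\<close> contains the factor with index \<open>k\<close>, which vanishes at
  the point where the kernel in \<open>tm k\<close> evaluates.\<close>

lemma l2_inner_Psi_tm_less:
  assumes r: "h2 r" and kn: "k < n"
  shows "l2_inner (taylor_coeff (\<lambda>z. Psi n z * r z)) (tmc k) = 0"
proof -
  define Q where "Q = (\<lambda>z. factor k z * ((\<Prod>i\<in>{Suc k..<n}. factor i z) * r z))"
  have "h2_isometric (\<lambda>z. \<Prod>i\<in>{Suc k..<n}. factor i z)"
    by (intro h2_isometric_prod factor_isometric)
  then have Q: "h2 Q" unfolding Q_def
    by (intro h2_isometricD(2)[OF factor_isometric] h2_isometricD(2)[OF _ r])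
  have "Psi n z = Psi k z * (factor k z * (\<Prod>i\<in>{Suc k..<n}. factor i z))" for z
  proof -
    have "Psi n z = Psi k z * (\<Prod>i=k..<n. factor i z)"
      unfolding Psi_def lessThan_atLeast0 using kn by (subst prod.atLeastLessThan_concat) auto
    then show ?thesis using kn by (simp add: prod.atLeast_Suc_lessThan)
  qed
  then have "(\<lambda>z. Psi n z * r z) = (\<lambda>z. Psi k z * Q z)" by (auto simp: Q_def mult_ac)
  then show ?thesis using l2_inner_Psi_tm[OF Q, of k] by (simp add: Q_def factor_zero)
qed

lemma tmc_orthonormal: "l2_inner (tmc n) (tmc n') = (if n = n' then 1 else 0)"
proof -
  have less: "l2_inner (tmc n) (tmc k) = 0" if "k < n" for n k
    using l2_inner_Psi_tm_less[OF h2_szego[OF zero_less1] that, of n] by (simp add: tmc_def tm_def[abs_def])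
  have eq: "l2_inner (tmc n) (tmc n) = 1" for n
    using l2_inner_Psi_tm[OF h2_szego[OF zero_less1], of n n] szego_self[OF zero_less1]
    by (simp add: tmc_def tm_def[abs_def])
  consider "n = n'" | "n < n'" | "n' < n" by linarith
  then show ?thesis
    using less eq l2_inner_cnj[OF tmc_ltwo tmc_ltwo, of n' n] by cases auto
qed

lemma taylor_coeff_tm_expansion:
  assumes r: "h2 r" and fr: "\<And>z. z \<in> ball 0 1 \<Longrightarrow> f z = (\<Sum>k<n. p k * tm k z) + Psi n z * r z"
  shows "taylor_coeff f = (\<lambda>i. (\<Sum>k<n. p k * tmc k i) + taylor_coeff (\<lambda>z. Psi n z * r z) i)"
proof -
  have "taylor_coeff f = taylor_coeff (\<lambda>z. (\<Sum>k<n. p k * tm k z) + Psi n z * r z)"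
    by (rule taylor_coeff_cong1) (rule fr)
  also have "\<dots> = (\<lambda>i. (\<Sum>k<n. p k * tmc k i) + taylor_coeff (\<lambda>z. Psi n z * r z) i)"
    by (subst taylor_coeff_add1)
      (auto intro!: holomorphic_on_sum holomorphic_on_mult[OF holomorphic_on_const] tm_hol
        h2_hol[OF h2_isometricD(2)[OF Psi_isometric r]] simp: taylor_coeff_sum1[OF tm_hol] tmc_def)
  finally show ?thesis .
qed

text \<open>Interpolation one zero at a time: a multiple of the kernel makes the remainder vanish at
  the next zero, and \<open>moebius_division\<close> then removes that factor. The remainder is
  bounded by Pythagoras.\<close>

lemma tm_expansion:
  assumes f: "h2 f"
  shows "\<exists>r. h2 r \<and> l2_norm_sq (taylor_coeff r) \<le> l2_norm_sq (taylor_coeff f) \<and>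
    (\<forall>z\<in>ball 0 1. f z = (\<Sum>k<n. l2_inner (taylor_coeff f) (tmc k) * tm k z) + Psi n z * r z)"
proof -
  have "\<exists>r. h2 r \<and>
    (\<forall>z\<in>ball 0 1. f z = (\<Sum>k<n. l2_inner (taylor_coeff f) (tmc k) * tm k z) + Psi n z * r z)"
  proof (induction n)
    case 0
    show ?case using f by (intro exI[of _ f]) (simp add: Psi_def)
  next
    case (Suc n)
    then obtain r where r: "h2 r"
      and fr: "\<And>z. z \<in> ball 0 1 \<Longrightarrow> f z = (\<Sum>k<n. l2_inner (taylor_coeff f) (tmc k) * tm k z) + Psi n z * r z"
      by blast
    note Pr = h2_isometricD(2)[OF Psi_isometric r, of n]
    have tf: "taylor_coeff f = (\<lambda>i. (\<Sum>k<n. l2_inner (taylor_coeff f) (tmc k) * tmc k i) + taylor_coeff (\<lambda>z. Psi n z * r z) i)"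
      by (rule taylor_coeff_tm_expansion[OF r fr])
    have cn: "l2_inner (taylor_coeff f) (tmc n) = of_real (sqrt (1 - (cmod (zero n))\<^sup>2)) * r (zero n)"
      by (subst tf, subst l2_inner_add_left)
        (auto intro!: ltwo_sum tmc_ltwo h2_ltwo[OF Pr] simp: l2_inner_sum_left tmc_ltwo tmc_orthonormal l2_inner_Psi_tm[OF r])
    \<comment> \<open>By \<open>cn\<close> and \<open>szego_self\<close> the \<open>n\<close>-th
      coefficient is exactly the multiple that produces a zero at \<open>zero n\<close>.\<close>
    define r' where "r' z = r z - l2_inner (taylor_coeff f) (tmc n) * szego (zero n) z" for z
    have r': "h2 r'" unfolding r'_def[abs_def] by (intro h2_diff h2_cmult r h2_szego zero_less1)
    have "r' (zero n) = r (zero n) - r (zero n) * (of_real (sqrt (1 - (cmod (zero n))\<^sup>2)) * szego (zero n) (zero n))"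
      unfolding r'_def cn by (simp only: mult_ac)
    then have "r' (zero n) = 0" unfolding szego_self[OF zero_less1] by simp
    moreover have "cmod (if n mod m = 0 then c else 1) = 1" using c by simp
    ultimately obtain q where q: "h2 q" "\<And>z. z \<in> ball 0 1 \<Longrightarrow> r' z = factor n z * q z"
      unfolding factor_def using moebius_division[OF zero_less1 _ r'] by blast
    have "f z = (\<Sum>k<Suc n. l2_inner (taylor_coeff f) (tmc k) * tm k z) + Psi (Suc n) z * q z" if "z \<in> ball 0 1" for z
    proof -
      have "r z = l2_inner (taylor_coeff f) (tmc n) * szego (zero n) z + factor n z * q z"
        using q(2)[OF that] by (simp add: r'_def algebra_simps)
      then show ?thesis using fr[OF that] by (simp add: tm_def Psi_def algebra_simps)
    qed
    with q(1) show ?case by blast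
  qed
  then obtain r where r: "h2 r"
    and fr: "\<And>z. z \<in> ball 0 1 \<Longrightarrow> f z = (\<Sum>k<n. l2_inner (taylor_coeff f) (tmc k) * tm k z) + Psi n z * r z"
    by blast
  note Pr = h2_isometricD(2)[OF Psi_isometric r, of n]
  note tf = fun_cong[OF taylor_coeff_tm_expansion[OF r fr]]
  have "l2_norm_sq (taylor_coeff f) = (\<Sum>k<n. (cmod (l2_inner (taylor_coeff f) (tmc k)))\<^sup>2) + l2_norm_sq (taylor_coeff (\<lambda>z. Psi n z * r z))"
    by (rule l2_norm_sq_Pythagoras(1)[OF _ h2_ltwo[OF f] _ _ h2_ltwo[OF Pr] _ tf])
      (auto simp: tmc_ltwo tmc_orthonormal l2_inner_Psi_tm_less[OF r])
  then have "l2_norm_sq (taylor_coeff r) \<le> l2_norm_sq (taylor_coeff f)"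
    unfolding h2_isometricD(3)[OF Psi_isometric r] by (simp add: sum_nonneg)
  with r fr show ?thesis by blast
qed

section \<open>Decay of the Takenaka-Malmquist coefficients\<close>

definition A where "A = Max ((\<lambda>j. cmod (a j)) ` {..<m})"

lemma A: "0 \<le> A" "A < 1" "cmod (zero n) \<le> A"
proof -
  have ne: "(\<lambda>j. cmod (a j)) ` {..<m} \<noteq> {}" using m by (auto simp: lessThan_empty_iff)
  show "A < 1" unfolding A_def using ne a by (subst Max_less_iff) auto
  show *: "cmod (zero n) \<le> A" for n unfolding A_def zero_def using m by (intro Max_ge) auto
  show "0 \<le> A" using *[of 0] norm_ge_zero order_trans by blast
qed

text \<open>Bounds every factor on |z| = 1/2. With d the denominator, |d|^2 - |z-p|^2 =
  (1-|p|^2)(1-|z|^2), where the last factor is 3/4; dividing by the bound 4 for |d|^2 gives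
  3/16.\<close>

definition \<beta> where "\<beta> = sqrt (1 - (1 - A\<^sup>2) * (3 / 16))"

lemma \<beta>: "0 < \<beta>" "\<beta> < 1"
proof -
  define x where "x = (1 - A\<^sup>2) * (3 / 16)"
  have "A\<^sup>2 < 1" "0 \<le> A\<^sup>2" using A by (auto simp: abs_square_less_1)
  then have "0 < x" "x \<le> 1 * (3 / 16)"
    unfolding x_def by (simp, intro mult_right_mono) auto
  then have "0 < x" "x < 1" by auto
  then show "0 < \<beta>" "\<beta> < 1" unfolding \<beta>_def x_def[symmetric] by auto
qed

lemma factor_bound: assumes "cmod z = 1 / 2" shows "cmod (factor n z) \<le> \<beta>"
proof -
  define p where "p = zero n"
  define d where "d = 1 - cnj p * z"
  have d0: "d \<noteq> 0" unfolding d_def p_def using moebius_denominator_nonzero[OF zero_less1] assms by simp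
  have p: "cmod p \<le> A" "cmod p < 1" unfolding p_def using A zero_less1 by auto
  have "cmod d \<le> 1 + cmod (cnj p * z)" unfolding d_def using norm_triangle_ineq4[of 1 "cnj p * z"] by simp
  also have "\<dots> \<le> 1 + 1 * 1"
    unfolding norm_mult using p assms by (intro add_left_mono mult_mono) auto
  finally have d2: "(cmod d)\<^sup>2 \<le> 4" using power_mono[of "cmod d" 2 2] by simp
  have "(cmod d)\<^sup>2 - (cmod (z - p))\<^sup>2 = (1 - (cmod p)\<^sup>2) * (1 - (cmod z)\<^sup>2)"
    unfolding d_def by (simp add: cmod_power2) (simp add: power2_eq_square algebra_simps)
  also have "\<dots> = (1 - (cmod p)\<^sup>2) * (3 / 4)" unfolding assms by (simp add: power_divide)
  also have "\<dots> \<ge> (1 - A\<^sup>2) * (3 / 4)" using p by (intro mult_right_mono diff_left_mono power_mono) auto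
  finally have 1: "(1 - A\<^sup>2) * (3 / 4) \<le> (cmod d)\<^sup>2 - (cmod (z - p))\<^sup>2" .
  have "A\<^sup>2 < 1" using A by (simp add: abs_square_less_1)
  then have "(cmod d)\<^sup>2 * ((1 - A\<^sup>2) * (3 / 16)) \<le> 4 * ((1 - A\<^sup>2) * (3 / 16))"
    using d2 by (intro mult_right_mono) auto
  moreover have "4 * ((1 - A\<^sup>2) * (3 / 16)) = (1 - A\<^sup>2) * (3 / 4)" by simp
  ultimately have "(cmod (z - p))\<^sup>2 \<le> (cmod d)\<^sup>2 * (1 - (1 - A\<^sup>2) * (3 / 16))"
    using 1 unfolding right_diff_distrib[of "(cmod d)\<^sup>2"] by linarith
  then have "(cmod (z - p) / cmod d)\<^sup>2 \<le> 1 - (1 - A\<^sup>2) * (3 / 16)"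
    using d0 by (simp add: power_divide field_simps)
  then have "cmod (z - p) / cmod d \<le> \<beta>" unfolding \<beta>_def by (rule real_le_rsqrt)
  then show ?thesis using c by (simp add: factor_def moebius_def p_def d_def norm_mult norm_divide)
qed

lemma Psi_bound: assumes "cmod z = 1 / 2" shows "cmod (Psi n z) \<le> \<beta> ^ n"
  unfolding Psi_def prod_norm[symmetric]
  using prod_mono[of "{..<n}" "\<lambda>i. cmod (factor i z)" "\<lambda>i. \<beta>"] factor_bound[OF assms] by simp

text \<open>Cauchy estimate on the circle of radius 1/2: \<open>\<beta> ^ n\<close> is gained and
  \<open>2 ^ i\<close> lost, so the bound is useful only for \<open>n\<close> large compared with
  \<open>i\<close>.\<close>

lemma Psi_coeff_bound:
  assumes r: "h2 r"
  shows "cmod (taylor_coeff (\<lambda>z. Psi n z * r z) i) \<le> 2 * sqrt (l2_norm_sq (taylor_coeff r)) * \<beta> ^ n * 2 ^ i"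
proof -
  note Pr = h2_hol[OF h2_isometricD(2)[OF Psi_isometric r, of n]]
  have "cmod (taylor_coeff (\<lambda>z. Psi n z * r z) i) \<le> (\<beta> ^ n * (2 * sqrt (l2_norm_sq (taylor_coeff r)))) / (1 / 2) ^ i"
  proof (rule taylor_coeff_bound)
    show "(\<lambda>z. Psi n z * r z) holomorphic_on ball 0 (1 / 2)"
      by (rule holomorphic_on_subset[OF Pr]) auto
    show "continuous_on (cball 0 (1 / 2)) (\<lambda>z. Psi n z * r z)"
      by (rule continuous_on_subset[OF holomorphic_on_imp_continuous_on[OF Pr]]) auto
    fix z :: complex assume z: "cmod z = 1 / 2"
    show "cmod (Psi n z * r z) \<le> \<beta> ^ n * (2 * sqrt (l2_norm_sq (taylor_coeff r)))"
      unfolding norm_mult using \<beta> z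
      by (intro mult_mono Psi_bound h2_pointwise_bound[OF r]) auto
  qed simp
  then show ?thesis by (simp add: power_divide mult_ac)
qed

lemma l2_norm_sq_szego: "cmod p < 1 \<Longrightarrow> l2_norm_sq (taylor_coeff (szego p)) = 1"
proof -
  assume p: "cmod p < 1"
  then have "(\<lambda>k. (1 - (cmod p)\<^sup>2) * ((cmod p)\<^sup>2) ^ k) sums ((1 - (cmod p)\<^sup>2) * (1 / (1 - (cmod p)\<^sup>2)))"
    by (intro sums_mult geometric_sums) (simp add: abs_square_less_1)
  moreover have "(cmod p)\<^sup>2 < 1" using p by (simp add: abs_square_less_1)
  ultimately show ?thesis
    unfolding l2_norm_sq_def szego_taylor_coeff[OF p]
    by (simp add: norm_mult norm_power power_mult_distrib power_mult[symmetric] mult.commute[of _ 2] sums_iff)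
qed

lemma tmc_column_bound: "cmod (tmc n i) \<le> 2 * \<beta> ^ n * 2 ^ i"
  using Psi_coeff_bound[OF h2_szego[OF zero_less1], of n n i] l2_norm_sq_szego[OF zero_less1]
  by (simp add: tmc_def tm_def[abs_def])

text \<open>Completeness of the system, coefficient by coefficient: \<open>Psi_coeff_bound\<close>
  applies to the remainder after \<open>n\<close> terms, whose norm does not exceed that of
  \<open>f\<close>.\<close>

lemma tm_coeff_sums:
  assumes f: "h2 f"
  shows "(\<lambda>n. l2_inner (taylor_coeff f) (tmc n) * tmc n i) sums taylor_coeff f i"
  unfolding sums_def
proof (rule LIM_zero_cancel, rule Lim_null_comparison)
  show "(\<lambda>n. 2 * sqrt (l2_norm_sq (taylor_coeff f)) * \<beta> ^ n * 2 ^ i) \<longlonglongrightarrow> 0"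
    using \<beta> by (auto intro!: tendsto_eq_intros LIMSEQ_power_zero)
  show "\<forall>\<^sub>F n in sequentially. norm ((\<Sum>k<n. l2_inner (taylor_coeff f) (tmc k) * tmc k i) - taylor_coeff f i) \<le>
      2 * sqrt (l2_norm_sq (taylor_coeff f)) * \<beta> ^ n * 2 ^ i"
  proof (rule always_eventually, rule allI)
    fix n
    obtain r where r: "h2 r" "l2_norm_sq (taylor_coeff r) \<le> l2_norm_sq (taylor_coeff f)"
      and fr: "\<And>z. z \<in> ball 0 1 \<Longrightarrow> f z = (\<Sum>k<n. l2_inner (taylor_coeff f) (tmc k) * tm k z) + Psi n z * r z"
      using tm_expansion[OF f, of n] by blast
    from fun_cong[OF taylor_coeff_tm_expansion[OF r(1) fr], of i]
    have "norm ((\<Sum>k<n. l2_inner (taylor_coeff f) (tmc k) * tmc k i) - taylor_coeff f i) =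
        cmod (taylor_coeff (\<lambda>z. Psi n z * r z) i)" by (simp add: norm_minus_commute)
    also have "\<dots> \<le> 2 * sqrt (l2_norm_sq (taylor_coeff r)) * \<beta> ^ n * 2 ^ i" by (rule Psi_coeff_bound[OF r(1)])
    also have "\<dots> \<le> 2 * sqrt (l2_norm_sq (taylor_coeff f)) * \<beta> ^ n * 2 ^ i"
      using r(2) \<beta> by (intro mult_right_mono mult_left_mono) auto
    finally show "norm ((\<Sum>k<n. l2_inner (taylor_coeff f) (tmc k) * tmc k i) - taylor_coeff f i) \<le>
      2 * sqrt (l2_norm_sq (taylor_coeff f)) * \<beta> ^ n * 2 ^ i" .
  qed
qed

text \<open>The Takenaka-Malmquist coefficients of the monomial of degree \<open>i\<close> are the
  conjugated \<open>i\<close>-th column, so this is completeness applied to monomials.\<close>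

lemma tmc_columns:
  shows "(\<lambda>n. cnj (tmc n i)) \<in> ltwo"
    "l2_inner (\<lambda>n. cnj (tmc n i)) (\<lambda>n. cnj (tmc n i')) = (if i = i' then 1 else 0)"
proof -
  define e where "e i = (\<lambda>k. if k = i then 1 else 0 :: complex)" for i :: nat
  have el: "e i \<in> ltwo" for i
    unfolding ltwo_def e_def by (auto intro!: summable_finite[of "{i}"] split: if_splits)
  have te: "taylor_coeff (\<lambda>z. z ^ i) = e i" for i
    by (auto simp: taylor_coeff_monomial e_def)
  have h: "h2 (\<lambda>z. z ^ i)" for i unfolding h2_def te by (intro conjI el holomorphic_intros)
  have le: "l2_inner (e i) (tmc n) = cnj (tmc n i)" for i n
    unfolding l2_inner_def by (subst suminf_finite[of "{i}"]) (auto simp: e_def)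
  show l: "(\<lambda>n. cnj (tmc n i)) \<in> ltwo" for i
    unfolding ltwo_def
  proof (rule CollectI, rule summableI_nonneg_bounded)
    fix n show "(\<Sum>k<n. (cmod (cnj (tmc k i)))\<^sup>2) \<le> l2_norm_sq (e i)"
      unfolding le[symmetric] by (rule l2_norm_sq_Bessel) (auto simp: el tmc_ltwo tmc_orthonormal)
  qed simp
  show "l2_inner (\<lambda>n. cnj (tmc n i)) (\<lambda>n. cnj (tmc n i')) = (if i = i' then 1 else 0)"
    using tm_coeff_sums[OF h, of i i'] unfolding te le
    by (auto simp: l2_inner_def sums_iff e_def)
qed

lemma power_threshold:
  fixes x y :: real
  assumes "1 < x"
  obtains C :: nat where "1 \<le> C" "y \<le> x ^ C"
proof -
  obtain C where "y < x ^ C" using real_arch_pow[OF assms] by blast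
  moreover have "x ^ C \<le> x ^ Suc C" using assms by (intro power_increasing) auto
  ultimately show ?thesis using that[of "Suc C"] by linarith
qed

lemma columns_decaying: "decaying_orthonormal (\<lambda>i n. cnj (tmc n i))"
proof -
  \<comment> \<open>Splits \<open>\<beta> ^ n\<close> into two equal powers: past the sector one of
    them absorbs \<open>2 ^ i\<close>, the other is the decay.\<close>
  define q where "q = sqrt \<beta>"
  have q: "0 < q" "q < 1" "q * q = \<beta>" using \<beta> by (auto simp: q_def)
  have "1 < 1 / q" using q by simp
  then obtain C where C: "1 \<le> C" "2 \<le> (1 / q) ^ C" using power_threshold[of "1/q" 2] by blast
  have "cmod (cnj (tmc n i)) \<le> 2 * q ^ n" if "C * (i + 1) \<le> n" for n i
  proof -
    have "(2::real) ^ i \<le> 2 ^ (i + 1)" by (intro power_increasing) auto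
    also have "\<dots> \<le> ((1 / q) ^ C) ^ (i + 1)" using C by (intro power_mono) auto
    also have "\<dots> = (1 / q) ^ (C * (i + 1))" by (rule power_mult[symmetric])
    also have "\<dots> \<le> (1 / q) ^ n" using that q by (intro power_increasing) auto
    finally have "2 * \<beta> ^ n * 2 ^ i \<le> 2 * \<beta> ^ n * (1 / q) ^ n" using \<beta> by (intro mult_left_mono) auto
    also have "\<dots> = 2 * q ^ n" using q by (simp add: q(3)[symmetric] power_mult_distrib power_divide)
    finally show ?thesis using tmc_column_bound[of n i] by simp
  qed
  then show ?thesis
    unfolding decaying_orthonormal_def
    by (intro conjI allI tmc_columns exI[of _ 2] exI[of _ C] exI[of _ q]) (use C q in auto)
qed

lemma rows_decaying: "decaying_orthonormal tmc"
proof -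
  \<comment> \<open>Satisfies \<open>1 < R\<close> and \<open>R * A < 1\<close>, so no factor has a
    pole in the closed disc of radius \<open>R\<close>, and Cauchy estimates there gain
    \<open>1 / R ^ i\<close>.\<close>
  define R where "R = 2 / (1 + A)"
  have R: "1 < R" "R * A < 1" using A by (auto simp: R_def field_simps)
  have den: "1 - R * A \<le> cmod (1 - cnj (zero n) * z)" if "cmod z \<le> R" for n z
  proof -
    have "cmod (cnj (zero n) * z) \<le> A * R"
      unfolding norm_mult using A that by (intro mult_mono) auto
    then show ?thesis using norm_triangle_ineq2[of 1 "cnj (zero n) * z"] by (simp add: mult.commute)
  qed
  have nz: "1 - cnj (zero n) * z \<noteq> 0" if "cmod z \<le> R" for n z
    using den[OF that, of n] R by auto
  \<comment> \<open>Numerator at most \<open>R + 1\<close>, denominator at least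
    \<open>1 - R * A\<close>. It also dominates the Szego kernel, so \<open>tm n\<close> is bounded
    by \<open>n + 1\<close> such factors.\<close>
  define b where "b = (R + 1) / (1 - R * A)"
  have b: "1 \<le> b" "1 / (1 - R * A) \<le> b" using R A by (auto simp: b_def field_simps)
  have fb: "cmod (factor n z) \<le> b" if "cmod z \<le> R" for n z
  proof -
    have "cmod (z - zero n) \<le> R + 1"
      using norm_triangle_ineq4[of z "zero n"] that zero_less1[of n] by linarith
    then have "cmod (z - zero n) / cmod (1 - cnj (zero n) * z) \<le> b"
      unfolding b_def using den[OF that, of n] R by (intro frac_le) auto
    then show ?thesis using c by (simp add: factor_def moebius_def norm_mult norm_divide)
  qed
  have tb: "cmod (tm n z) \<le> b ^ (n + 1)" if "cmod z \<le> R" for n z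
  proof -
    have "cmod (Psi n z) \<le> b ^ n"
      unfolding Psi_def prod_norm[symmetric]
      using prod_mono[of "{..<n}" "\<lambda>i. cmod (factor i z)" "\<lambda>i. b"] fb[OF that] by simp
    moreover have "cmod (szego (zero n) z) \<le> b"
    proof -
      have "(cmod (zero n))\<^sup>2 \<le> 1" using zero_less1[of n] by (simp add: abs_square_le_1)
      then have "cmod (szego (zero n) z) \<le> 1 / (1 - R * A)"
        unfolding szego_def norm_divide using den[OF that, of n] R
        by (intro frac_le) auto
      then show ?thesis using b by linarith
    qed
    ultimately have "cmod (tm n z) \<le> b ^ n * b" unfolding tm_def norm_mult using b by (intro mult_mono) auto
    then show ?thesis by (simp add: mult.commute)
  qed
  have hol: "tm n holomorphic_on ball 0 R" and cont: "continuous_on (cball 0 R) (tm n)" for n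
    unfolding tm_def[abs_def] Psi_def factor_def moebius_def szego_def
    using nz by (auto intro!: holomorphic_intros continuous_intros)
  have row: "cmod (tmc n i) \<le> b ^ (n + 1) / R ^ i" for n i
    unfolding tmc_def by (rule taylor_coeff_bound[OF _ hol cont]) (use R tb in auto)
  \<comment> \<open>Again half of the decay \<open>1 / R ^ i\<close> is spent, here against
    \<open>b ^ (n + 1)\<close>.\<close>
  define q where "q = 1 / sqrt R"
  have q: "0 < q" "q < 1" "q * q = 1 / R" using R by (auto simp: q_def)
  have "1 < 1 / q" using q by simp
  then obtain C where C: "1 \<le> C" "b \<le> (1 / q) ^ C" using power_threshold[of "1/q" b] by blast
  have "cmod (tmc n i) \<le> 1 * q ^ i" if "C * (n + 1) \<le> i" for n i
  proof -
    have "b ^ (n + 1) \<le> ((1 / q) ^ C) ^ (n + 1)" using C b by (intro power_mono) auto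
    also have "\<dots> = (1 / q) ^ (C * (n + 1))" by (rule power_mult[symmetric])
    also have "\<dots> \<le> (1 / q) ^ i" using that q by (intro power_increasing) auto
    finally have "b ^ (n + 1) / R ^ i \<le> (1 / q) ^ i / R ^ i" using R by (intro divide_right_mono) auto
    also have "\<dots> = (1 / q) ^ i * (1 / R) ^ i" by (simp add: power_divide)
    also have "\<dots> = 1 * q ^ i" using q by (simp add: q(3)[symmetric] power_mult_distrib power_divide)
    finally show ?thesis using row[of n i] by simp
  qed
  then show ?thesis
    unfolding decaying_orthonormal_def
    by (intro conjI allI tmc_ltwo tmc_orthonormal exI[of _ 1] exI[of _ C] exI[of _ q]) (use C q in auto)
qed

end

subsection \<open>Model spaces and blocks of coefficients\<close>

lemma wltwo_mono:
  assumes x: "x \<in> wltwo w" and w: "\<And>n. 0 \<le> w n" "\<And>n. 0 \<le> w' n" "\<And>n. w' n \<le> K * w n"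
  shows "x \<in> wltwo w'" "l2_norm_sq (wscale w' x) \<le> K * l2_norm_sq (wscale w x)"
proof -
  have s: "summable (\<lambda>n. K * (cmod (wscale w x n))\<^sup>2)"
    using x by (intro summable_mult) (simp add: wltwo_def ltwo_def)
  have le: "(cmod (wscale w' x n))\<^sup>2 \<le> K * (cmod (wscale w x n))\<^sup>2" for n
    using mult_right_mono[OF w(3)[of n], of "(cmod (x n))\<^sup>2"] w(1,2)[of n]
    by (simp add: norm_wscale mult_ac)
  have s': "summable (\<lambda>n. (cmod (wscale w' x n))\<^sup>2)"
    by (rule summable_comparison_test'[OF s, of 0]) (use le in simp)
  then show "x \<in> wltwo w'" by (simp add: wltwo_def ltwo_def)
  have "l2_norm_sq (wscale w' x) \<le> (\<Sum>n. K * (cmod (wscale w x n))\<^sup>2)"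
    unfolding l2_norm_sq_def by (rule suminf_le[OF le s' s])
  also have "\<dots> = K * l2_norm_sq (wscale w x)"
    unfolding l2_norm_sq_def using x by (intro suminf_mult) (simp add: wltwo_def ltwo_def)
  finally show "l2_norm_sq (wscale w' x) \<le> K * l2_norm_sq (wscale w x)" .
qed

text \<open>Point evaluations are bounded: powers of a radius below 1 beat the polynomially small
  weights, and Cauchy-Schwarz does the rest.\<close>

lemma wltwo_pointwise:
  assumes z: "cmod z < 1"
  obtains C where "0 \<le> C" "\<And>x. x \<in> wltwo (wpow \<alpha>) \<Longrightarrow> summable (\<lambda>i. cmod (x i * z ^ i))"
    "\<And>x. x \<in> wltwo (wpow \<alpha>) \<Longrightarrow> cmod (\<Sum>i. x i * z ^ i) \<le> C * sqrt (l2_norm_sq (wscale (wpow \<alpha>) x))"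
proof -
  define r where "r = (1 + cmod z) / 2"
  have r: "0 < r" "r < 1" "cmod z \<le> r" using z by (auto simp: r_def add_pos_nonneg)
  define e where "e i = r ^ i / sqrt (wpow \<alpha> i)" for i
  have e2: "(e i)\<^sup>2 = (real i + 1) powr (- \<alpha>) * r ^ (2 * i)" for i
    using wpow_pos[of \<alpha> i]
    by (simp add: e_def wpow_def power_divide powr_minus field_simps) (simp add: power_mult)?
  have se: "summable (\<lambda>i. (e i)\<^sup>2)"
    unfolding e2
  proof -
    define q where "q = - \<alpha>"
    have "(\<lambda>i. (real i + 1) powr q * r ^ (2 * i)) \<in> O(\<lambda>i. r ^ i)"
      using r(1,2) by real_asymp
    moreover have "summable (\<lambda>i. norm (r ^ i))" using r by simp
    ultimately show "summable (\<lambda>i. (real i + 1) powr (- \<alpha>) * r ^ (2 * i))"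
      unfolding q_def by (rule summable_comparison_test_bigo[rotated])
  qed
  have main: "summable (\<lambda>i. cmod (x i * z ^ i)) \<and>
      cmod (\<Sum>i. x i * z ^ i) \<le> sqrt (\<Sum>i. (e i)\<^sup>2) * sqrt (l2_norm_sq (wscale (wpow \<alpha>) x))"
    if x: "x \<in> wltwo (wpow \<alpha>)" for x
  proof -
    define b where "b i = cmod (wscale (wpow \<alpha>) x i)" for i
    have sb: "summable (\<lambda>i. (b i)\<^sup>2)" using x by (simp add: b_def wltwo_def ltwo_def)
    have eb: "\<bar>e i * b i\<bar> = r ^ i * cmod (x i)" for i
      using wpow_pos[of \<alpha> i] r by (simp add: e_def b_def wscale_def abs_mult norm_mult)
    have le: "cmod (x i * z ^ i) \<le> \<bar>e i * b i\<bar>" for i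
      unfolding eb using r by (simp add: norm_mult norm_power mult.commute[of "cmod (x i)"] mult_right_mono power_mono)
    have seb: "summable (\<lambda>i. \<bar>e i * b i\<bar>)" by (rule summable_mult_L2[OF se sb])
    have s: "summable (\<lambda>i. cmod (x i * z ^ i))"
      by (rule summable_comparison_test'[OF seb, of 0]) (use le in simp)
    have "cmod (\<Sum>i. x i * z ^ i) \<le> (\<Sum>i. cmod (x i * z ^ i))" by (rule summable_norm[OF s])
    also have "\<dots> \<le> (\<Sum>i. \<bar>e i * b i\<bar>)" by (rule suminf_le[OF le s seb])
    also have "\<dots> \<le> sqrt (\<Sum>i. (e i)\<^sup>2) * sqrt (\<Sum>i. (b i)\<^sup>2)" by (rule suminf_Cauchy_Schwarz[OF se sb])
    finally show ?thesis using s by (simp add: l2_norm_sq_def b_def)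
  qed
  show ?thesis
    by (rule that[of "sqrt (\<Sum>i. (e i)\<^sup>2)"]) (use main se in \<open>auto intro: suminf_nonneg\<close>)
qed

section \<open>Dirichlet-type spaces as weighted sequence spaces\<close>

lemma dirichlet_iff: "f \<in> dirichlet \<alpha> \<longleftrightarrow> f \<in> analytic_on_disc 1 \<and> taylor_coeff f \<in> wltwo (wpow \<alpha>)"
  by (simp add: dirichlet_def wltwo_def ltwo_def norm_wscale wpow_def mult.commute)

lemma dirichlet_norm_eq: "dirichlet_norm \<alpha> f = sqrt (l2_norm_sq (wscale (wpow \<alpha>) (taylor_coeff f)))"
  by (simp add: dirichlet_norm_def l2_norm_sq_def norm_wscale wpow_def mult.commute)

lemma dirichlet_hol: "f \<in> dirichlet \<alpha> \<Longrightarrow> f holomorphic_on ball 0 1"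
  by (simp add: dirichlet_iff analytic_on_disc_def)

lemma dirichlet_outside: "f \<in> dirichlet \<alpha> \<Longrightarrow> z \<notin> ball 0 1 \<Longrightarrow> f z = 0"
  by (simp add: dirichlet_iff analytic_on_disc_def)

lemma dirichlet_coeffs: "f \<in> dirichlet \<alpha> \<Longrightarrow> taylor_coeff f \<in> wltwo (wpow \<alpha>)"
  by (simp add: dirichlet_iff)

lemma dirichlet_eqI:
  "f \<in> dirichlet \<alpha> \<Longrightarrow> g \<in> dirichlet \<alpha> \<Longrightarrow> taylor_coeff f = taylor_coeff g \<Longrightarrow> f = g"
  by (rule analytic_on_disc_eqI[of _ 1]) (auto simp: dirichlet_iff)

lemma dirichlet_add:
  assumes "f \<in> dirichlet \<alpha>" "g \<in> dirichlet \<alpha>"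
  shows "(\<lambda>z. f z + c * g z) \<in> dirichlet \<alpha>"
    "taylor_coeff (\<lambda>z. f z + c * g z) = (\<lambda>n. taylor_coeff f n + c * taylor_coeff g n)"
proof -
  note h = assms[THEN dirichlet_hol]
  show tc: "taylor_coeff (\<lambda>z. f z + c * g z) = (\<lambda>n. taylor_coeff f n + c * taylor_coeff g n)"
    using h by (subst taylor_coeff_add1) (auto simp: taylor_coeff_cmult1 intro!: holomorphic_on_mult[OF holomorphic_on_const])
  show "(\<lambda>z. f z + c * g z) \<in> dirichlet \<alpha>"
    unfolding dirichlet_iff tc using assms h
    by (auto simp: dirichlet_iff analytic_on_disc_def intro!: wltwo_add wltwo_cmult holomorphic_intros)
qed

definition pser :: "(nat \<Rightarrow> complex) \<Rightarrow> complex \<Rightarrow> complex" where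
  "pser x z = (if z \<in> ball 0 1 then (\<Sum>i. x i * z ^ i) else 0)"

lemma pser_dirichlet:
  assumes x: "x \<in> wltwo (wpow \<alpha>)"
  shows "pser x \<in> dirichlet \<alpha>" "taylor_coeff (pser x) = x"
proof -
  have s: "(\<lambda>i. x i * z ^ i) sums pser x z" if "z \<in> ball 0 1" for z
  proof -
    have "summable (\<lambda>i. cmod (x i * z ^ i))"
      by (rule wltwo_pointwise[of z \<alpha>]) (use that x in auto)
    from summable_sums[OF summable_norm_cancel[OF this]] show ?thesis using that by (simp add: pser_def)
  qed
  show tc: "taylor_coeff (pser x) = x"
    by (rule ext, rule taylor_coeff_unique[OF zero_less_one s])
  have "pser x holomorphic_on ball 0 1"
    by (rule power_series_holomorphic[of _ _ x]) (use s in simp)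
  then show "pser x \<in> dirichlet \<alpha>"
    using x by (simp add: dirichlet_iff tc analytic_on_disc_def pser_def)
qed

lemma pser_taylor_coeff:
  assumes "f \<in> dirichlet \<alpha>" shows "pser (taylor_coeff f) = f"
  by (rule dirichlet_eqI[OF _ assms]) (use pser_dirichlet dirichlet_coeffs[OF assms] in auto)

context blaschke
begin

section \<open>Periodicity of the system and the basis of the model space\<close>

lemma zero_add [simp]: "zero (n + m) = zero n" "zero (m + n) = zero n"
  by (simp_all add: zero_def)

lemma factor_add [simp]: "factor (n + m) = factor n" "factor (m + n) = factor n"
  by (simp_all add: factor_def)

lemma Psi_add: "Psi (n + m) z = Psi m z * Psi n z"
proof -
  have "Psi (m + n) z = (\<Prod>i=0..<m. factor i z) * (\<Prod>i=0 + m..<n + m. factor i z)"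
    using prod.atLeastLessThan_concat[of 0 m "m + n" "\<lambda>i. factor i z"]
    by (simp add: Psi_def lessThan_atLeast0 add.commute)
  also have "\<dots> = Psi m z * Psi n z"
    by (subst prod.shift_bounds_nat_ivl) (simp add: Psi_def lessThan_atLeast0)
  finally show ?thesis by (simp add: add.commute)
qed

text \<open>\<open>B\<close> is prescribed on the unit disc only; \<open>Psi m\<close> is an
  explicit formula that can also be evaluated outside, as the reflection in the circle of radius
  \<open>s\<close> requires.\<close>

lemma B_eq: "z \<in> ball 0 1 \<Longrightarrow> B z = Psi m z"
proof -
  assume z: "z \<in> ball 0 1"
  have f: "factor j z = (if j = 0 then c else 1) * ((z - a j) / (1 - cnj (a j) * z))" if "j < m" for j
    using that by (simp add: factor_def moebius_def zero_def)
  have "Psi m z = (\<Prod>j<m. (if j = 0 then c else 1)) * (\<Prod>j<m. (z - a j) / (1 - cnj (a j) * z))"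
    unfolding Psi_def by (subst prod.distrib[symmetric]) (intro prod.cong, auto simp: f)
  also have "(\<Prod>j<m. (if j = 0 then c else 1)) = c" using m by (subst prod.delta) auto
  finally show ?thesis using B[OF z] by simp
qed

lemma tm_add: "tm (n + m) z = Psi m z * tm n z"
  by (simp add: tm_def Psi_add mult_ac)

lemma tm_block: "tm (k * m + j) z = Psi m z ^ k * tm j z"
proof (induction k)
  case (Suc k)
  have "Suc k * m + j = (k * m + j) + m" by simp
  then show ?case using Suc by (simp only: tm_add power_Suc mult.assoc)
qed simp

lemma div_mod_block: "j < m \<Longrightarrow> (k * m + j) div m = k" "j < m \<Longrightarrow> (k * m + j) mod m = j"
  using m by (auto simp: div_add1_eq mod_add_eq)

text \<open>The first \<open>m\<close> functions \<open>tm j\<close> turn out to be an orthonormal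
  basis of the model space, and this is the element whose coordinates are the \<open>k\<close>-th
  block of \<open>y\<close>.\<close>

definition block :: "(nat \<Rightarrow> complex) \<Rightarrow> nat \<Rightarrow> complex \<Rightarrow> complex" where
  "block y k z = (if z \<in> ball 0 1 then (\<Sum>j<m. y (k * m + j) * tm j z) else 0)"

lemma taylor_coeff_block: "taylor_coeff (block y k) = (\<lambda>i. \<Sum>j<m. y (k * m + j) * tmc j i)"
proof -
  have "taylor_coeff (block y k) = taylor_coeff (\<lambda>z. \<Sum>j<m. y (k * m + j) * tm j z)"
    by (rule taylor_coeff_cong1) (simp add: block_def)
  then show ?thesis by (simp add: taylor_coeff_sum1[OF tm_hol] tmc_def)
qed

lemma l2_inner_block_tmc: "j < m \<Longrightarrow> l2_inner (taylor_coeff (block y k)) (tmc j) = y (k * m + j)"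
  unfolding taylor_coeff_block
  by (subst l2_inner_sum_left) (auto simp: tmc_ltwo tmc_orthonormal if_distrib cong: if_cong)

lemma hardy_inner_block: "hardy_inner 1 (block x k) (block y k) = (\<Sum>j<m. x (k * m + j) * cnj (y (k * m + j)))"
proof -
  have "taylor_coeff (block x k) \<in> ltwo" unfolding taylor_coeff_block by (intro ltwo_sum tmc_ltwo)
  then have "hardy_inner 1 (block x k) (block y k) =
      (\<Sum>j<m. cnj (y (k * m + j)) * l2_inner (taylor_coeff (block x k)) (tmc j))"
    unfolding hardy_inner_1 by (subst (2) taylor_coeff_block, subst l2_inner_sum_right) (auto simp: tmc_ltwo)
  then show ?thesis by (simp add: l2_inner_block_tmc mult.commute)
qed

lemma hardy_norm_block: "(hardy_norm 1 (block y k))\<^sup>2 = (\<Sum>j<m. (cmod (y (k * m + j)))\<^sup>2)"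
proof -
  have l: "taylor_coeff (block y k) \<in> ltwo" unfolding taylor_coeff_block by (intro ltwo_sum tmc_ltwo)
  have "complex_of_real ((hardy_norm 1 (block y k))\<^sup>2) = hardy_inner 1 (block y k) (block y k)"
    using l by (simp add: hardy_inner_1 hardy_norm_1 l2_inner_self)
  also have "\<dots> = of_real (\<Sum>j<m. (cmod (y (k * m + j)))\<^sup>2)"
    by (simp only: hardy_inner_block complex_norm_square[symmetric] of_real_sum)
  finally show ?thesis by (simp only: of_real_eq_iff)
qed

lemma h2_block: "h2 (block y k)"
  by (rule h2_cong[of "\<lambda>z. \<Sum>j<m. y (k * m + j) * tm j z"]) (auto intro!: h2_sum h2_tm simp: block_def)

lemma block_model_space: "block y k \<in> model_space B"
proof -
  have "hardy_inner 1 (block y k) (mult_op B g) = 0" if "g \<in> hardy 1" for g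
  proof -
    have g: "h2 g" using that by (simp add: hardy_1_iff)
    have t: "taylor_coeff (mult_op B g) = taylor_coeff (\<lambda>z. Psi m z * g z)"
      by (rule taylor_coeff_cong1) (simp add: mult_op_def B_eq)
    have l: "taylor_coeff (mult_op B g) \<in> ltwo"
      unfolding t by (rule h2_ltwo[OF h2_isometricD(2)[OF Psi_isometric g]])
    have "l2_inner (tmc j) (taylor_coeff (mult_op B g)) = 0" if "j < m" for j
      using l2_inner_Psi_tm_less[OF g that] l2_inner_cnj[OF l tmc_ltwo, of j] by (simp add: t)
    then show ?thesis
      unfolding hardy_inner_1 taylor_coeff_block using l
      by (subst l2_inner_sum_left) (auto simp: tmc_ltwo)
  qed
  then show ?thesis
    using h2_block by (auto simp: model_space_def ominus_def hardy_1_iff block_def)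
qed

text \<open>The remainder in the expansion of \<open>h\<close> after \<open>m\<close> terms lies in
  the range of \<open>B\<close>. It is orthogonal to \<open>h\<close> and to the block, hence to
  itself.\<close>

lemma model_space_block:
  assumes h: "h \<in> model_space B" and y: "\<And>j. j < m \<Longrightarrow> y (k * m + j) = l2_inner (taylor_coeff h) (tmc j)"
  shows "h = block y k"
proof
  fix z
  have h1: "h \<in> hardy 1" and ho: "\<And>g. g \<in> hardy 1 \<Longrightarrow> hardy_inner 1 h (mult_op B g) = 0"
    using h by (auto simp: model_space_def ominus_def)
  have h2h: "h2 h" using h1 by (simp add: hardy_1_iff)
  obtain r where r: "h2 r"
    and hr: "\<And>z. z \<in> ball 0 1 \<Longrightarrow> h z = (\<Sum>j<m. l2_inner (taylor_coeff h) (tmc j) * tm j z) + Psi m z * r z"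
    using tm_expansion[OF h2h, of m] by blast
  have hb: "h z = block y k z + Psi m z * r z" if "z \<in> ball 0 1" for z
    using hr[OF that] that by (simp add: block_def y)
  \<comment> \<open>Truncated because membership in \<open>hardy 1\<close> demands the value 0 off
    the disc.\<close>
  define R where "R z = (if z \<in> ball 0 1 then r z else 0)" for z
  have R: "R \<in> hardy 1" unfolding hardy_1_iff
    by (auto intro: h2_cong[OF r] simp: R_def)
  note Pr = h2_isometricD(2)[OF Psi_isometric r, of m]
  have t: "taylor_coeff (mult_op B R) = taylor_coeff (\<lambda>z. Psi m z * r z)"
    by (rule taylor_coeff_cong1) (simp add: mult_op_def B_eq R_def)
  have "taylor_coeff h = taylor_coeff (\<lambda>z. block y k z + Psi m z * r z)"
    by (rule taylor_coeff_cong1) (rule hb)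
  also have "\<dots> = (\<lambda>i. taylor_coeff (block y k) i + taylor_coeff (mult_op B R) i)"
    unfolding t by (rule taylor_coeff_add1[OF h2_hol[OF h2_block] h2_hol[OF Pr]])
  finally have th: "taylor_coeff h = \<dots>" .
  have l: "taylor_coeff (mult_op B R) \<in> ltwo" unfolding t by (rule h2_ltwo[OF Pr])
  have "l2_inner (taylor_coeff (block y k)) (taylor_coeff (mult_op B R)) = 0"
    using block_model_space[of y k] R by (auto simp: model_space_def ominus_def hardy_inner_1)
  moreover have "l2_inner (taylor_coeff h) (taylor_coeff (mult_op B R)) = 0"
    using ho[OF R] by (simp add: hardy_inner_1)
  ultimately have "l2_inner (taylor_coeff (mult_op B R)) (taylor_coeff (mult_op B R)) = 0"
    using l h2_ltwo[OF h2_block[of y k]] by (simp add: th l2_inner_add_left)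
  then have "l2_norm_sq (taylor_coeff (mult_op B R)) = 0" using l by (simp add: l2_inner_self)
  then have z0: "taylor_coeff (\<lambda>z. Psi m z * r z) i = 0" for i
    using l2_norm_sq_eq_0D[OF l] by (simp add: t)
  show "h z = block y k z"
  proof (cases "z \<in> ball 0 1")
    case True
    have "Psi m z * r z = 0"
      using taylor_coeff_sums[OF h2_hol[OF Pr] True] by (simp add: z0 sums_iff)
    then show ?thesis using hb[OF True] by simp
  qed (use h1 in \<open>auto simp: hardy_1_iff block_def\<close>)
qed

end

subsection \<open>Expansions in powers of the Blaschke product\<close>

locale blaschke_dirichlet = blaschke +
  fixes \<alpha> :: real and N :: nat
  assumes \<alpha>: "\<alpha> < 0" and N: "1 \<le> N"
begin

definition tm_coeffs :: "(complex \<Rightarrow> complex) \<Rightarrow> nat \<Rightarrow> complex" where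
  "tm_coeffs f = coords tmc (taylor_coeff f)"

definition tm_series :: "(nat \<Rightarrow> complex) \<Rightarrow> complex \<Rightarrow> complex" where
  "tm_series y = pser (coords (\<lambda>i n. cnj (tmc n i)) y)"

abbreviation "W \<equiv> wltwo (wpow \<alpha>)"

lemma \<alpha>0: "\<alpha> \<le> 0" using \<alpha> by simp

lemma coords_W: "x \<in> W \<Longrightarrow> coords tmc x \<in> W" "x \<in> W \<Longrightarrow> coords (\<lambda>i n. cnj (tmc n i)) x \<in> W"
  by (rule coords_bounded[OF rows_decaying \<alpha>0], blast) (rule coords_bounded[OF columns_decaying \<alpha>0], blast)

lemma tm_coeffs_W: "f \<in> dirichlet \<alpha> \<Longrightarrow> tm_coeffs f \<in> W"
  unfolding tm_coeffs_def by (intro coords_W dirichlet_coeffs)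

lemma tm_series_dirichlet: "y \<in> W \<Longrightarrow> tm_series y \<in> dirichlet \<alpha>"
  unfolding tm_series_def by (intro pser_dirichlet coords_W)

lemma taylor_coeff_tm_series: "y \<in> W \<Longrightarrow> taylor_coeff (tm_series y) = coords (\<lambda>i n. cnj (tmc n i)) y"
  unfolding tm_series_def by (intro pser_dirichlet(2)[of _ \<alpha>] coords_W)

lemma tm_coeffs_tm_series: "y \<in> W \<Longrightarrow> tm_coeffs (tm_series y) = y"
  unfolding tm_coeffs_def taylor_coeff_tm_series
  using coords_inverse[OF columns_decaying _ \<alpha>0, of y] rows_decaying by simp

lemma tm_series_tm_coeffs: "f \<in> dirichlet \<alpha> \<Longrightarrow> tm_series (tm_coeffs f) = f"
  unfolding tm_series_def tm_coeffs_def
  by (simp add: coords_inverse[OF rows_decaying columns_decaying \<alpha>0 dirichlet_coeffs] pser_taylor_coeff)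

lemma tm_coeffs_inj: "f \<in> dirichlet \<alpha> \<Longrightarrow> g \<in> dirichlet \<alpha> \<Longrightarrow> tm_coeffs f = tm_coeffs g \<Longrightarrow> f = g"
  using tm_series_tm_coeffs by metis

lemma tm_coeffs_add:
  "f \<in> dirichlet \<alpha> \<Longrightarrow> g \<in> dirichlet \<alpha> \<Longrightarrow> tm_coeffs (\<lambda>z. f z + p * g z) = (\<lambda>n. tm_coeffs f n + p * tm_coeffs g n)"
  unfolding tm_coeffs_def by (simp add: dirichlet_add coords_add[OF rows_decaying \<alpha>0 dirichlet_coeffs dirichlet_coeffs])

lemma tm_series_add:
  assumes "x \<in> W" "y \<in> W" shows "tm_series (\<lambda>n. x n + p * y n) = (\<lambda>z. tm_series x z + p * tm_series y z)"
proof (rule tm_coeffs_inj)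
  show "tm_series (\<lambda>n. x n + p * y n) \<in> dirichlet \<alpha>"
    using assms by (intro tm_series_dirichlet wltwo_add wltwo_cmult)
  show "(\<lambda>z. tm_series x z + p * tm_series y z) \<in> dirichlet \<alpha>"
    using assms by (intro dirichlet_add tm_series_dirichlet)
  show "tm_coeffs (tm_series (\<lambda>n. x n + p * y n)) = tm_coeffs (\<lambda>z. tm_series x z + p * tm_series y z)"
    using assms by (simp add: tm_coeffs_add tm_series_dirichlet tm_coeffs_tm_series wltwo_add wltwo_cmult)
qed

lemma tm_series_norm_bound:
  obtains K where "0 \<le> K" "\<And>y. y \<in> W \<Longrightarrow> dirichlet_norm \<alpha> (tm_series y) \<le> K * sqrt (l2_norm_sq (wscale (wpow \<alpha>) y))"
proof -
  obtain K where K: "0 \<le> K"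
    "\<And>x n. x \<in> W \<Longrightarrow> summable (\<lambda>i. cmod (x i * cnj (cnj (tmc i n))))"
    "\<And>x. x \<in> W \<Longrightarrow> coords (\<lambda>i n. cnj (tmc n i)) x \<in> W"
    "\<And>x. x \<in> W \<Longrightarrow> l2_norm_sq (wscale (wpow \<alpha>) (coords (\<lambda>i n. cnj (tmc n i)) x)) \<le> K * l2_norm_sq (wscale (wpow \<alpha>) x)"
    by (rule coords_bounded[OF columns_decaying \<alpha>0]) (rule that; blast)
  have "dirichlet_norm \<alpha> (tm_series y) \<le> sqrt K * sqrt (l2_norm_sq (wscale (wpow \<alpha>) y))" if "y \<in> W" for y
    unfolding dirichlet_norm_eq taylor_coeff_tm_series[OF that] using K(4)[OF that] by (simp flip: real_sqrt_mult)
  then show ?thesis using that[of "sqrt K"] K(1) by auto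
qed

lemma tm_series_pointwise_bound:
  assumes "z \<in> ball 0 1"
  obtains C where "0 \<le> C" "\<And>y. y \<in> W \<Longrightarrow> cmod (tm_series y z) \<le> C * sqrt (l2_norm_sq (wscale (wpow \<alpha>) y))"
proof -
  from assms have "cmod z < 1" by simp
  then obtain C where C: "0 \<le> C" "\<And>x. x \<in> W \<Longrightarrow> summable (\<lambda>i. cmod (x i * z ^ i))"
    "\<And>x. x \<in> W \<Longrightarrow> cmod (\<Sum>i. x i * z ^ i) \<le> C * sqrt (l2_norm_sq (wscale (wpow \<alpha>) x))"
    by (rule wltwo_pointwise) (rule that; blast)
  obtain K where K: "0 \<le> K" "\<And>y. y \<in> W \<Longrightarrow> dirichlet_norm \<alpha> (tm_series y) \<le> K * sqrt (l2_norm_sq (wscale (wpow \<alpha>) y))"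
    by (rule tm_series_norm_bound) (rule that; blast)
  have "cmod (tm_series y z) \<le> (C * K) * sqrt (l2_norm_sq (wscale (wpow \<alpha>) y))" if y: "y \<in> W" for y
  proof -
    have "cmod (tm_series y z) \<le> C * dirichlet_norm \<alpha> (tm_series y)"
      unfolding dirichlet_norm_eq taylor_coeff_tm_series[OF y]
      using C(3)[OF coords_W(2)[OF y]] assms by (simp add: tm_series_def pser_def)
    also have "\<dots> \<le> C * (K * sqrt (l2_norm_sq (wscale (wpow \<alpha>) y)))"
      by (intro mult_left_mono K(2) y C(1))
    finally show ?thesis by (simp add: mult.assoc)
  qed
  then show ?thesis using that[of "C * K"] C(1) K(1) by auto
qed

definition cut :: "(nat \<Rightarrow> complex) \<Rightarrow> nat \<Rightarrow> nat \<Rightarrow> complex" where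
  "cut y J n = (if n < J then y n else 0)"

lemma cut_W: "cut y J \<in> W"
  by (rule wltwo_finite, rule finite_subset[of _ "{..<J}"]) (auto simp: cut_def split: if_splits)

lemma tm_series_cut: "tm_series (cut y J) z = (if z \<in> ball 0 1 then (\<Sum>i<J. y i * tm i z) else 0)"
proof -
  define S where "S z = (if z \<in> ball 0 1 then (\<Sum>i<J. y i * tm i z) else 0)" for z
  have t: "taylor_coeff S = coords (\<lambda>i n. cnj (tmc n i)) (cut y J)"
  proof -
    have "taylor_coeff S = taylor_coeff (\<lambda>z. \<Sum>i<J. y i * tm i z)"
      by (rule taylor_coeff_cong1) (simp add: S_def)
    also have "\<dots> = (\<lambda>k. \<Sum>i<J. y i * tmc i k)" by (simp add: taylor_coeff_sum1[OF tm_hol] tmc_def)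
    also have "\<dots> = coords (\<lambda>i n. cnj (tmc n i)) (cut y J)"
      by (rule ext, unfold coords_def, subst suminf_finite[of "{..<J}"]) (auto simp: cut_def)
    finally show ?thesis .
  qed
  have "S holomorphic_on ball 0 1"
    by (rule holomorphic_transform[of "\<lambda>z. \<Sum>i<J. y i * tm i z"])
      (auto simp: S_def intro!: holomorphic_on_sum holomorphic_on_mult[OF holomorphic_on_const] tm_hol)
  then have "S \<in> dirichlet \<alpha>"
    unfolding dirichlet_iff t using coords_W(2)[OF cut_W] by (auto simp: analytic_on_disc_def S_def)
  then have "tm_series (cut y J) = S"
    by (intro dirichlet_eqI[of _ \<alpha>] tm_series_dirichlet cut_W) (simp_all add: t taylor_coeff_tm_series cut_W)
  then show ?thesis by (simp add: S_def)
qed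

lemma tm_series_tail:
  assumes "y \<in> W"
  shows "(\<lambda>z. tm_series y z - tm_series (cut y J) z) = tm_series (\<lambda>n. if n < J then 0 else y n)"
proof -
  have "(\<lambda>n. if n < J then 0 else y n) = (\<lambda>n. y n + (-1) * cut y J n)"
    by (auto simp: cut_def)
  then show ?thesis using tm_series_add[OF assms cut_W[of y J], of "-1"] by simp
qed

lemma tm_series_partial_sums: "y \<in> W \<Longrightarrow> (\<lambda>J. dirichlet_norm \<alpha> (\<lambda>z. tm_series y z - tm_series (cut y J) z)) \<longlonglongrightarrow> 0"
proof -
  assume y: "y \<in> W"
  obtain K where K: "0 \<le> K" "\<And>y. y \<in> W \<Longrightarrow> dirichlet_norm \<alpha> (tm_series y) \<le> K * sqrt (l2_norm_sq (wscale (wpow \<alpha>) y))"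
    by (rule tm_series_norm_bound) (rule that; blast)
  show "(\<lambda>J. dirichlet_norm \<alpha> (\<lambda>z. tm_series y z - tm_series (cut y J) z)) \<longlonglongrightarrow> 0"
  proof (rule Lim_null_comparison)
    have "(\<lambda>J. K * sqrt (l2_norm_sq (wscale (wpow \<alpha>) (\<lambda>n. if n < J then 0 else y n)))) \<longlonglongrightarrow> K * sqrt 0"
      by (intro tendsto_intros wltwo_tail[OF y])
    then show "(\<lambda>J. K * sqrt (l2_norm_sq (wscale (wpow \<alpha>) (\<lambda>n. if n < J then 0 else y n)))) \<longlonglongrightarrow> 0" by simp
    show "\<forall>\<^sub>F J in sequentially. norm (dirichlet_norm \<alpha> (\<lambda>z. tm_series y z - tm_series (cut y J) z)) \<le>
        K * sqrt (l2_norm_sq (wscale (wpow \<alpha>) (\<lambda>n. if n < J then 0 else y n)))"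
    proof (rule always_eventually, rule allI)
      fix J
      have "0 \<le> dirichlet_norm \<alpha> (\<lambda>z. tm_series y z - tm_series (cut y J) z)"
        unfolding tm_series_tail[OF y] dirichlet_norm_eq taylor_coeff_tm_series[OF wltwo_tail(1)[OF y]]
        using coords_W(2)[OF wltwo_tail(1)[OF y]] by (simp add: wltwo_def)
      then show "norm (dirichlet_norm \<alpha> (\<lambda>z. tm_series y z - tm_series (cut y J) z)) \<le>
        K * sqrt (l2_norm_sq (wscale (wpow \<alpha>) (\<lambda>n. if n < J then 0 else y n)))"
        using K(2)[OF wltwo_tail(1)[OF y]] by (simp add: tm_series_tail[OF y])
    qed
  qed
qed

lemma tm_series_sums:
  assumes y: "y \<in> W" and z: "z \<in> ball 0 1"
  shows "(\<lambda>i. y i * tm i z) sums tm_series y z"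
proof -
  obtain C where C: "0 \<le> C" "\<And>y. y \<in> W \<Longrightarrow> cmod (tm_series y z) \<le> C * sqrt (l2_norm_sq (wscale (wpow \<alpha>) y))"
    by (rule tm_series_pointwise_bound[OF z]) (rule that; blast)
  show ?thesis
    unfolding sums_def
  proof (rule LIM_zero_cancel, rule Lim_null_comparison)
  have "(\<lambda>J. C * sqrt (l2_norm_sq (wscale (wpow \<alpha>) (\<lambda>n. if n < J then 0 else y n)))) \<longlonglongrightarrow> C * sqrt 0"
    by (intro tendsto_intros wltwo_tail[OF y])
  then show "(\<lambda>J. C * sqrt (l2_norm_sq (wscale (wpow \<alpha>) (\<lambda>n. if n < J then 0 else y n)))) \<longlonglongrightarrow> 0" by simp
  show "\<forall>\<^sub>F J in sequentially. norm ((\<Sum>i<J. y i * tm i z) - tm_series y z) \<le>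
        C * sqrt (l2_norm_sq (wscale (wpow \<alpha>) (\<lambda>n. if n < J then 0 else y n)))"
  proof (rule always_eventually, rule allI)
    fix J
    have "tm_series y z - (\<Sum>i<J. y i * tm i z) = tm_series (\<lambda>n. if n < J then 0 else y n) z"
      using fun_cong[OF tm_series_tail[OF y, of J], of z] z by (simp add: tm_series_cut)
    then show "norm ((\<Sum>i<J. y i * tm i z) - tm_series y z) \<le>
        C * sqrt (l2_norm_sq (wscale (wpow \<alpha>) (\<lambda>n. if n < J then 0 else y n)))"
      using C(2)[OF wltwo_tail(1)[OF y]] by (simp add: norm_minus_commute)
  qed
  qed
qed

lemma sum_block: "(\<Sum>n\<in>{k*m..<k*m+m}. g n) = (\<Sum>j<m. g (k * m + j))"
  using sum.shift_bounds_nat_ivl[of g 0 "k*m" m] by (simp add: lessThan_atLeast0 add.commute)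

lemma summable_blocks:
  fixes g :: "nat \<Rightarrow> real"
  assumes "summable g" "\<And>n. 0 \<le> g n"
  shows "(\<lambda>k. \<Sum>j<m. g (k * m + j)) sums suminf g"
  using sums_group[OF summable_sums[OF assms(1)], of m] m by (simp add: sum_block)

text \<open>The expansion weighs by the block number, the Dirichlet norm by the index itself; the
  two differ by a bounded factor.\<close>

lemma wpow_block:
  assumes "n div m = k" shows "wpow \<alpha> k \<le> real m powr (- \<alpha>) * wpow \<alpha> n" "wpow \<alpha> n \<le> wpow \<alpha> k"
proof -
  have "n = k * m + n mod m" using assms by (metis div_mult_mod_eq)
  moreover have "n mod m < m" using m by simp
  ultimately have "n + 1 \<le> m * (k + 1)" by (simp add: algebra_simps)
  then show "wpow \<alpha> k \<le> real m powr (- \<alpha>) * wpow \<alpha> n" by (rule wpow_dilation[OF \<alpha>0 m])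
  have "k \<le> n" using assms div_le_dividend by blast
  then show "wpow \<alpha> n \<le> wpow \<alpha> k" unfolding wpow_def using \<alpha> by (intro powr_mono2') auto
qed

lemma block_partial_sum: "(\<Sum>k<n. B z ^ k * block y k z) = tm_series (cut y (n * m)) z"
proof (cases "z \<in> ball 0 1")
  case True
  have "(\<Sum>k<n. B z ^ k * block y k z) = (\<Sum>k<n. \<Sum>j<m. y (k * m + j) * tm (k * m + j) z)"
    using True by (simp add: block_def B_eq tm_block sum_distrib_left mult_ac)
  also have "\<dots> = (\<Sum>i<n*m. y i * tm i z)"
    using sum.nat_group[of "\<lambda>i. y i * tm i z" m n] by (simp add: sum_block)
  finally show ?thesis using True by (simp add: tm_series_cut)
qed (simp add: block_def tm_series_cut)

text \<open>Existence of the expansion: its partial sums are the Takenaka-Malmquist partial sums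
  taken at multiples of \<open>m\<close>.\<close>

lemma expansion_tm_series:
  assumes y: "y \<in> W"
  shows "blaschke_expansion \<alpha> B (tm_series y) (block y)"
  unfolding blaschke_expansion_def
proof (intro conjI allI block_model_space)
  have y2: "summable (\<lambda>n. wpow \<alpha> n * (cmod (y n))\<^sup>2)"
    using y by (simp add: wltwo_def ltwo_def norm_wscale wpow_pos less_imp_le)
  have "summable (\<lambda>k. real m powr (- \<alpha>) * (\<Sum>j<m. wpow \<alpha> (k * m + j) * (cmod (y (k * m + j)))\<^sup>2))"
    using summable_blocks[OF y2] wpow_pos[of \<alpha>] by (intro summable_mult) (auto simp: sums_iff less_imp_le)
  then have "summable (\<lambda>k. wpow \<alpha> k * (\<Sum>j<m. (cmod (y (k * m + j)))\<^sup>2))"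
  proof (rule summable_comparison_test'[of _ 0])
    fix k
    have "wpow \<alpha> k * (cmod (y (k * m + j)))\<^sup>2 \<le> real m powr (- \<alpha>) * (wpow \<alpha> (k * m + j) * (cmod (y (k * m + j)))\<^sup>2)" if "j < m" for j
      using mult_right_mono[OF wpow_block(1)[OF div_mod_block(1)[OF that, of k]], of "(cmod (y (k * m + j)))\<^sup>2"]
      by (simp add: mult.assoc)
    then show "norm (wpow \<alpha> k * (\<Sum>j<m. (cmod (y (k * m + j)))\<^sup>2)) \<le>
      real m powr (- \<alpha>) * (\<Sum>j<m. wpow \<alpha> (k * m + j) * (cmod (y (k * m + j)))\<^sup>2)"
      using wpow_pos[of \<alpha> k] by (auto simp: sum_distrib_left sum_nonneg abs_mult intro!: sum_mono)
  qed
  then show "summable (\<lambda>k. (real k + 1) powr \<alpha> * (hardy_norm 1 (block y k))\<^sup>2)"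
    by (simp add: hardy_norm_block wpow_def)
  have "(\<lambda>n. dirichlet_norm \<alpha> (\<lambda>z. tm_series y z - tm_series (cut y (n * m)) z)) \<longlonglongrightarrow> 0"
  proof (rule filterlim_compose[OF tm_series_partial_sums[OF y]])
    show "filterlim (\<lambda>n. n * m) sequentially sequentially"
      using m by (intro filterlim_subseq strict_monoI) auto
  qed
  then show "(\<lambda>n. dirichlet_norm \<alpha> (\<lambda>z. tm_series y z - (\<Sum>k<n. B z ^ k * block y k z))) \<longlonglongrightarrow> 0"
    by (simp only: block_partial_sum)
qed

text \<open>Uniqueness, without which the \<open>THE\<close> in \<open>blaschke_coeff\<close> would
  be undetermined.\<close>

lemma expansion_unique:
  assumes f: "f \<in> dirichlet \<alpha>" and e: "blaschke_expansion \<alpha> B f h"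
  shows "h = block (tm_coeffs f)"
proof -
  \<comment> \<open>The given model space coefficients in the basis of the \<open>tm j\<close>, laid
    out as one sequence.\<close>
  define y where "y n = l2_inner (taylor_coeff (h (n div m))) (tmc (n mod m))" for n
  have hk: "h k = block y k" for k
    by (rule model_space_block) (use e in \<open>auto simp: blaschke_expansion_def y_def div_mod_block\<close>)
  have s: "summable (\<lambda>k. wpow \<alpha> k * (\<Sum>j<m. (cmod (y (k * m + j)))\<^sup>2))"
    using e by (simp add: blaschke_expansion_def hk hardy_norm_block wpow_def)
  have y: "y \<in> W"
    unfolding wltwo_def ltwo_def
  proof (rule CollectI, rule CollectI, rule summableI_nonneg_bounded)
    fix J
    have "(\<Sum>n<J. (cmod (wscale (wpow \<alpha>) y n))\<^sup>2) \<le> (\<Sum>n<J*m. (cmod (wscale (wpow \<alpha>) y n))\<^sup>2)"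
    proof (rule sum_mono2)
      have "J * 1 \<le> J * m" using m by (intro mult_le_mono) auto
      then show "{..<J} \<subseteq> {..<J * m}" by auto
    qed auto
    also have "\<dots> = (\<Sum>k<J. \<Sum>j<m. (cmod (wscale (wpow \<alpha>) y (k * m + j)))\<^sup>2)"
      by (simp add: sum.nat_group[symmetric] sum_block)
    also have "\<dots> \<le> (\<Sum>k<J. wpow \<alpha> k * (\<Sum>j<m. (cmod (y (k * m + j)))\<^sup>2))"
      unfolding sum_distrib_left
      by (intro sum_mono) (auto simp: norm_wscale wpow_pos less_imp_le intro!: mult_right_mono wpow_block div_mod_block)
    also have "\<dots> \<le> (\<Sum>k. wpow \<alpha> k * (\<Sum>j<m. (cmod (y (k * m + j)))\<^sup>2))"
      using wpow_pos[of \<alpha>] by (intro sum_le_suminf s) (auto simp: sum_nonneg less_imp_le)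
    finally show "(\<Sum>n<J. (cmod (wscale (wpow \<alpha>) y n))\<^sup>2) \<le> \<dots>" .
  qed simp
  \<comment> \<open>Common partial sums of the expansions of \<open>f\<close> and of
    \<open>tm_series y\<close>; both functions are their limit, hence equal.\<close>
  define S where "S n = (\<lambda>z. \<Sum>k<n. B z ^ k * block y k z)" for n
  have 1: "(\<lambda>n. dirichlet_norm \<alpha> (\<lambda>z. tm_series y z - S n z)) \<longlonglongrightarrow> 0"
    using expansion_tm_series[OF y] by (simp add: blaschke_expansion_def S_def)
  have 2: "(\<lambda>n. dirichlet_norm \<alpha> (\<lambda>z. f z - S n z)) \<longlonglongrightarrow> 0"
    using e by (simp add: blaschke_expansion_def S_def hk)
  have Sd: "S n \<in> dirichlet \<alpha>" for n
    using tm_series_dirichlet[OF cut_W, of y "n * m"] by (simp only: S_def block_partial_sum)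
  define D where "D g n = wscale (wpow \<alpha>) (taylor_coeff (\<lambda>z. g z - S n z))" for g n
  have Dl: "D g n \<in> ltwo" "D g n = (\<lambda>i. wscale (wpow \<alpha>) (taylor_coeff g) i - wscale (wpow \<alpha>) (taylor_coeff (S n)) i)"
    if "g \<in> dirichlet \<alpha>" for g n
    using dirichlet_coeffs[OF dirichlet_add(1)[OF that Sd[of n], of "-1"]] dirichlet_add(2)[OF that Sd[of n], of "-1"]
    by (auto simp: D_def wltwo_def wscale_diff)
  have lim: "(\<lambda>n. l2_norm_sq (D g n)) \<longlonglongrightarrow> 0"
    if "(\<lambda>n. dirichlet_norm \<alpha> (\<lambda>z. g z - S n z)) \<longlonglongrightarrow> 0" "g \<in> dirichlet \<alpha>" for g
  proof -
    have "(dirichlet_norm \<alpha> (\<lambda>z. g z - S n z))\<^sup>2 = l2_norm_sq (D g n)" for n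
      using Dl(1)[OF that(2), of n] by (simp add: dirichlet_norm_eq D_def)
    then show ?thesis using tendsto_power[OF that(1), of 2] by (simp only: power2_eq_square mult_zero_left)
  qed
  define X where "X = (\<lambda>i. wscale (wpow \<alpha>) (taylor_coeff f) i - wscale (wpow \<alpha>) (taylor_coeff (tm_series y)) i)"
  note sy = tm_series_dirichlet[OF y]
  have X: "X \<in> ltwo" unfolding X_def using dirichlet_coeffs[OF f] dirichlet_coeffs[OF sy]
    by (intro ltwo_diff) (auto simp: wltwo_def)
  have "l2_norm_sq X \<le> 2 * l2_norm_sq (D f n) + 2 * l2_norm_sq (D (tm_series y) n)" for n
  proof -
    have "X = (\<lambda>i. D f n i + (-1) * D (tm_series y) n i)" by (auto simp: X_def Dl(2)[OF f] Dl(2)[OF sy])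
    then show ?thesis
      using l2_norm_sq_add_le[OF Dl(1)[OF f] ltwo_cmult[OF Dl(1)[OF sy]], of n "-1" n] l2_norm_sq_cmult[OF Dl(1)[OF sy], of "-1" n]
      by simp
  qed
  moreover have "(\<lambda>n. 2 * l2_norm_sq (D f n) + 2 * l2_norm_sq (D (tm_series y) n)) \<longlonglongrightarrow> 2 * 0 + 2 * 0"
    by (intro tendsto_intros lim 1 2 f sy)
  ultimately have "l2_norm_sq X \<le> 2 * 0 + 2 * 0" by (intro LIMSEQ_le_const) auto
  then have "l2_norm_sq X = 0" using l2_norm_sq_nonneg[OF X] by simp
  then have "taylor_coeff f i = taylor_coeff (tm_series y) i" for i
    using l2_norm_sq_eq_0D[OF X, of i] wpow_pos[of \<alpha> i] by (simp add: X_def wscale_def)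
  then have "f = tm_series y" by (intro dirichlet_eqI[OF f sy] ext)
  then have "tm_coeffs f = y" using tm_coeffs_tm_series[OF y] by simp
  then show ?thesis using hk by auto
qed

lemma blaschke_coeff_eq: "f \<in> dirichlet \<alpha> \<Longrightarrow> blaschke_coeff \<alpha> B f = block (tm_coeffs f)"
proof -
  assume f: "f \<in> dirichlet \<alpha>"
  show "blaschke_coeff \<alpha> B f = block (tm_coeffs f)"
    unfolding blaschke_coeff_def
  proof (rule the_equality)
    show "blaschke_expansion \<alpha> B f (block (tm_coeffs f))"
      using expansion_tm_series[OF tm_coeffs_W[OF f]] by (simp only: tm_series_tm_coeffs[OF f])
  qed (rule expansion_unique[OF f])
qed

section \<open>The norm \<open>norm2\<close> in Takenaka-Malmquist coordinates\<close>

definition \<omega> :: "nat \<Rightarrow> real" where "\<omega> n = weight2 \<alpha> N (n div m)"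

lemma \<omega>_pos: "0 < \<omega> n"
  using N by (simp add: \<omega>_def weight2_def)

lemma \<omega>_le_wpow: "\<omega> n \<le> real m powr (- \<alpha>) * wpow \<alpha> n"
proof -
  have "\<omega> n \<le> wpow \<alpha> (n div m)"
    unfolding \<omega>_def weight2_def wpow_def using \<alpha> by (auto intro!: powr_mono2')
  then show ?thesis using wpow_block(1)[OF refl, of n] by linarith
qed

lemma wpow_le_\<omega>: "wpow \<alpha> n \<le> real N powr (- \<alpha>) * \<omega> n"
proof -
  define k where "k = n div m"
  have p: "1 \<le> real N powr (- \<alpha>)" using N \<alpha> by (intro ge_one_powr_ge_zero) auto
  have "wpow \<alpha> k \<le> real N powr (- \<alpha>) * \<omega> n"
  proof (cases "k < N")
    case True
    have "wpow \<alpha> k \<le> 1 powr \<alpha>" unfolding wpow_def using \<alpha> by (intro powr_mono2') auto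
    also have "\<dots> = real N powr (- \<alpha>) * \<omega> n"
      using True N by (simp add: \<omega>_def weight2_def k_def[symmetric] powr_minus)
    finally show ?thesis .
  next
    case False
    then have "\<omega> n = wpow \<alpha> k" by (simp add: \<omega>_def weight2_def k_def wpow_def)
    then show ?thesis using p wpow_pos[of \<alpha> k] by simp
  qed
  then show ?thesis using wpow_block(2)[of n k] by (simp add: k_def)
qed

text \<open>The original weights and those of \<open>norm2\<close> are comparable, so the same
  sequences occur and boundedness results transfer.\<close>

lemma W_eq: "W = wltwo \<omega>"
  using wltwo_mono(1)[of _ "wpow \<alpha>" \<omega>, OF _ _ _ \<omega>_le_wpow] wltwo_mono(1)[of _ \<omega> "wpow \<alpha>", OF _ _ _ wpow_le_\<omega>]
    less_imp_le[OF wpow_pos] less_imp_le[OF \<omega>_pos] by blast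

text \<open>Carries the Dirichlet space with \<open>norm2\<close> isometrically onto
  \<open>ltwo\<close>; the Hilbert space arguments take place there.\<close>

definition norm2_coords :: "(complex \<Rightarrow> complex) \<Rightarrow> nat \<Rightarrow> complex" where
  "norm2_coords f = wscale \<omega> (tm_coeffs f)"

lemma norm2_coords_ltwo: "f \<in> dirichlet \<alpha> \<Longrightarrow> norm2_coords f \<in> ltwo"
  using tm_coeffs_W[of f] unfolding W_eq by (simp add: wltwo_def norm2_coords_def)

lemma norm2_coords_add:
  "f \<in> dirichlet \<alpha> \<Longrightarrow> g \<in> dirichlet \<alpha> \<Longrightarrow> norm2_coords (\<lambda>z. f z + p * g z) = (\<lambda>n. norm2_coords f n + p * norm2_coords g n)"
  by (simp add: norm2_coords_def tm_coeffs_add wscale_add wscale_cmult)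

lemma inner2_eq:
  assumes "f \<in> dirichlet \<alpha>" "g \<in> dirichlet \<alpha>"
  shows "inner2 \<alpha> B N f g = l2_inner (norm2_coords f) (norm2_coords g)"
proof -
  have "(\<lambda>k. \<Sum>j<m. norm2_coords f (k * m + j) * cnj (norm2_coords g (k * m + j))) sums l2_inner (norm2_coords f) (norm2_coords g)"
    using sums_group[OF summable_sums[OF ltwo_summable[OF norm2_coords_ltwo[OF assms(1)] norm2_coords_ltwo[OF assms(2)]]], of m] m
    by (simp add: sum_block l2_inner_def)
  moreover have "(\<Sum>j<m. norm2_coords f (k * m + j) * cnj (norm2_coords g (k * m + j))) =
     of_real (weight2 \<alpha> N k) * hardy_inner 1 (block (tm_coeffs f) k) (block (tm_coeffs g) k)" for k
  proof -
    have "norm2_coords f (k * m + j) * cnj (norm2_coords g (k * m + j)) = of_real (weight2 \<alpha> N k) * (tm_coeffs f (k * m + j) * cnj (tm_coeffs g (k * m + j)))"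
      if "j < m" for j
    proof -
      have "\<omega> (k * m + j) = weight2 \<alpha> N k" by (simp add: \<omega>_def div_mod_block[OF that])
      moreover have "norm2_coords f n * cnj (norm2_coords g n) = of_real (\<omega> n) * (tm_coeffs f n * cnj (tm_coeffs g n))" for n
      proof -
        have "norm2_coords f n * cnj (norm2_coords g n) = of_real (sqrt (\<omega> n) * sqrt (\<omega> n)) * (tm_coeffs f n * cnj (tm_coeffs g n))"
          unfolding of_real_mult by (simp only: norm2_coords_def wscale_def complex_cnj_mult complex_cnj_complex_of_real mult_ac)
        then show ?thesis using \<omega>_pos[of n] by simp
      qed
      ultimately show ?thesis by simp
    qed
    then show ?thesis by (simp add: hardy_inner_block sum_distrib_left)
  qed
  ultimately show ?thesis by (simp add: inner2_def blaschke_coeff_eq assms sums_iff)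
qed

lemma norm2_eq:
  assumes f: "f \<in> dirichlet \<alpha>"
  shows "norm2 \<alpha> B N f = sqrt (l2_norm_sq (norm2_coords f))"
proof -
  have "(\<lambda>k. \<Sum>j<m. (cmod (norm2_coords f (k * m + j)))\<^sup>2) sums l2_norm_sq (norm2_coords f)"
    unfolding l2_norm_sq_def using norm2_coords_ltwo[OF f] by (intro summable_blocks) (auto simp: ltwo_def)
  moreover have "(\<Sum>j<m. (cmod (norm2_coords f (k * m + j)))\<^sup>2) = weight2 \<alpha> N k * (hardy_norm 1 (block (tm_coeffs f) k))\<^sup>2" for k
  proof -
    have "\<omega> (k * m + j) = weight2 \<alpha> N k" if "j < m" for j by (simp add: \<omega>_def div_mod_block[OF that])
    then show ?thesis
      unfolding hardy_norm_block sum_distrib_left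
      by (intro sum.cong) (auto simp: norm2_coords_def norm_wscale[of \<omega>, OF less_imp_le[OF \<omega>_pos]])
  qed
  ultimately show ?thesis by (simp add: norm2_def blaschke_coeff_eq f sums_iff)
qed

text \<open>Since \<open>tm (n + m)\<close> is \<open>Psi m\<close> times \<open>tm n\<close>,
  multiplication acts as a shift. The series is multiplied term by term at each point, and the
  shifted sequence stays in \<open>W\<close> because the weights decrease.\<close>

lemma mult_B:
  assumes f: "f \<in> dirichlet \<alpha>"
  shows "mult_op B f \<in> dirichlet \<alpha>" "tm_coeffs (mult_op B f) = (\<lambda>n. if n < m then 0 else tm_coeffs f (n - m))"
proof -
  define y where "y n = (if n < m then 0 else tm_coeffs f (n - m))" for n
  have y: "y \<in> W"
  proof -
    have "summable (\<lambda>n. (cmod (wscale (wpow \<alpha>) y (n + m)))\<^sup>2)"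
    proof (rule summable_comparison_test'[of "\<lambda>n. (cmod (wscale (wpow \<alpha>) (tm_coeffs f) n))\<^sup>2" 0])
      show "summable (\<lambda>n. (cmod (wscale (wpow \<alpha>) (tm_coeffs f) n))\<^sup>2)" using tm_coeffs_W[OF f] by (simp add: wltwo_def ltwo_def)
      fix n
      have "wpow \<alpha> (n + m) \<le> wpow \<alpha> n" unfolding wpow_def using \<alpha> by (intro powr_mono2') auto
      then show "norm ((cmod (wscale (wpow \<alpha>) y (n + m)))\<^sup>2) \<le> (cmod (wscale (wpow \<alpha>) (tm_coeffs f) n))\<^sup>2"
        by (simp add: norm_wscale wpow_pos less_imp_le y_def mult_right_mono)
    qed
    then show ?thesis
      unfolding wltwo_def ltwo_def
      using summable_iff_shift[of "\<lambda>n. (cmod (wscale (wpow \<alpha>) y n))\<^sup>2" m] by simp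
  qed
  have sm: "tm_series y = mult_op B f"
  proof
    fix z
    show "tm_series y z = mult_op B f z"
    proof (cases "z \<in> ball 0 1")
      case True
      have "(\<lambda>i. tm_coeffs f i * tm i z) sums f z"
        using tm_series_sums[OF tm_coeffs_W[OF f] True] by (simp add: tm_series_tm_coeffs f)
      then have "(\<lambda>i. B z * (tm_coeffs f i * tm i z)) sums (B z * f z)" by (rule sums_mult)
      then have "(\<lambda>i. y (i + m) * tm (i + m) z) sums (B z * f z)"
        by (simp add: y_def tm_add B_eq[OF True] mult_ac)
      then have "(\<lambda>i. y i * tm i z) sums (B z * f z)"
        by (subst (asm) sums_iff_shift) (simp add: y_def)
      then show ?thesis using tm_series_sums[OF y True] by (simp add: mult_op_def sums_unique2)
    next
      case False
      then show ?thesis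
        using dirichlet_outside[OF f] dirichlet_outside[OF tm_series_dirichlet[OF y]] by (simp add: mult_op_def)
    qed
  qed
  show "mult_op B f \<in> dirichlet \<alpha>" using tm_series_dirichlet[OF y] unfolding sm .
  show "tm_coeffs (mult_op B f) = (\<lambda>n. if n < m then 0 else tm_coeffs f (n - m))"
    using tm_coeffs_tm_series[OF y] unfolding sm by (rule trans) (rule ext, rule y_def)
qed

text \<open>The backward shift preserves \<open>W\<close>: passing from \<open>n\<close> to
  \<open>n + m\<close> lowers the weight by a bounded factor.\<close>

lemma range_mult_B:
  assumes f: "f \<in> dirichlet \<alpha>" and z: "\<And>n. n < m \<Longrightarrow> tm_coeffs f n = 0"
  obtains g where "g \<in> dirichlet \<alpha>" "f = mult_op B g" "\<And>n. tm_coeffs g n = tm_coeffs f (n + m)"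
proof -
  define y where "y n = tm_coeffs f (n + m)" for n
  have y: "y \<in> W"
    unfolding wltwo_def ltwo_def
  proof (rule CollectI, rule CollectI, rule summable_comparison_test'[of "\<lambda>n. real (m + 1) powr (- \<alpha>) * (cmod (wscale (wpow \<alpha>) (tm_coeffs f) (n + m)))\<^sup>2" 0])
    show "summable (\<lambda>n. real (m + 1) powr (- \<alpha>) * (cmod (wscale (wpow \<alpha>) (tm_coeffs f) (n + m)))\<^sup>2)"
      using tm_coeffs_W[OF f] summable_iff_shift[of "\<lambda>n. (cmod (wscale (wpow \<alpha>) (tm_coeffs f) n))\<^sup>2" m]
      by (intro summable_mult) (simp add: wltwo_def ltwo_def)
    fix n
    have "wpow \<alpha> n \<le> real (m + 1) powr (- \<alpha>) * wpow \<alpha> (n + m)"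
      by (rule wpow_dilation[OF \<alpha>0]) (auto simp: algebra_simps)
    from mult_right_mono[OF this, of "(cmod (y n))\<^sup>2"]
    show "norm ((cmod (wscale (wpow \<alpha>) y n))\<^sup>2) \<le> real (m + 1) powr (- \<alpha>) * (cmod (wscale (wpow \<alpha>) (tm_coeffs f) (n + m)))\<^sup>2"
      by (simp add: norm_wscale wpow_pos less_imp_le y_def mult.assoc)
  qed
  have "tm_coeffs f = tm_coeffs (mult_op B (tm_series y))"
    unfolding mult_B(2)[OF tm_series_dirichlet[OF y]] tm_coeffs_tm_series[OF y] by (auto simp: y_def z)
  then have "f = mult_op B (tm_series y)" by (rule tm_coeffs_inj[OF f mult_B(1)[OF tm_series_dirichlet[OF y]]])
  then show ?thesis using that[of "tm_series y"] tm_series_dirichlet[OF y] tm_coeffs_tm_series[OF y] by (simp add: y_def)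
qed

definition \<gamma> :: real where "\<gamma> = (1 - 1 / (real N + 1)) powr (- \<alpha> / 2)"

lemma \<gamma>_pos: "0 < \<gamma>"
  using N by (simp add: \<gamma>_def)

text \<open>Adding \<open>m\<close> to the index moves to the next block, so consecutive values of
  \<open>weight2\<close> are compared.\<close>

lemma \<omega>_shift: "\<gamma>\<^sup>2 * \<omega> n \<le> \<omega> (n + m)"
proof -
  define k where "k = n div m"
  have k': "(n + m) div m = Suc k" using m by (simp add: k_def)
  define t where "t = 1 - 1 / (real N + 1)"
  have t: "0 < t" "t \<le> 1" "t = real N / (real N + 1)" using N by (auto simp: t_def field_simps)
  have g2: "\<gamma>\<^sup>2 = t powr (- \<alpha>)"
    unfolding \<gamma>_def t_def[symmetric] using t(1) by (simp add: power2_eq_square powr_add[symmetric])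
  have step: "t powr (- \<alpha>) * x powr \<alpha> \<le> x' powr \<alpha>" if "0 < x" "0 < x'" "t * x' \<le> x" for x x' :: real
  proof -
    have "0 < t * x'" using that t(1) by simp
    then have "x powr \<alpha> \<le> (t * x') powr \<alpha>" using that(3) \<alpha> by (intro powr_mono2') auto
    then have "t powr (- \<alpha>) * x powr \<alpha> \<le> t powr (- \<alpha>) * (t * x') powr \<alpha>" by (intro mult_left_mono) auto
    also have "\<dots> = x' powr \<alpha>" using t(1) that by (simp add: powr_mult powr_minus)
    finally show ?thesis .
  qed
  \<comment> \<open>The weights are constant up to block \<open>N - 1\<close>. The first drop, from
    block \<open>N - 1\<close> to block \<open>N\<close>, gives the ratio exactly; later ratios are
    closer to 1.\<close>
  consider "Suc k < N" | "Suc k = N" | "N \<le> k" by linarith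
  then have "t powr (- \<alpha>) * weight2 \<alpha> N k \<le> weight2 \<alpha> N (Suc k)"
  proof cases
    case 1
    have "t powr (- \<alpha>) * real N powr \<alpha> \<le> real N powr \<alpha>"
      using N t(1,2) by (intro step) (auto simp: mult_left_le_one_le)
    with 1 show ?thesis by (simp add: weight2_def)
  next
    case 2
    have "t powr (- \<alpha>) * real N powr \<alpha> \<le> (real N + 1) powr \<alpha>"
      using N by (intro step) (auto simp: t(3))
    with 2 show ?thesis by (auto simp: weight2_def)
  next
    case 3
    have "t * (real k + 2) \<le> real k + 1"
    proof -
      have "real N * (real k + 2) \<le> (real k + 1) * (real N + 1)" using 3 by (simp add: algebra_simps)
      then show ?thesis unfolding t(3) by (simp add: field_simps)
    qed
    then have "t powr (- \<alpha>) * (real k + 1) powr \<alpha> \<le> (real k + 2) powr \<alpha>" by (intro step) auto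
    with 3 show ?thesis by (simp add: weight2_def add.commute)
  qed
  then show ?thesis by (simp add: \<omega>_def k' k_def[symmetric] g2)
qed

lemma norm2_mult_B:
  assumes f: "f \<in> dirichlet \<alpha>"
  shows "\<gamma>\<^sup>2 * l2_norm_sq (norm2_coords f) \<le> l2_norm_sq (norm2_coords (mult_op B f))"
proof -
  note s = norm2_coords_ltwo[OF mult_B(1)[OF f]]
  have e: "(cmod (norm2_coords (mult_op B f) (n + m)))\<^sup>2 = \<omega> (n + m) * (cmod (tm_coeffs f n))\<^sup>2" for n
    by (simp add: norm2_coords_def norm_wscale less_imp_le[OF \<omega>_pos] mult_B(2)[OF f])
  have z: "norm2_coords (mult_op B f) n = 0" if "n < m" for n
    using that by (simp add: norm2_coords_def wscale_def mult_B(2)[OF f])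
  have "l2_norm_sq (norm2_coords (mult_op B f)) = (\<Sum>n. (cmod (norm2_coords (mult_op B f) (n + m)))\<^sup>2)"
    unfolding l2_norm_sq_def using s by (subst suminf_split_initial_segment[of _ m]) (auto simp: ltwo_def z)
  also have "\<dots> \<ge> (\<Sum>n. \<gamma>\<^sup>2 * (cmod (norm2_coords f n))\<^sup>2)"
  proof (rule suminf_le)
    fix n
    show "\<gamma>\<^sup>2 * (cmod (norm2_coords f n))\<^sup>2 \<le> (cmod (norm2_coords (mult_op B f) (n + m)))\<^sup>2"
      unfolding e using mult_right_mono[OF \<omega>_shift[of n], of "(cmod (tm_coeffs f n))\<^sup>2"]
      by (simp add: norm2_coords_def norm_wscale less_imp_le[OF \<omega>_pos] mult.assoc)
  qed (use s norm2_coords_ltwo[OF f] summable_iff_shift[of "\<lambda>n. (cmod (norm2_coords (mult_op B f) n))\<^sup>2" m]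
      in \<open>auto simp: ltwo_def intro!: summable_mult\<close>)
  finally show ?thesis using norm2_coords_ltwo[OF f] by (simp add: l2_norm_sq_def ltwo_def suminf_mult)
qed

text \<open>Evaluation is bounded for \<open>norm2\<close>; this controls the value of the remainder
  when the decomposition is iterated.\<close>

lemma norm2_pointwise_bound:
  assumes "z \<in> ball 0 1"
  obtains C where "0 \<le> C" "\<And>f. f \<in> dirichlet \<alpha> \<Longrightarrow> cmod (f z) \<le> C * sqrt (l2_norm_sq (norm2_coords f))"
proof -
  obtain C where C: "0 \<le> C" "\<And>y. y \<in> W \<Longrightarrow> cmod (tm_series y z) \<le> C * sqrt (l2_norm_sq (wscale (wpow \<alpha>) y))"
    by (rule tm_series_pointwise_bound[OF assms]) (rule that; blast)
  have "cmod (f z) \<le> C * sqrt (real N powr (- \<alpha>)) * sqrt (l2_norm_sq (norm2_coords f))" if f: "f \<in> dirichlet \<alpha>" for f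
  proof -
    have "l2_norm_sq (wscale (wpow \<alpha>) (tm_coeffs f)) \<le> real N powr (- \<alpha>) * l2_norm_sq (norm2_coords f)"
      unfolding norm2_coords_def using tm_coeffs_W[OF f] wpow_le_\<omega> less_imp_le[OF wpow_pos] less_imp_le[OF \<omega>_pos]
      by (intro wltwo_mono(2)) (auto simp: W_eq)
    then have "sqrt (l2_norm_sq (wscale (wpow \<alpha>) (tm_coeffs f))) \<le> sqrt (real N powr (- \<alpha>)) * sqrt (l2_norm_sq (norm2_coords f))"
      by (simp flip: real_sqrt_mult)
    then have "C * sqrt (l2_norm_sq (wscale (wpow \<alpha>) (tm_coeffs f))) \<le> C * (sqrt (real N powr (- \<alpha>)) * sqrt (l2_norm_sq (norm2_coords f)))"
      using C(1) by (rule mult_left_mono)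
    then show ?thesis using C(2)[OF tm_coeffs_W[OF f]] by (simp add: tm_series_tm_coeffs f mult.assoc)
  qed
  then show ?thesis using that[of "C * sqrt (real N powr (- \<alpha>))"] C(1) by auto
qed

end

subsection \<open>Nearly invariant subspaces\<close>

context blaschke_dirichlet
begin

lemma zero_dirichlet: "(\<lambda>z. 0) \<in> dirichlet \<alpha>" and tm_coeffs_zero: "tm_coeffs (\<lambda>z. 0) = (\<lambda>n. 0)"
  and norm2_coords_zero: "norm2_coords (\<lambda>z. 0) = (\<lambda>n. 0)"
proof -
  have t: "taylor_coeff (\<lambda>z. 0) = (\<lambda>n. 0)" by (rule ext) simp
  show "(\<lambda>z. 0) \<in> dirichlet \<alpha>"
    unfolding dirichlet_iff t by (auto simp: analytic_on_disc_def intro: wltwo_finite)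
  show "tm_coeffs (\<lambda>z. 0) = (\<lambda>n. 0)" unfolding tm_coeffs_def t by (rule ext) (simp add: coords_def)
  then show "norm2_coords (\<lambda>z. 0) = (\<lambda>n. 0)" by (simp add: norm2_coords_def wscale_def)
qed

lemma dirichlet_sum:
  assumes "finite I" "\<And>i. i \<in> I \<Longrightarrow> f i \<in> dirichlet \<alpha>"
  shows "(\<lambda>z. \<Sum>i\<in>I. p i * f i z) \<in> dirichlet \<alpha>"
    "norm2_coords (\<lambda>z. \<Sum>i\<in>I. p i * f i z) = (\<lambda>n. \<Sum>i\<in>I. p i * norm2_coords (f i) n)"
proof -
  have "(\<lambda>z. \<Sum>i\<in>I. p i * f i z) \<in> dirichlet \<alpha> \<and>
      norm2_coords (\<lambda>z. \<Sum>i\<in>I. p i * f i z) = (\<lambda>n. \<Sum>i\<in>I. p i * norm2_coords (f i) n)"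
    using assms
  proof (induction I rule: finite_induct)
    case empty
    then show ?case by (simp add: zero_dirichlet norm2_coords_zero)
  next
    case (insert i F)
    then have IH: "(\<lambda>z. \<Sum>i\<in>F. p i * f i z) \<in> dirichlet \<alpha>"
      "norm2_coords (\<lambda>z. \<Sum>i\<in>F. p i * f i z) = (\<lambda>n. \<Sum>i\<in>F. p i * norm2_coords (f i) n)" by auto
    have fi: "f i \<in> dirichlet \<alpha>" using insert by auto
    have e: "(\<lambda>z. \<Sum>i\<in>insert i F. p i * f i z) = (\<lambda>z. (\<Sum>i\<in>F. p i * f i z) + p i * f i z)"
      using insert by (auto simp: add.commute)
    show ?case
      unfolding e using insert(1,2) norm2_coords_add[OF IH(1) fi] dirichlet_add(1)[OF IH(1) fi]
      by (auto simp: IH(2) add.commute)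
  qed
  then show "(\<lambda>z. \<Sum>i\<in>I. p i * f i z) \<in> dirichlet \<alpha>"
    "norm2_coords (\<lambda>z. \<Sum>i\<in>I. p i * f i z) = (\<lambda>n. \<Sum>i\<in>I. p i * norm2_coords (f i) n)" by auto
qed

lemma mult_B_inj:
  assumes "f \<in> dirichlet \<alpha>" "g \<in> dirichlet \<alpha>" "mult_op B f = mult_op B g"
  shows "f = g"
proof (rule tm_coeffs_inj[OF assms(1,2)], rule ext)
  fix n
  have "tm_coeffs (mult_op B f) (n + m) = tm_coeffs (mult_op B g) (n + m)" using assms(3) by simp
  then show "tm_coeffs f n = tm_coeffs g n" by (simp add: mult_B(2) assms(1,2))
qed

text \<open>In this form the range is visibly closed, being cut out by finitely many
  coordinates.\<close>

lemma range_mult_B_iff: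
  assumes "f \<in> dirichlet \<alpha>"
  shows "f \<in> mult_op B ` dirichlet \<alpha> \<longleftrightarrow> (\<forall>n<m. norm2_coords f n = 0)"
proof -
  have e: "norm2_coords f n = 0 \<longleftrightarrow> tm_coeffs f n = 0" for n
    using \<omega>_pos[of n] by (simp add: norm2_coords_def wscale_def)
  show ?thesis
  proof
    assume "f \<in> mult_op B ` dirichlet \<alpha>"
    then show "\<forall>n<m. norm2_coords f n = 0" by (auto simp: e mult_B(2))
  next
    assume "\<forall>n<m. norm2_coords f n = 0"
    then obtain h where "h \<in> dirichlet \<alpha>" "f = mult_op B h" "\<And>n. tm_coeffs h n = tm_coeffs f (n + m)"
      using range_mult_B[OF assms] e by blast
    then show "f \<in> mult_op B ` dirichlet \<alpha>" by blast
  qed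
qed

text \<open>Lets limits found in \<open>ltwo\<close> be realized by functions, as the projection
  argument needs.\<close>

lemma norm2_coords_surj:
  assumes "x \<in> ltwo" obtains f where "f \<in> dirichlet \<alpha>" "norm2_coords f = x"
proof -
  define y where "y n = x n / of_real (sqrt (\<omega> n))" for n
  have e: "wscale \<omega> y = x"
    by (rule ext) (use \<omega>_pos in \<open>simp add: wscale_def y_def less_imp_neq[symmetric]\<close>)
  have "y \<in> wltwo \<omega>" using assms by (simp add: wltwo_def e)
  then have "y \<in> W" unfolding W_eq .
  then show ?thesis using that[of "tm_series y"] tm_series_dirichlet tm_coeffs_tm_series e by (simp add: norm2_coords_def)
qed

end

locale nearly_invariant_subspace = blaschke_dirichlet +
  fixes M :: "(complex \<Rightarrow> complex) set" and g :: "'l::finite \<Rightarrow> complex \<Rightarrow> complex"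
  assumes closed: "closed_subspace (norm2 \<alpha> B N) (dirichlet \<alpha>) M"
    and nearly: "nearly_inverse_invariant \<alpha> B M"
    and basis: "orthonormal_basis (inner2 \<alpha> B N)
           (ominus (inner2 \<alpha> B N) M (M \<inter> mult_op B ` dirichlet \<alpha>)) g"
begin

lemma M_dirichlet: "f \<in> M \<Longrightarrow> f \<in> dirichlet \<alpha>"
  and M_zero: "(\<lambda>z. 0) \<in> M"
  and M_cmult: "f \<in> M \<Longrightarrow> (\<lambda>z. p * f z) \<in> M"
  using closed by (auto simp: closed_subspace_def linear_submanifold_def)

lemma M_add: "f \<in> M \<Longrightarrow> h \<in> M \<Longrightarrow> (\<lambda>z. f z + p * h z) \<in> M"
proof -
  assume "f \<in> M" "h \<in> M"
  have "\<forall>f\<in>M. \<forall>g\<in>M. (\<lambda>z. f z + g z) \<in> M"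
    using closed by (simp add: closed_subspace_def linear_submanifold_def)
  from this[rule_format, OF \<open>f \<in> M\<close> M_cmult[OF \<open>h \<in> M\<close>, of p]]
  show "(\<lambda>z. f z + p * h z) \<in> M" .
qed

lemma M_closed:
  assumes "\<And>n. F n \<in> M" "f \<in> dirichlet \<alpha>" "(\<lambda>n. l2_norm_sq (\<lambda>i. norm2_coords (F n) i - norm2_coords f i)) \<longlonglongrightarrow> 0"
  shows "f \<in> M"
proof -
  have "norm2 \<alpha> B N (\<lambda>z. F n z - f z) = sqrt (l2_norm_sq (\<lambda>i. norm2_coords (F n) i - norm2_coords f i))" for n
    using norm2_eq[OF dirichlet_add(1)[OF M_dirichlet[OF assms(1)] assms(2), of n "-1"]]
      norm2_coords_add[OF M_dirichlet[OF assms(1)] assms(2), of n "-1"] by simp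
  moreover have "(\<lambda>n. sqrt (l2_norm_sq (\<lambda>i. norm2_coords (F n) i - norm2_coords f i))) \<longlonglongrightarrow> sqrt 0"
    by (intro tendsto_intros assms)
  ultimately have lim: "(\<lambda>n. norm2 \<alpha> B N (\<lambda>z. F n z - f z)) \<longlonglongrightarrow> 0" by simp
  have "\<forall>F f. (\<forall>n::nat. F n \<in> M) \<longrightarrow> f \<in> dirichlet \<alpha> \<longrightarrow>
      (\<lambda>n. norm2 \<alpha> B N (\<lambda>z. F n z - f z)) \<longlonglongrightarrow> 0 \<longrightarrow> f \<in> M"
    using closed by (simp add: closed_subspace_def)
  from this[rule_format, of F f, OF assms(1,2) lim] show ?thesis .
qed

lemma basis_mem: "g i \<in> M" "g i \<in> dirichlet \<alpha>"
  and basis_orthonormal: "l2_inner (norm2_coords (g i)) (norm2_coords (g j)) = (if i = j then 1 else 0)"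
proof -
  have gi: "g i \<in> M" for i using basis by (simp add: orthonormal_basis_def ominus_def)
  then show "g i \<in> M" "g i \<in> dirichlet \<alpha>" by (auto intro: M_dirichlet)
  have "inner2 \<alpha> B N (g i) (g j) = (if i = j then 1 else 0)"
    using basis by (simp add: orthonormal_basis_def)
  then show "l2_inner (norm2_coords (g i)) (norm2_coords (g j)) = (if i = j then 1 else 0)"
    using inner2_eq[OF gi[THEN M_dirichlet] gi[THEN M_dirichlet]] by simp
qed

lemma basis_orthogonal:
  assumes "w \<in> M" "w \<in> mult_op B ` dirichlet \<alpha>" shows "l2_inner (norm2_coords w) (norm2_coords (g i)) = 0"
proof -
  have "inner2 \<alpha> B N (g i) w = 0"
    using basis assms by (simp add: orthonormal_basis_def ominus_def)
  then have "l2_inner (norm2_coords (g i)) (norm2_coords w) = 0"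
    using inner2_eq[OF basis_mem(2) M_dirichlet[OF assms(1)]] by simp
  then show ?thesis
    using l2_inner_cnj[OF norm2_coords_ltwo[OF basis_mem(2)] norm2_coords_ltwo[OF M_dirichlet[OF assms(1)]], of i] by simp
qed

definition lead_coord :: "(complex \<Rightarrow> complex) \<Rightarrow> 'l \<Rightarrow> complex" where
  "lead_coord h i = l2_inner (norm2_coords h) (norm2_coords (g i))"

definition lead :: "(complex \<Rightarrow> complex) \<Rightarrow> complex \<Rightarrow> complex" where
  "lead h z = (\<Sum>i\<in>UNIV. lead_coord h i * g i z)"

lemma lead_mem: "lead h \<in> M"
proof -
  have "(\<lambda>z. \<Sum>i\<in>I. p i * g i z) \<in> M" for I :: "'l set" and p
  proof (induction I rule: infinite_finite_induct)
    case (insert i F)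
    then have "(\<lambda>z. (\<Sum>i\<in>F. p i * g i z) + p i * g i z) \<in> M" by (intro M_add basis_mem) auto
    with insert(1,2) show ?case by (simp add: add.commute)
  qed (auto simp: M_zero)
  then show ?thesis unfolding lead_def[abs_def] .
qed

text \<open>Projecting \<open>h\<close> onto the part of \<open>M\<close> in the range of T_B leaves
  an element of the orthogonal complement, a combination of the \<open>g i\<close>. The projection
  is B f, and near invariance puts \<open>f\<close> into \<open>M\<close>.\<close>

lemma decomposition_aux:
  assumes h: "h \<in> M"
  obtains f where "f \<in> M" "h = (\<lambda>z. lead h z + B z * f z)"
    "l2_norm_sq (norm2_coords h) = (\<Sum>i\<in>UNIV. (cmod (lead_coord h i))\<^sup>2) + l2_norm_sq (norm2_coords (mult_op B f))"
proof -
  define R where "R = M \<inter> mult_op B ` dirichlet \<alpha>"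
  have R: "f \<in> R \<longleftrightarrow> f \<in> M \<and> (\<forall>n<m. norm2_coords f n = 0)" for f
    unfolding R_def using range_mult_B_iff[OF M_dirichlet, of f] by blast
  obtain x where x: "x \<in> norm2_coords ` R" "\<And>w. w \<in> norm2_coords ` R \<Longrightarrow> l2_inner (\<lambda>n. norm2_coords h n - x n) w = 0"
  proof (rule ltwo_projection[of "norm2_coords ` R" "norm2_coords h"])
    show "norm2_coords ` R \<subseteq> ltwo" using norm2_coords_ltwo M_dirichlet by (auto simp: R)
    show "(\<lambda>n. 0) \<in> norm2_coords ` R" by (rule image_eqI[where x = "\<lambda>z. 0"]) (simp_all add: R M_zero norm2_coords_zero)
    show "(\<lambda>n. x n + y n) \<in> norm2_coords ` R" if xy: "x \<in> norm2_coords ` R" "y \<in> norm2_coords ` R" for x y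
    proof -
      obtain f k where fk: "f \<in> R" "x = norm2_coords f" "k \<in> R" "y = norm2_coords k" using xy by blast
      have e: "norm2_coords (\<lambda>z. f z + 1 * k z) = (\<lambda>n. x n + 1 * y n)"
        unfolding fk using fk by (intro norm2_coords_add M_dirichlet) (auto simp: R)
      have "(\<lambda>z. f z + 1 * k z) \<in> M" using fk by (intro M_add) (auto simp: R)
      then have "(\<lambda>z. f z + 1 * k z) \<in> R" unfolding R e using fk by (auto simp: R)
      from imageI[OF this, of norm2_coords] show ?thesis unfolding e by simp
    qed
    show "(\<lambda>n. p * x n) \<in> norm2_coords ` R" if xy: "x \<in> norm2_coords ` R" for x p
    proof -
      obtain f where fk: "f \<in> R" "x = norm2_coords f" using xy by blast
      have e: "norm2_coords (\<lambda>z. 0 + p * f z) = (\<lambda>n. 0 + p * x n)"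
        unfolding fk norm2_coords_zero[symmetric] using fk by (subst norm2_coords_add) (auto simp: R zero_dirichlet M_dirichlet norm2_coords_zero)
      have "(\<lambda>z. 0 + p * f z) \<in> M" using fk by (intro M_add M_zero) (auto simp: R)
      then have "(\<lambda>z. 0 + p * f z) \<in> R" unfolding R e using fk by (auto simp: R)
      from imageI[OF this, of norm2_coords] show ?thesis unfolding e by simp
    qed
    \<comment> \<open>Closedness: the limit comes from some \<open>f\<close>, which is in
      \<open>M\<close> because \<open>M\<close> is closed and in the range because vanishing of the
      first \<open>m\<close> coordinates survives the limit.\<close>
    show "x \<in> norm2_coords ` R" if F: "\<And>n. F n \<in> norm2_coords ` R" and xl: "x \<in> ltwo"
      and lim: "(\<lambda>n. l2_norm_sq (\<lambda>i. F n i - x i)) \<longlonglongrightarrow> 0" for F :: "nat \<Rightarrow> nat \<Rightarrow> complex" and x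
    proof -
      obtain f where f: "f \<in> dirichlet \<alpha>" "norm2_coords f = x" using norm2_coords_surj[OF xl] by blast
      have "\<forall>n. \<exists>k. k \<in> R \<and> F n = norm2_coords k" using F by blast
      then obtain G where G: "\<And>n. G n \<in> R" "\<And>n. F n = norm2_coords (G n)" by metis
      have "f \<in> M" by (rule M_closed[of G]) (use G f lim in \<open>auto simp: R\<close>)
      moreover have "norm2_coords f n = 0" if "n < m" for n
      proof -
        have Fn: "F k n = 0" for k using G that by (simp add: R)
        have "(cmod (x n))\<^sup>2 \<le> 0"
        proof (rule LIMSEQ_le_const[OF lim], intro exI allI impI)
          fix k
          have "(\<lambda>i. F k i - x i) \<in> ltwo"
            using G(1)[of k] xl by (auto simp: G(2) R intro!: ltwo_diff norm2_coords_ltwo M_dirichlet)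
          from l2_norm_sq_component[OF this, of n] show "(cmod (x n))\<^sup>2 \<le> l2_norm_sq (\<lambda>i. F k i - x i)" by (simp add: Fn)
        qed
        then show ?thesis by (simp add: f)
      qed
      ultimately have "f \<in> R" by (simp add: R)
      then show ?thesis using f by blast
    qed
    show "norm2_coords h \<in> ltwo" by (rule norm2_coords_ltwo[OF M_dirichlet[OF h]])
  qed blast
  then obtain v where v: "v \<in> R" "x = norm2_coords v" by blast
  have vM: "v \<in> M" "v \<in> mult_op B ` dirichlet \<alpha>" using v by (auto simp: R_def)
  define w where "w z = h z - v z" for z
  have w_eq: "w = (\<lambda>z. h z + (-1) * v z)" by (auto simp: w_def)
  have wM: "w \<in> M" unfolding w_eq by (rule M_add[OF h vM(1)])
  have ww: "norm2_coords w = (\<lambda>n. norm2_coords h n - norm2_coords v n)"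
    unfolding w_eq using norm2_coords_add[OF M_dirichlet[OF h] M_dirichlet[OF vM(1)], of "-1"] by simp
  have "inner2 \<alpha> B N w r = 0" if "r \<in> M \<inter> mult_op B ` dirichlet \<alpha>" for r
  proof -
    have "inner2 \<alpha> B N w r = l2_inner (norm2_coords w) (norm2_coords r)" using that by (intro inner2_eq M_dirichlet wM) auto
    also have "\<dots> = 0" unfolding ww using x(2)[of "norm2_coords r"] v that by (auto simp: R_def)
    finally show ?thesis .
  qed
  then have "w \<in> ominus (inner2 \<alpha> B N) M (M \<inter> mult_op B ` dirichlet \<alpha>)"
    using wM by (auto simp: ominus_def)
  then obtain p where p: "w = (\<lambda>z. \<Sum>i\<in>UNIV. p i * g i z)"
    using basis by (auto simp: orthonormal_basis_def)
  have wcw: "norm2_coords w = (\<lambda>n. \<Sum>i\<in>UNIV. p i * norm2_coords (g i) n)"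
    unfolding p by (rule dirichlet_sum(2)) (auto simp: basis_mem)
  have hw: "norm2_coords h n = (\<Sum>i\<in>UNIV. p i * norm2_coords (g i) n) + norm2_coords v n" for n
    using fun_cong[OF ww, of n] fun_cong[OF wcw, of n] by simp
  note pyth = l2_norm_sq_Pythagoras[OF finite_class.finite_UNIV norm2_coords_ltwo[OF M_dirichlet[OF h]] _ _ norm2_coords_ltwo[OF M_dirichlet[OF vM(1)]] _ hw]
  have dp: "lead_coord h i = p i" for i
    unfolding lead_coord_def by (rule pyth(2)) (auto simp: basis_mem norm2_coords_ltwo basis_orthonormal basis_orthogonal vM)
  have e: "l2_norm_sq (norm2_coords h) = (\<Sum>i\<in>UNIV. (cmod (p i))\<^sup>2) + l2_norm_sq (norm2_coords v)"
    by (rule pyth(1)) (auto simp: basis_mem norm2_coords_ltwo basis_orthonormal basis_orthogonal vM)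
  obtain f where f: "f \<in> dirichlet \<alpha>" "v = mult_op B f" using vM by blast
  have "f \<in> M" using nearly f vM(1) by (simp add: nearly_inverse_invariant_def)
  moreover have "h = (\<lambda>z. lead h z + B z * f z)"
  proof
    fix z
    have "h z = w z + v z" by (simp add: w_def)
    then show "h z = lead h z + B z * f z" by (simp add: lead_def dp p f(2) mult_op_def)
  qed
  ultimately show ?thesis using that e by (simp add: dp f(2))
qed

text \<open>The choice is forced, by \<open>rest_unique\<close>.\<close>

definition rest :: "(complex \<Rightarrow> complex) \<Rightarrow> complex \<Rightarrow> complex" where
  "rest h = (SOME f. f \<in> M \<and> h = (\<lambda>z. lead h z + B z * f z))"

lemma rest: assumes "h \<in> M" shows "rest h \<in> M" "h z = lead h z + B z * rest h z"
proof -
  have "\<exists>f. f \<in> M \<and> h = (\<lambda>z. lead h z + B z * f z)"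
    by (rule decomposition_aux[OF assms]) blast
  then have "rest h \<in> M \<and> h = (\<lambda>z. lead h z + B z * rest h z)"
    unfolding rest_def by (rule someI_ex)
  then show "rest h \<in> M" "h z = lead h z + B z * rest h z" by (auto dest: fun_cong)
qed

text \<open>Multiplication by \<open>B\<close> is injective. All linearity of \<open>rest\<close>,
  of its iterates and of the row functions rests on this.\<close>

lemma rest_unique:
  assumes "h \<in> M" "f \<in> M" "\<And>z. h z = lead h z + B z * f z"
  shows "rest h = f"
proof (rule mult_B_inj)
  show "mult_op B (rest h) = mult_op B f"
  proof
    fix z
    show "mult_op B (rest h) z = mult_op B f z"
      using trans[OF rest(2)[OF assms(1), of z, symmetric] assms(3)[of z]]
      by (simp only: add_left_cancel mult_op_def)
  qed
qed (use rest assms M_dirichlet in auto)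

text \<open>Orthogonality of the two parts combined with the lower bound of T_B; the inequality that
  is iterated.\<close>

lemma rest_energy:
  assumes "h \<in> M"
  shows "(\<Sum>i\<in>UNIV. (cmod (lead_coord h i))\<^sup>2) + \<gamma>\<^sup>2 * l2_norm_sq (norm2_coords (rest h)) \<le> l2_norm_sq (norm2_coords h)"
proof -
  obtain f where f: "f \<in> M" "h = (\<lambda>z. lead h z + B z * f z)"
    "l2_norm_sq (norm2_coords h) = (\<Sum>i\<in>UNIV. (cmod (lead_coord h i))\<^sup>2) + l2_norm_sq (norm2_coords (mult_op B f))"
    by (rule decomposition_aux[OF assms])
  have "rest h = f" by (rule rest_unique[OF assms f(1)]) (rule fun_cong[OF f(2)])
  then show ?thesis using f(3) norm2_mult_B[OF M_dirichlet[OF f(1)]] by simp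
qed

lemma lead_coord_add:
  "f \<in> M \<Longrightarrow> h \<in> M \<Longrightarrow> lead_coord (\<lambda>z. f z + p * h z) i = lead_coord f i + p * lead_coord h i"
  unfolding lead_coord_def
  by (simp add: norm2_coords_add M_dirichlet l2_inner_add_left l2_inner_cmult_left ltwo_cmult norm2_coords_ltwo basis_mem)

lemma lead_add:
  "f \<in> M \<Longrightarrow> h \<in> M \<Longrightarrow> lead (\<lambda>z. f z + p * h z) z = lead f z + p * lead h z"
  unfolding lead_def by (simp add: lead_coord_add sum.distrib sum_distrib_left algebra_simps)

lemma rest_add:
  assumes "f \<in> M" "h \<in> M" shows "rest (\<lambda>z. f z + p * h z) = (\<lambda>z. rest f z + p * rest h z)"
proof (rule rest_unique)
  show "(\<lambda>z. f z + p * h z) \<in> M" "(\<lambda>z. rest f z + p * rest h z) \<in> M"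
    using assms rest(1) by (auto intro!: M_add)
  show "f z + p * h z = lead (\<lambda>z. f z + p * h z) z + B z * (rest f z + p * rest h z)" for z
    using rest(2)[OF assms(1), of z] rest(2)[OF assms(2), of z] lead_add[OF assms, of p z]
    by (simp add: algebra_simps)
qed

lemma lead_coord_lead: "lead_coord (lead h) i = lead_coord h i"
proof -
  have "norm2_coords (lead h) = (\<lambda>n. \<Sum>i\<in>UNIV. lead_coord h i * norm2_coords (g i) n)"
    unfolding lead_def[abs_def] by (rule dirichlet_sum(2)) (auto simp: basis_mem)
  then show ?thesis
    unfolding lead_coord_def[of "lead h"]
    by (simp add: l2_inner_sum_left norm2_coords_ltwo basis_mem basis_orthonormal if_distrib cong: if_cong)
qed

text \<open>Combinations of the \<open>g i\<close> decompose trivially, so constant rows represent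
  them.\<close>

lemma rest_lead: "rest (lead h) = (\<lambda>z. 0)"
  by (rule rest_unique[OF lead_mem M_zero]) (simp add: lead_def[of "lead h"] lead_coord_lead lead_def[symmetric])

section \<open>Iterating the decomposition\<close>

definition iter :: "nat \<Rightarrow> (complex \<Rightarrow> complex) \<Rightarrow> complex \<Rightarrow> complex" where
  "iter k h = (rest ^^ k) h"

lemma iter_simps: "iter 0 h = h" "iter (Suc k) h = rest (iter k h)" "iter (Suc k) h = iter k (rest h)"
  by (simp_all add: iter_def funpow_swap1)

lemma iter_mem: "h \<in> M \<Longrightarrow> iter k h \<in> M"
  by (induction k) (auto simp: iter_simps(1,2) rest)

lemma iter_add: "f \<in> M \<Longrightarrow> h \<in> M \<Longrightarrow> iter k (\<lambda>z. f z + p * h z) = (\<lambda>z. iter k f z + p * iter k h z)"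
  by (induction k) (auto simp: iter_simps(1,2) rest_add iter_mem)

lemma iter_expansion:
  assumes "h \<in> M"
  shows "h z = (\<Sum>k<n. B z ^ k * lead (iter k h) z) + B z ^ n * iter n h z"
proof (induction n)
  case (Suc n)
  have "B z ^ n * iter n h z = B z ^ n * lead (iter n h) z + B z ^ Suc n * iter (Suc n) h z"
    using rest(2)[OF iter_mem[OF assms, of n], of z] by (simp add: iter_simps algebra_simps)
  with Suc show ?case by simp
qed (simp add: iter_simps)

definition lead_row :: "(complex \<Rightarrow> complex) \<Rightarrow> complex ^ 'l" where
  "lead_row h = (\<chi> i. lead_coord h i)"

lemma norm_lead_row: "(norm (lead_row h))\<^sup>2 = (\<Sum>i\<in>UNIV. (cmod (lead_coord h i))\<^sup>2)"
  by (simp add: lead_row_def norm_vec_def L2_set_def sum_nonneg)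

text \<open>\<open>rest_energy\<close> at the \<open>n\<close>-th iterate, multiplied by the square
  of \<open>\<gamma> ^ n\<close>, telescopes.\<close>

lemma iter_energy:
  assumes "h \<in> M"
  shows "(\<Sum>k<n. (\<gamma> ^ k * norm (lead_row (iter k h)))\<^sup>2) + (\<gamma> ^ n)\<^sup>2 * l2_norm_sq (norm2_coords (iter n h)) \<le> l2_norm_sq (norm2_coords h)"
proof (induction n)
  case (Suc n)
  have "(\<gamma> ^ n)\<^sup>2 * ((norm (lead_row (iter n h)))\<^sup>2 + \<gamma>\<^sup>2 * l2_norm_sq (norm2_coords (rest (iter n h)))) \<le> (\<gamma> ^ n)\<^sup>2 * l2_norm_sq (norm2_coords (iter n h))"
    unfolding norm_lead_row by (intro mult_left_mono rest_energy iter_mem assms) auto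
  with Suc show ?case by (simp add: iter_simps(2) power_mult_distrib algebra_simps)
qed (simp add: iter_simps)

end

subsection \<open>Boundary functions and Toeplitz operators\<close>

text \<open>Arc length in the angle, of total mass \<open>2 * pi\<close>; the normalization stays
  outside the integrals.\<close>

definition circ :: "real measure" where "circ = lebesgue_on {0..2*pi}"

definition vec_inner :: "complex ^ 'l \<Rightarrow> complex ^ 'l \<Rightarrow> complex" where
  "vec_inner x y = (\<Sum>i\<in>UNIV. x $ i * cnj (y $ i))"

abbreviation csq :: "(real \<Rightarrow> complex ^ 'l) \<Rightarrow> real" where
  "csq F \<equiv> LINT \<theta>|circ. (norm (F \<theta>))\<^sup>2"

abbreviation cint :: "(real \<Rightarrow> complex ^ 'l) \<Rightarrow> (real \<Rightarrow> complex ^ 'l) \<Rightarrow> complex" where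
  "cint F G \<equiv> LINT \<theta>|circ. vec_inner (F \<theta>) (G \<theta>)"

definition L2circ :: "(real \<Rightarrow> complex ^ 'l) \<Rightarrow> bool" where
  "L2circ F \<longleftrightarrow> F \<in> borel_measurable circ \<and> integrable circ (\<lambda>\<theta>. (norm (F \<theta>))\<^sup>2)"

lemma vec_inner_continuous: "continuous_on UNIV (\<lambda>p. vec_inner (fst p) (snd p))"
  unfolding vec_inner_def by (intro continuous_intros)

lemma norm_vec_inner_le: "cmod (vec_inner x y) \<le> norm x * norm y"
proof -
  have "cmod (vec_inner x y) \<le> (\<Sum>i\<in>UNIV. \<bar>cmod (x $ i)\<bar> * \<bar>cmod (y $ i)\<bar>)"
    unfolding vec_inner_def by (rule order_trans[OF norm_sum]) (simp add: norm_mult)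
  also have "\<dots> \<le> L2_set (\<lambda>i. cmod (x $ i)) UNIV * L2_set (\<lambda>i. cmod (y $ i)) UNIV"
    by (rule L2_set_mult_ineq)
  finally show ?thesis by (simp add: norm_vec_def)
qed

text \<open>Young's inequality with a parameter. Pointwise it supplies an integrable majorant, and
  after integration it replaces the Cauchy-Schwarz inequality on the circle.\<close>

lemma norm_vec_inner_le':
  assumes "0 < t" shows "cmod (vec_inner x y) \<le> t * (norm x)\<^sup>2 + (norm y)\<^sup>2 / t"
proof -
  have "0 \<le> (norm x * sqrt t - norm y / sqrt t)\<^sup>2" by simp
  then have "2 * (norm x * norm y) \<le> t * (norm x)\<^sup>2 + (norm y)\<^sup>2 / t"
    using assms by (simp add: power2_diff power_mult_distrib power_divide mult_ac)
  moreover have "0 \<le> norm x * norm y" by simp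
  ultimately show ?thesis using norm_vec_inner_le[of x y] by linarith
qed

lemma vec_inner_measurable:
  assumes "F \<in> borel_measurable circ" "G \<in> borel_measurable circ"
  shows "(\<lambda>\<theta>. vec_inner (F \<theta>) (G \<theta>)) \<in> borel_measurable circ"
proof -
  have "(\<lambda>\<theta>. (F \<theta>, G \<theta>)) \<in> borel_measurable circ" using assms by measurable
  from measurable_compose[OF this borel_measurable_continuous_onI[OF vec_inner_continuous]]
  show ?thesis by simp
qed

lemma L2circ_vec_inner:
  assumes "L2circ F" "L2circ G"
  shows "integrable circ (\<lambda>\<theta>. vec_inner (F \<theta>) (G \<theta>))"
    "0 < t \<Longrightarrow> cmod (cint F G) \<le>
      t * csq F + csq G / t"
proof -
  have i: "integrable circ (\<lambda>\<theta>. t * (norm (F \<theta>))\<^sup>2 + (norm (G \<theta>))\<^sup>2 / t)" for t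
    using assms unfolding L2circ_def
    by (intro Bochner_Integration.integrable_add integrable_mult_right integrable_divide) auto
  show c: "integrable circ (\<lambda>\<theta>. vec_inner (F \<theta>) (G \<theta>))"
  proof (rule Bochner_Integration.integrable_bound[OF i[of 1]])
    show "(\<lambda>\<theta>. vec_inner (F \<theta>) (G \<theta>)) \<in> borel_measurable circ"
      using assms by (intro vec_inner_measurable) (auto simp: L2circ_def)
  qed (use norm_vec_inner_le'[of 1] in auto)
  assume t: "0 < t"
  have "cmod (cint F G) \<le> (LINT \<theta>|circ. cmod (vec_inner (F \<theta>) (G \<theta>)))" by simp
  also have "\<dots> \<le> (LINT \<theta>|circ. t * (norm (F \<theta>))\<^sup>2 + (norm (G \<theta>))\<^sup>2 / t)"
    by (intro integral_mono integrable_norm c i norm_vec_inner_le' t)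
  also have "\<dots> = t * csq F + csq G / t"
    using assms unfolding L2circ_def by (subst Bochner_Integration.integral_add) auto
  finally show "cmod (cint F G) \<le>
      t * csq F + csq G / t" .
qed

lemma norm_diff_sq_le: "(norm (x - y))\<^sup>2 \<le> 2 * (norm x)\<^sup>2 + 2 * (norm (y :: 'a :: real_normed_vector))\<^sup>2"
proof -
  have "(norm (x - y))\<^sup>2 \<le> (norm x + norm y)\<^sup>2" by (intro power_mono norm_triangle_ineq4) auto
  also have "\<dots> \<le> 2 * (norm x)\<^sup>2 + 2 * (norm y)\<^sup>2"
    using sum_squares_bound[of "norm x" "norm y"] by (simp add: power2_sum)
  finally show ?thesis .
qed

lemma L2circ_diff:
  assumes "L2circ F" "L2circ G"
  shows "L2circ (\<lambda>\<theta>. F \<theta> - G \<theta>)"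
    "(LINT \<theta>|circ. (norm (F \<theta> - G \<theta>))\<^sup>2) \<le> 2 * csq F + 2 * csq G"
proof -
  have i: "integrable circ (\<lambda>\<theta>. 2 * (norm (F \<theta>))\<^sup>2 + 2 * (norm (G \<theta>))\<^sup>2)"
    using assms unfolding L2circ_def by auto
  have meas: "(\<lambda>\<theta>. F \<theta> - G \<theta>) \<in> borel_measurable circ"
    using assms unfolding L2circ_def by (intro borel_measurable_diff) auto
  have n: "integrable circ (\<lambda>\<theta>. (norm (F \<theta> - G \<theta>))\<^sup>2)"
    by (rule Bochner_Integration.integrable_bound[OF i])
      (use meas norm_diff_sq_le[of "F _" "G _"] in auto)
  with meas show "L2circ (\<lambda>\<theta>. F \<theta> - G \<theta>)" by (simp add: L2circ_def)
  have "(LINT \<theta>|circ. (norm (F \<theta> - G \<theta>))\<^sup>2) \<le> (LINT \<theta>|circ. 2 * (norm (F \<theta>))\<^sup>2 + 2 * (norm (G \<theta>))\<^sup>2)"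
    by (intro integral_mono n i norm_diff_sq_le)
  also have "\<dots> = 2 * csq F + 2 * csq G"
    using assms unfolding L2circ_def by (subst Bochner_Integration.integral_add) auto
  finally show "(LINT \<theta>|circ. (norm (F \<theta> - G \<theta>))\<^sup>2) \<le> 2 * csq F + 2 * csq G" .
qed

lemma L2circ_continuous:
  assumes "continuous_on {0..2*pi} F" shows "L2circ F"
  unfolding L2circ_def circ_def
  using assms by (auto intro!: continuous_imp_measurable_on_sets_lebesgue continuous_imp_integrable_real continuous_intros)

lemma vec_inner_diff_left: "vec_inner (x - y) z = vec_inner x z - vec_inner y z"
  by (simp add: vec_inner_def left_diff_distrib sum_subtractf)

lemma vec_inner_diff_right: "vec_inner z (x - y) = vec_inner z x - vec_inner z y"
  by (simp add: vec_inner_def right_diff_distrib sum_subtractf)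

lemma vec_inner_commute: "vec_inner y x = cnj (vec_inner x y)"
  by (simp add: vec_inner_def mult.commute)

lemma integral_vec_inner_tendsto_0:
  assumes G: "\<forall>\<^sub>F r in A. L2circ (G r)" and F: "L2circ F"
    and lim: "((\<lambda>r. csq (G r)) \<longlongrightarrow> 0) A"
  shows "((\<lambda>r. cint F (G r)) \<longlongrightarrow> 0) A"
proof (rule tendstoI)
  fix \<epsilon> :: real assume e: "0 < \<epsilon>"
  define b where "b = csq F"
  have b: "0 \<le> b" unfolding b_def by (intro Bochner_Integration.integral_nonneg) auto
  \<comment> \<open>Keeps the fixed term \<open>t * b\<close> below half of
    \<open>\<epsilon>\<close>; the other term is small once \<open>csq (G r)\<close> is.\<close>
  define t where "t = \<epsilon> / (2 * (b + 1))"
  have t: "0 < t" using e b by (simp add: t_def)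
  have tb: "t * b < \<epsilon> / 2"
  proof -
    have "t * (b + 1) = \<epsilon> / 2" using b by (simp add: t_def field_simps)
    then show ?thesis using t by (simp add: algebra_simps)
  qed
  have "\<forall>\<^sub>F r in A. (csq (G r)) < t * (\<epsilon> / 2)"
    using lim t e by (intro order_tendstoD(2)) auto
  with G show "\<forall>\<^sub>F r in A. dist (cint F (G r)) 0 < \<epsilon>"
  proof eventually_elim
    case (elim r)
    have "(csq (G r)) / t < \<epsilon> / 2" using elim(2) t by (simp add: field_simps)
    then have "cmod (cint F (G r)) < \<epsilon>"
      using L2circ_vec_inner(2)[OF F elim(1) t] tb unfolding b_def by linarith
    then show ?case by simp
  qed
qed

section \<open>Boundary functions as limits of dilates\<close>

abbreviation on_circle :: "real \<Rightarrow> (complex \<Rightarrow> 'b) \<Rightarrow> real \<Rightarrow> 'b" where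
  "on_circle s f \<theta> \<equiv> f (of_real s * cis \<theta>)"

abbreviation dilate :: "real \<Rightarrow> (complex \<Rightarrow> 'b) \<Rightarrow> real \<Rightarrow> real \<Rightarrow> 'b" where
  "dilate s q r \<equiv> on_circle s (\<lambda>\<zeta>. q (of_real r * \<zeta>))"

lemma circle_L2_iff: "\<phi> \<in> circle_L2 s \<longleftrightarrow> L2circ (on_circle s \<phi>)"
  by (simp add: circle_L2_def L2circ_def circ_def)

lemma circle_inner_eq: "circle_inner s \<phi> \<psi> = (LINT \<theta>|circ. vec_inner (on_circle s \<phi> \<theta>) (on_circle s \<psi> \<theta>)) / of_real (2 * pi)"
  by (simp add: circle_inner_def vec_inner_def circ_def)

lemma is_boundary_funD:
  assumes "is_boundary_fun s q \<phi>"
  shows "L2circ (on_circle s \<phi>)"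
    "((\<lambda>r. csq (\<lambda>\<theta>. on_circle s \<phi> \<theta> - dilate s q r \<theta>)) \<longlongrightarrow> 0) (at_left 1)"
proof -
  show "L2circ (on_circle s \<phi>)" using assms by (simp add: is_boundary_fun_def circle_L2_iff)
  have "((\<lambda>r. (circle_norm s (\<lambda>\<zeta>. \<phi> \<zeta> - q (of_real r * \<zeta>)))\<^sup>2 * (2 * pi)) \<longlongrightarrow> 0\<^sup>2 * (2 * pi)) (at_left 1)"
    using assms unfolding is_boundary_fun_def by (intro tendsto_intros) auto
  moreover have "(circle_norm s (\<lambda>\<zeta>. \<phi> \<zeta> - q (of_real r * \<zeta>)))\<^sup>2 * (2 * pi) =
      csq (\<lambda>\<theta>. on_circle s \<phi> \<theta> - dilate s q r \<theta>)" for r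
    unfolding circle_norm_def circ_def
    by (subst real_sqrt_pow2) (auto intro!: divide_nonneg_nonneg Bochner_Integration.integral_nonneg)
  ultimately show "((\<lambda>r. csq (\<lambda>\<theta>. on_circle s \<phi> \<theta> - dilate s q r \<theta>)) \<longlongrightarrow> 0) (at_left 1)"
    by simp
qed

lemma eventually_at_left_1: "\<forall>\<^sub>F r in at_left (1::real). 0 < r \<and> r < 1"
  using eventually_at_left[of 0 "1::real"] by (auto intro!: exI[of _ 0])

lemma dilate_L2circ:
  assumes s: "0 < s" and q: "continuous_on (ball 0 s) q" and r: "0 < r" "r < 1"
  shows "L2circ (dilate s q r)"
proof (rule L2circ_continuous)
  have "s * r < s * 1" using s r by (intro mult_strict_left_mono) auto
  then show "continuous_on {0..2*pi} (dilate s q r)"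
    using s r by (intro continuous_on_compose2[OF q] continuous_intros) (auto simp: norm_mult mult.commute)
qed

lemma hardy_vec_continuous:
  assumes "q \<in> hardy_vec s" shows "continuous_on (ball 0 s) q"
proof -
  have "continuous_on (ball 0 s) (\<lambda>z. q z $ i)" for i
    using assms by (intro holomorphic_on_imp_continuous_on) (simp add: hardy_vec_def hardy_def analytic_on_disc_def)
  then have "continuous_on (ball 0 s) (\<lambda>z. \<chi> i. q z $ i)" by (rule continuous_on_vec_lambda)
  then show ?thesis by simp
qed

text \<open>\<open>boundary_fun\<close> is an arbitrary choice. Any two candidates are limits of the
  same dilates, so their quadratic distance is zero and integrals do not see the choice.\<close>

lemma boundary_fun_unique:
  assumes s: "0 < s" and q: "continuous_on (ball 0 s) q"
    and "is_boundary_fun s q \<phi>" "is_boundary_fun s q \<psi>"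
  shows "AE \<theta> in circ. on_circle s \<phi> \<theta> = on_circle s \<psi> \<theta>"
proof -
  note a = is_boundary_funD[OF assms(3)] and b = is_boundary_funD[OF assms(4)]
  define D where "D = (LINT \<theta>|circ. (norm (on_circle s \<phi> \<theta> - on_circle s \<psi> \<theta>))\<^sup>2)"
  have "((\<lambda>r. 2 * csq (\<lambda>\<theta>. on_circle s \<phi> \<theta> - dilate s q r \<theta>) +
      2 * csq (\<lambda>\<theta>. on_circle s \<psi> \<theta> - dilate s q r \<theta>)) \<longlongrightarrow> 2 * 0 + 2 * 0) (at_left 1)"
    by (intro tendsto_intros a b)
  moreover have "\<forall>\<^sub>F r in at_left 1. D \<le> 2 * csq (\<lambda>\<theta>. on_circle s \<phi> \<theta> - dilate s q r \<theta>) +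
      2 * csq (\<lambda>\<theta>. on_circle s \<psi> \<theta> - dilate s q r \<theta>)"
    using eventually_at_left_1
  proof eventually_elim
    case (elim r)
    note l = dilate_L2circ[OF s q conjunct1[OF elim] conjunct2[OF elim]]
    show ?case using L2circ_diff(2)[OF L2circ_diff(1)[OF a(1) l] L2circ_diff(1)[OF b(1) l]] by (simp add: D_def)
  qed
  ultimately have "D \<le> 2 * 0 + 2 * 0" by (intro tendsto_lowerbound) auto
  moreover have "0 \<le> D" unfolding D_def by (intro Bochner_Integration.integral_nonneg) auto
  ultimately have "D = 0" by simp
  then have "AE \<theta> in circ. (norm (on_circle s \<phi> \<theta> - on_circle s \<psi> \<theta>))\<^sup>2 = 0"
    using L2circ_diff(1)[OF a(1) b(1)] unfolding D_def L2circ_def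
    by (subst (asm) integral_nonneg_eq_0_iff_AE) auto
  then show ?thesis by simp
qed

text \<open>Dilates by \<open>r < 1\<close> only see values inside the disc, so the truncation is
  harmless and uniform continuity of \<open>Q\<close> gives the limit.\<close>

lemma continuous_boundary:
  assumes s: "0 < s" and Q: "continuous_on (cball 0 s) Q"
  shows "is_boundary_fun s (\<lambda>z. if z \<in> ball 0 s then Q z else 0) Q"
  unfolding is_boundary_fun_def
proof
  have c: "continuous_on {0..2*pi} (on_circle s Q)"
    using s by (intro circle_continuous Q) auto
  show "Q \<in> circle_L2 s" unfolding circle_L2_iff by (rule L2circ_continuous[OF c])
  have u: "uniformly_continuous_on (cball 0 s) Q"
    by (rule compact_uniformly_continuous[OF Q]) simp
  show "((\<lambda>r. circle_norm s (\<lambda>\<zeta>. Q \<zeta> - (if of_real r * \<zeta> \<in> ball 0 s then Q (of_real r * \<zeta>) else 0))) \<longlongrightarrow> 0) (at_left 1)"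
  proof (rule tendstoI)
    fix e :: real assume e: "0 < e"
    obtain d where d: "0 < d" "\<And>x x'. x \<in> cball 0 s \<Longrightarrow> x' \<in> cball 0 s \<Longrightarrow> dist x' x < d \<Longrightarrow> dist (Q x') (Q x) < e / 2"
      using u e unfolding uniformly_continuous_on_def by (meson half_gt_zero)
    \<comment> \<open>A point of the circle and its dilate are \<open>s * (1 - r)\<close> apart,
      which explains the threshold \<open>1 - d / s\<close>.\<close>
    have "\<forall>\<^sub>F r in at_left (1::real). 0 < r \<and> 1 - d / s < r \<and> r < 1"
      using s d eventually_at_left[of "max 0 (1 - d / s)" "1::real"]
      by (auto intro!: exI[of _ "max 0 (1 - d / s)"])
    then show "\<forall>\<^sub>F r in at_left 1. dist (circle_norm s (\<lambda>\<zeta>. Q \<zeta> - (if of_real r * \<zeta> \<in> ball 0 s then Q (of_real r * \<zeta>) else 0))) 0 < e"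
    proof eventually_elim
      case (elim r)
      have sr: "s * r < s * 1" using s elim by (intro mult_strict_left_mono) auto
      define F where "F \<theta> = on_circle s Q \<theta> - on_circle s (\<lambda>\<zeta>. Q (of_real r * \<zeta>)) \<theta>" for \<theta>
      have eq: "on_circle s (\<lambda>\<zeta>. Q \<zeta> - (if of_real r * \<zeta> \<in> ball 0 s then Q (of_real r * \<zeta>) else 0)) \<theta> = F \<theta>" for \<theta>
        using sr s elim by (simp add: F_def norm_mult mult.commute)
      have cF: "continuous_on {0..2*pi} F"
        unfolding F_def using s elim sr
        by (intro continuous_intros c continuous_on_compose2[OF Q]) (auto simp: norm_mult mult.commute)
      have bF: "(norm (F \<theta>))\<^sup>2 \<le> (e / 2)\<^sup>2" for \<theta>
      proof -
        have e': "of_real s * cis \<theta> - of_real r * (of_real s * cis \<theta>) = of_real (s * (1 - r)) * cis \<theta>"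
          by (simp add: algebra_simps)
        have "dist (of_real s * cis \<theta>) (of_real r * (of_real s * cis \<theta>)) = s * (1 - r)"
          unfolding dist_norm e' norm_mult norm_of_real using s elim by simp
        also have "\<dots> < d" using elim s by (simp add: field_simps)
        finally have "dist (on_circle s Q \<theta>) (on_circle s (\<lambda>\<zeta>. Q (of_real r * \<zeta>)) \<theta>) < e / 2"
          using s elim sr by (intro d(2)) (auto simp: norm_mult mult.commute)
        then show ?thesis by (intro power_mono) (auto simp: F_def dist_norm)
      qed
      have "(LINT \<theta>|lebesgue_on {0..2*pi}. (norm (F \<theta>))\<^sup>2) \<le> (LINT \<theta>|lebesgue_on {0..2*pi}. (e / 2)\<^sup>2)"
        by (intro integral_mono bF continuous_imp_integrable_real continuous_intros cF)
      also have "\<dots> = (e / 2)\<^sup>2 * (2 * pi)" by (simp add: measure_restrict_space)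
      finally have "(LINT \<theta>|lebesgue_on {0..2*pi}. (norm (F \<theta>))\<^sup>2) / (2 * pi) \<le> (e / 2)\<^sup>2"
        by (simp add: field_simps)
      then have "circle_norm s (\<lambda>\<zeta>. Q \<zeta> - (if of_real r * \<zeta> \<in> ball 0 s then Q (of_real r * \<zeta>) else 0)) \<le> e / 2"
        unfolding circle_norm_def eq using e by (intro real_le_lsqrt) auto
      moreover have "0 \<le> circle_norm s (\<lambda>\<zeta>. Q \<zeta> - (if of_real r * \<zeta> \<in> ball 0 s then Q (of_real r * \<zeta>) else 0))"
        unfolding circle_norm_def by (auto intro!: Bochner_Integration.integral_nonneg)
      ultimately show ?case using e by simp
    qed
  qed
qed

text \<open>A boundary function determines the Taylor coefficients: the formula holds for dilates
  and passes to the limit. One power \<open>s ^ n\<close> stems from the monomial, the other from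
  the radius.\<close>

lemma boundary_taylor_coeff:
  fixes p :: "complex \<Rightarrow> complex ^ 'l"
  assumes s: "0 < s" and p: "p \<in> hardy_vec s" and b: "is_boundary_fun s p \<psi>"
  shows "(LINT \<theta>|circ. vec_inner (axis i (on_circle s (\<lambda>z. z ^ n) \<theta>)) (on_circle s \<psi> \<theta>)) =
    cnj (2 * pi * taylor_coeff (\<lambda>z. p z $ i) n * of_real (s ^ n) * of_real (s ^ n))"
proof -
  define F :: "real \<Rightarrow> complex ^ 'l" where "F \<theta> = axis i (on_circle s (\<lambda>z. z ^ n) \<theta>)" for \<theta>
  have "continuous_on {0..2*pi} (\<lambda>\<theta>. \<chi> j. if j = i then (of_real s * cis \<theta>) ^ n else (0 :: complex))"
    by (rule continuous_on_vec_lambda, rename_tac j, case_tac "j = i") (auto intro!: continuous_intros)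
  then have F: "L2circ F" unfolding F_def[abs_def] axis_def by (rule L2circ_continuous)
  note cp = hardy_vec_continuous[OF p]
  define G where "G r \<theta> = dilate s p r \<theta>" for r \<theta>
  have G: "L2circ (G r)" if "0 < r" "r < 1" for r
    unfolding G_def by (rule dilate_L2circ[OF s cp that])
  note bb = is_boundary_funD[OF b]
  have "((\<lambda>r. LINT \<theta>|circ. vec_inner (F \<theta>) (on_circle s \<psi> \<theta> - G r \<theta>)) \<longlongrightarrow> 0) (at_left 1)"
  proof (rule integral_vec_inner_tendsto_0[OF _ F])
    show "\<forall>\<^sub>F r in at_left 1. L2circ (\<lambda>\<theta>. on_circle s \<psi> \<theta> - G r \<theta>)"
      using eventually_at_left_1 by eventually_elim (auto intro: L2circ_diff bb G)
  qed (use bb(2) in \<open>simp add: G_def\<close>)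
  moreover have "\<forall>\<^sub>F r in at_left 1. (LINT \<theta>|circ. vec_inner (F \<theta>) (on_circle s \<psi> \<theta> - G r \<theta>)) =
     cint F (on_circle s \<psi>) - cnj (2 * pi * (taylor_coeff (\<lambda>z. p z $ i) n * of_real (r * s) ^ n)) * of_real (s ^ n)"
    using eventually_at_left_1
  proof eventually_elim
    case (elim r)
    have G': "L2circ (G r)" using elim by (auto intro: G)
    have rs: "0 < r * s" "r * s < s" using s elim by auto
    have hol: "(\<lambda>z. p z $ i) holomorphic_on ball 0 s"
      using p by (simp add: hardy_vec_def hardy_def analytic_on_disc_def)
    have "(cint F (G r)) =
      (LINT \<theta>|circ. cnj (p (of_real (r * s) * cis \<theta>) $ i * cis (- real n * \<theta>)) * of_real (s ^ n))"
    proof (rule Bochner_Integration.integral_cong[OF refl])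
      fix \<theta>
      have "vec_inner (F \<theta>) (G r \<theta>) = (of_real s * cis \<theta>) ^ n * cnj (p (of_real r * (of_real s * cis \<theta>)) $ i)"
        unfolding vec_inner_def F_def G_def axis_def by (simp add: if_distrib[of "\<lambda>x. x * _"] cong: if_cong)
      also have "(of_real s * cis \<theta>) ^ n = of_real (s ^ n) * cnj (cis (- real n * \<theta>))"
        by (simp add: power_mult_distrib Complex.DeMoivre cis_cnj)
      finally show "vec_inner (F \<theta>) (G r \<theta>) = cnj (p (of_real (r * s) * cis \<theta>) $ i * cis (- real n * \<theta>)) * of_real (s ^ n)"
        by (simp add: mult_ac)
    qed
    also have "\<dots> = cnj (LINT \<theta>|circ. p (of_real (r * s) * cis \<theta>) $ i * cis (- real n * \<theta>)) * of_real (s ^ n)"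
      by (simp only: integral_mult_left_zero Bochner_Integration.integral_cnj)
    also have "(LINT \<theta>|circ. p (of_real (r * s) * cis \<theta>) $ i * cis (- real n * \<theta>)) =
        2 * pi * (taylor_coeff (\<lambda>z. p z $ i) n * of_real (r * s) ^ n)"
      unfolding circ_def
      by (rule taylor_coeff_circle[OF rs(1), of "\<lambda>z. p z $ i"])
        (use rs in \<open>auto intro!: holomorphic_on_subset[OF hol] continuous_on_subset[OF holomorphic_on_imp_continuous_on[OF hol]]\<close>)
    finally show ?case
      unfolding vec_inner_diff_right using L2circ_vec_inner(1)[OF F bb(1)] L2circ_vec_inner(1)[OF F G']
      by (subst Bochner_Integration.integral_diff) auto
  qed
  ultimately have "((\<lambda>r. cint F (on_circle s \<psi>) -
      cnj (2 * pi * (taylor_coeff (\<lambda>z. p z $ i) n * of_real (r * s) ^ n)) * of_real (s ^ n)) \<longlongrightarrow> 0) (at_left 1)"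
    by (rule Lim_transform_eventually)
  moreover have "((\<lambda>r. cint F (on_circle s \<psi>) -
      cnj (2 * pi * (taylor_coeff (\<lambda>z. p z $ i) n * of_real (r * s) ^ n)) * of_real (s ^ n)) \<longlongrightarrow>
      cint F (on_circle s \<psi>) -
      cnj (2 * pi * (taylor_coeff (\<lambda>z. p z $ i) n * of_real (1 * s) ^ n)) * of_real (s ^ n)) (at_left 1)"
    by (intro tendsto_intros)
  ultimately have "cint F (on_circle s \<psi>) -
      cnj (2 * pi * (taylor_coeff (\<lambda>z. p z $ i) n * of_real (1 * s) ^ n)) * of_real (s ^ n) = 0"
    by (intro tendsto_unique[OF trivial_limit_at_left_real])
  then show ?thesis by (simp add: F_def mult_ac)
qed

text \<open>Identifies the projection by a test on continuous data: \<open>orth\<close> involves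
  dilates of \<open>u\<close>, and an L^2 limit extends it to boundary functions.\<close>

lemma toeplitz_eqI:
  fixes Q P :: "complex \<Rightarrow> complex ^ 'l"
  assumes s: "0 < s" and Q: "continuous_on (cball 0 s) Q" and P: "continuous_on (cball 0 s) P"
    and \<sigma>: "continuous_on (sphere 0 s) \<sigma>"
    and Pv: "(\<lambda>z. if z \<in> ball 0 s then P z else 0) \<in> hardy_vec s"
    and orth: "\<And>u r. u \<in> hardy_vec s \<Longrightarrow> 0 < r \<Longrightarrow> r < 1 \<Longrightarrow>
      (LINT \<theta>|circ. vec_inner (on_circle s (\<lambda>\<zeta>. \<sigma> \<zeta> *s Q \<zeta> - P \<zeta>) \<theta>) (dilate s u r \<theta>)) = 0"
  shows "toeplitz s \<sigma> (\<lambda>z. if z \<in> ball 0 s then Q z else 0) = (\<lambda>z. if z \<in> ball 0 s then P z else 0)"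
proof -
  define q where "q = (\<lambda>z. if z \<in> ball 0 s then Q z else 0)"
  define p where "p = (\<lambda>z. if z \<in> ball 0 s then P z else 0)"
  define \<phi> where "\<phi> = boundary_fun s q"
  have qQ: "is_boundary_fun s q Q" unfolding q_def by (rule continuous_boundary[OF s Q])
  have pP: "is_boundary_fun s p P" unfolding p_def by (rule continuous_boundary[OF s P])
  have q\<phi>: "is_boundary_fun s q \<phi>"
    using someI[of "is_boundary_fun s q", OF qQ] by (simp only: \<phi>_def boundary_fun_def)
  have cq: "continuous_on (ball 0 s) q"
  proof -
    have "continuous_on (ball 0 s) Q" by (rule continuous_on_subset[OF Q]) auto
    then show ?thesis by (rule continuous_on_eq) (simp add: q_def)
  qed
  have ae: "AE \<theta> in circ. on_circle s \<phi> \<theta> = on_circle s Q \<theta>"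
    by (rule boundary_fun_unique[OF s cq q\<phi> qQ])
  have c\<sigma>: "continuous_on {0..2*pi} (on_circle s \<sigma>)"
    using s by (intro continuous_on_compose2[OF \<sigma>] continuous_intros) (auto simp: norm_mult)
  have cQ: "continuous_on {0..2*pi} (on_circle s Q)" and cP: "continuous_on {0..2*pi} (on_circle s P)"
    using s by (intro circle_continuous Q P; simp)+
  define H where "H \<theta> = on_circle s \<sigma> \<theta> *s on_circle s Q \<theta>" for \<theta>
  have cH: "continuous_on {0..2*pi} H"
    unfolding H_def vector_scalar_mult_def by (intro continuous_intros c\<sigma> cQ)
  have LH: "L2circ H" by (rule L2circ_continuous[OF cH])
  have LP: "L2circ (on_circle s P)" by (rule L2circ_continuous[OF cP])
  have meas\<phi>: "(\<lambda>\<theta>. on_circle s \<sigma> \<theta> *s on_circle s \<phi> \<theta>) \<in> borel_measurable circ"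
  proof -
    have m1: "on_circle s \<phi> \<in> borel_measurable circ" using is_boundary_funD(1)[OF q\<phi>] by (simp add: L2circ_def)
    have m2: "on_circle s \<sigma> \<in> borel_measurable circ"
      unfolding circ_def by (rule continuous_imp_measurable_on_sets_lebesgue[OF c\<sigma>]) simp
    have m3: "(\<lambda>\<theta>. (on_circle s \<sigma> \<theta>, on_circle s \<phi> \<theta>)) \<in> borel_measurable circ" using m1 m2 by measurable
    have "continuous_on UNIV (\<lambda>x :: complex \<times> (complex ^ 'l). fst x *s snd x)"
      unfolding vector_scalar_mult_def by (intro continuous_intros)
    from measurable_compose[OF m3 borel_measurable_continuous_onI[OF this]] show ?thesis by simp
  qed
  \<comment> \<open>Replaces the chosen boundary function by the continuous \<open>Q\<close>, with
    which it agrees almost everywhere.\<close>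
  have inner: "circle_inner s (\<lambda>\<zeta>. \<sigma> \<zeta> *s \<phi> \<zeta> - \<psi> \<zeta>) \<upsilon> =
      (LINT \<theta>|circ. vec_inner (H \<theta> - on_circle s \<psi> \<theta>) (on_circle s \<upsilon> \<theta>)) / of_real (2 * pi)"
    if "L2circ (on_circle s \<psi>)" "L2circ (on_circle s \<upsilon>)" for \<psi> \<upsilon>
  proof -
    have "(LINT \<theta>|circ. vec_inner (on_circle s (\<lambda>\<zeta>. \<sigma> \<zeta> *s \<phi> \<zeta> - \<psi> \<zeta>) \<theta>) (on_circle s \<upsilon> \<theta>)) =
        (LINT \<theta>|circ. vec_inner (H \<theta> - on_circle s \<psi> \<theta>) (on_circle s \<upsilon> \<theta>))"
    proof (rule integral_cong_AE)
      show "(\<lambda>\<theta>. vec_inner (on_circle s (\<lambda>\<zeta>. \<sigma> \<zeta> *s \<phi> \<zeta> - \<psi> \<zeta>) \<theta>) (on_circle s \<upsilon> \<theta>)) \<in> borel_measurable circ"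
        using that meas\<phi> by (intro vec_inner_measurable borel_measurable_diff) (auto simp: L2circ_def)
      show "(\<lambda>\<theta>. vec_inner (H \<theta> - on_circle s \<psi> \<theta>) (on_circle s \<upsilon> \<theta>)) \<in> borel_measurable circ"
        using that LH by (intro vec_inner_measurable borel_measurable_diff) (auto simp: L2circ_def)
      show "AE \<theta> in circ. vec_inner (on_circle s (\<lambda>\<zeta>. \<sigma> \<zeta> *s \<phi> \<zeta> - \<psi> \<zeta>) \<theta>) (on_circle s \<upsilon> \<theta>) =
          vec_inner (H \<theta> - on_circle s \<psi> \<theta>) (on_circle s \<upsilon> \<theta>)"
        using ae by eventually_elim (simp add: H_def)
    qed
    then show ?thesis by (simp add: circle_inner_eq)
  qed
  have Porth: "circle_inner s (\<lambda>\<zeta>. \<sigma> \<zeta> *s \<phi> \<zeta> - P \<zeta>) \<upsilon> = 0"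
    if u: "u \<in> hardy_vec s" and b: "is_boundary_fun s u \<upsilon>" for u \<upsilon>
  proof -
    note bb = is_boundary_funD[OF b]
    define F where "F \<theta> = H \<theta> - on_circle s P \<theta>" for \<theta>
    have F: "L2circ F" unfolding F_def by (rule L2circ_diff(1)[OF LH LP])
    define G where "G r \<theta> = dilate s u r \<theta>" for r \<theta>
    have G: "L2circ (G r)" if "0 < r" "r < 1" for r
      unfolding G_def by (rule dilate_L2circ[OF s hardy_vec_continuous[OF u] that])
    have "((\<lambda>r. LINT \<theta>|circ. vec_inner (F \<theta>) (on_circle s \<upsilon> \<theta> - G r \<theta>)) \<longlongrightarrow> 0) (at_left 1)"
    proof (rule integral_vec_inner_tendsto_0[OF _ F])
      show "\<forall>\<^sub>F r in at_left 1. L2circ (\<lambda>\<theta>. on_circle s \<upsilon> \<theta> - G r \<theta>)"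
        using eventually_at_left_1 by eventually_elim (auto intro: L2circ_diff bb G)
    qed (use bb(2) in \<open>simp add: G_def\<close>)
    moreover have "\<forall>\<^sub>F r in at_left 1. (LINT \<theta>|circ. vec_inner (F \<theta>) (on_circle s \<upsilon> \<theta> - G r \<theta>)) =
        cint F (on_circle s \<upsilon>)"
      using eventually_at_left_1
    proof eventually_elim
      case (elim r)
      have G': "L2circ (G r)" using elim by (auto intro: G)
      have "(cint F (G r)) = 0"
        using orth[OF u, of r] elim by (simp add: F_def G_def H_def)
      then show ?case
        unfolding vec_inner_diff_right using L2circ_vec_inner(1)[OF F bb(1)] L2circ_vec_inner(1)[OF F G']
        by (subst Bochner_Integration.integral_diff) auto
    qed
    ultimately have "((\<lambda>r. cint F (on_circle s \<upsilon>)) \<longlongrightarrow> 0) (at_left (1::real))"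
      by (rule Lim_transform_eventually)
    then have "cint F (on_circle s \<upsilon>) = 0"
      using tendsto_const_iff[OF trivial_limit_at_left_real] by blast
    then show ?thesis using inner[OF LP bb(1)] by (simp add: F_def)
  qed
  have "hardy_proj s (\<lambda>\<zeta>. \<sigma> \<zeta> *s \<phi> \<zeta>) = p"
    unfolding hardy_proj_def
  proof (rule the_equality)
    show "p \<in> hardy_vec s \<and> (\<exists>\<psi>. is_boundary_fun s p \<psi> \<and>
        (\<forall>u\<in>hardy_vec s. \<forall>\<upsilon>. is_boundary_fun s u \<upsilon> \<longrightarrow> circle_inner s (\<lambda>\<zeta>. \<sigma> \<zeta> *s \<phi> \<zeta> - \<psi> \<zeta>) \<upsilon> = 0))"
      using Pv pP Porth by (auto simp: p_def)
  next
    fix p' assume p': "p' \<in> hardy_vec s \<and> (\<exists>\<psi>. is_boundary_fun s p' \<psi> \<and>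
        (\<forall>u\<in>hardy_vec s. \<forall>\<upsilon>. is_boundary_fun s u \<upsilon> \<longrightarrow> circle_inner s (\<lambda>\<zeta>. \<sigma> \<zeta> *s \<phi> \<zeta> - \<psi> \<zeta>) \<upsilon> = 0))"
    then obtain \<psi> where \<psi>: "is_boundary_fun s p' \<psi>"
      "\<And>u \<upsilon>. u \<in> hardy_vec s \<Longrightarrow> is_boundary_fun s u \<upsilon> \<Longrightarrow> circle_inner s (\<lambda>\<zeta>. \<sigma> \<zeta> *s \<phi> \<zeta> - \<psi> \<zeta>) \<upsilon> = 0"
      by blast
    have p'v: "p' \<in> hardy_vec s" using p' by blast
    have pv: "p \<in> hardy_vec s" using Pv by (simp add: p_def)
    have L\<psi>: "L2circ (on_circle s \<psi>)" by (rule is_boundary_funD(1)[OF \<psi>(1)])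
    \<comment> \<open>Uniqueness in the \<open>THE\<close>: both candidates have the same pairing
      with every monomial in every component, and these pairings are their Taylor
      coefficients.\<close>
    have coeff: "taylor_coeff (\<lambda>z. p' z $ i) n = taylor_coeff (\<lambda>z. p z $ i) n" for i n
    proof -
      define E :: "complex \<Rightarrow> complex ^ 'l" where "E z = axis i (z ^ n)" for z
      have Ei: "E z $ j = (if j = i then z ^ n else 0)" for z j by (simp add: E_def axis_def)
      have "continuous_on A (\<lambda>z. \<chi> j. if j = i then z ^ n else (0 :: complex))" for A
        by (rule continuous_on_vec_lambda, rename_tac j, case_tac "j = i") (auto intro!: continuous_intros)
      then have cE: "continuous_on A E" for A unfolding E_def[abs_def] axis_def .
      have hE: "(\<lambda>z. E z $ j) holomorphic_on A" for A j
        unfolding Ei by (cases "j = i") (auto intro!: holomorphic_intros)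
      have bE: "norm (E z) \<le> s ^ n" if "z \<in> cball 0 s" for z
      proof -
        have "(cmod (E z $ j))\<^sup>2 = (if j = i then (cmod (z ^ n))\<^sup>2 else 0)" for j by (simp add: Ei)
        then have "norm (E z) = cmod (z ^ n)" by (simp add: norm_vec_def L2_set_def)
        also have "\<dots> \<le> s ^ n" using that by (simp add: norm_power power_mono)
        finally show ?thesis .
      qed
      have Ev: "(\<lambda>z. if z \<in> ball 0 s then E z else 0) \<in> hardy_vec s"
        by (rule hardy_vec_sup_bound[OF s hE cE bE])
      note Eb = continuous_boundary[OF s cE]
      note LE = is_boundary_funD(1)[OF Eb]
      have "(LINT \<theta>|circ. vec_inner (H \<theta> - on_circle s \<psi> \<theta>) (on_circle s E \<theta>)) = 0"
        using \<psi>(2)[OF Ev Eb] inner[OF L\<psi> LE] by simp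
      then have 1: "cint H (on_circle s E) = cint (on_circle s \<psi>) (on_circle s E)"
        unfolding vec_inner_diff_left using L2circ_vec_inner(1)[OF LH LE] L2circ_vec_inner(1)[OF L\<psi> LE]
        by (subst (asm) Bochner_Integration.integral_diff) auto
      have "(LINT \<theta>|circ. vec_inner (H \<theta> - on_circle s P \<theta>) (on_circle s E \<theta>)) = 0"
        using Porth[OF Ev Eb] inner[OF LP LE] by simp
      then have 2: "cint H (on_circle s E) = cint (on_circle s P) (on_circle s E)"
        unfolding vec_inner_diff_left using L2circ_vec_inner(1)[OF LH LE] L2circ_vec_inner(1)[OF LP LE]
        by (subst (asm) Bochner_Integration.integral_diff) auto
      have 3: "(LINT \<theta>|circ. vec_inner (on_circle s X \<theta>) (on_circle s E \<theta>)) = cnj (LINT \<theta>|circ. vec_inner (on_circle s E \<theta>) (on_circle s X \<theta>))" for X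
        unfolding Bochner_Integration.integral_cnj[symmetric] by (subst vec_inner_commute) simp
      have "cnj (cint (on_circle s E) (on_circle s \<psi>)) = cnj (cint (on_circle s E) (on_circle s P))"
        using 1 2 unfolding 3 by simp
      then have "2 * pi * taylor_coeff (\<lambda>z. p' z $ i) n * of_real (s ^ n) * of_real (s ^ n) =
          2 * pi * taylor_coeff (\<lambda>z. p z $ i) n * of_real (s ^ n) * of_real (s ^ n)"
        unfolding E_def boundary_taylor_coeff[OF s p'v \<psi>(1), of i n] boundary_taylor_coeff[OF s pv pP, of i n]
        by simp
      then show ?thesis using s by simp
    qed
    have "(\<lambda>z. p' z $ i) = (\<lambda>z. p z $ i)" for i
      by (rule analytic_on_disc_eqI[of _ s]) (use pv p'v coeff in \<open>auto simp: hardy_vec_def hardy_def\<close>)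
    then show "p' = p" by (auto simp: fun_eq_iff vec_eq_iff)
  qed
  then show ?thesis by (simp add: toeplitz_def q_def \<phi>_def p_def)
qed

subsection \<open>Rows representing the elements of a nearly invariant subspace\<close>

locale nearly_invariant_disc = nearly_invariant_subspace m B c a \<alpha> N M g
  for m B c a \<alpha> N M and g :: "'l::finite \<Rightarrow> complex \<Rightarrow> complex" +
  fixes s :: real
  assumes s: "0 < s" "s < 1"
    and zeros: "\<And>z. z \<in> ball 0 1 \<Longrightarrow> B z = 0 \<Longrightarrow> z \<in> ball 0 s"
    and Hinf_less: "Hinf_norm s (\<lambda>z. of_real (inverse \<gamma>) * B z) < 1"
begin

definition \<rho> :: real where "\<rho> = Hinf_norm s (\<lambda>z. of_real (inverse \<gamma>) * B z)"

lemma B_hol: "B holomorphic_on ball 0 1"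
  by (rule holomorphic_transform[OF h2_isometricD(1)[OF Psi_isometric[of m]]]) (simp add: B_eq)

lemma cball_s: "z \<in> cball 0 s \<Longrightarrow> z \<in> ball 0 1"
  using s by simp

lemma B_cont: "continuous_on (cball 0 s) B"
  using holomorphic_on_imp_continuous_on[OF B_hol] by (rule continuous_on_subset) (use cball_s in blast)

text \<open>The supremum is over the open disc; continuity carries it to the circle, where the
  Toeplitz operator lives.\<close>

lemma B_bound: "z \<in> cball 0 s \<Longrightarrow> cmod (B z) \<le> \<rho> * \<gamma>"
proof -
  have c: "continuous_on (cball 0 s) (\<lambda>z. of_real (inverse \<gamma>) * B z)"
    by (intro continuous_intros B_cont)
  have "bounded ((\<lambda>z. of_real (inverse \<gamma>) * B z) ` cball 0 s)"
    by (intro compact_imp_bounded compact_continuous_image c) simp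
  then obtain K where "\<forall>x\<in>(\<lambda>z. of_real (inverse \<gamma>) * B z) ` cball 0 s. cmod x \<le> K"
    unfolding bounded_iff by blast
  then have K: "\<And>z. z \<in> cball 0 s \<Longrightarrow> cmod (of_real (inverse \<gamma>) * B z) \<le> K" by blast
  have le: "cmod (of_real (inverse \<gamma>) * B z) \<le> \<rho>" if "z \<in> ball 0 s" for z
    unfolding \<rho>_def Hinf_norm_def
    by (rule cSUP_upper[OF that]) (use K in \<open>auto intro!: bdd_aboveI2[where M = K]\<close>)
  assume z: "z \<in> cball 0 s"
  have "cmod (of_real (inverse \<gamma>) * B z) \<le> \<rho>"
    by (rule continuous_on_closure_norm_le[of "ball 0 s" "\<lambda>z. of_real (inverse \<gamma>) * B z"])
      (use c z s le in auto)
  then have "inverse \<gamma> * cmod (B z) \<le> \<rho>" using \<gamma>_pos by (simp only: norm_mult norm_of_real) simp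
  then show ?thesis using \<gamma>_pos by (simp add: field_simps)
qed

lemma \<rho>: "0 \<le> \<rho>" "\<rho> < 1"
proof -
  show "\<rho> < 1" using Hinf_less by (simp add: \<rho>_def)
  have "0 \<le> \<rho> * \<gamma>" using B_bound[of 0] s by (intro order_trans[OF norm_ge_zero[of "B 0"]]) auto
  then show "0 \<le> \<rho>" using \<gamma>_pos by (simp add: zero_le_mult_iff)
qed

text \<open>Size of the \<open>k\<close>-th row weighted so that the squares sum to at most the
  squared norm of \<open>h\<close>; the compensating power of \<open>\<gamma>\<close> is taken from
  the bound on \<open>B\<close>.\<close>

definition E :: "(complex \<Rightarrow> complex) \<Rightarrow> nat \<Rightarrow> real" where
  "E h k = \<gamma> ^ k * norm (lead_row (iter k h))"

lemma E_nonneg: "0 \<le> E h k"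
  using \<gamma>_pos by (simp add: E_def)

lemma E_summable:
  assumes "h \<in> M"
  shows "summable (\<lambda>k. (E h k)\<^sup>2)" "(\<Sum>k. (E h k)\<^sup>2) \<le> l2_norm_sq (norm2_coords h)"
proof -
  have part: "(\<Sum>k<n. (E h k)\<^sup>2) \<le> l2_norm_sq (norm2_coords h)" for n
  proof -
    have "0 \<le> (\<gamma> ^ n)\<^sup>2 * l2_norm_sq (norm2_coords (iter n h))"
      by (intro mult_nonneg_nonneg l2_norm_sq_nonneg norm2_coords_ltwo M_dirichlet iter_mem assms) auto
    then show ?thesis using iter_energy[OF assms, of n] by (simp add: E_def)
  qed
  then show "summable (\<lambda>k. (E h k)\<^sup>2)" by (intro summableI_nonneg_bounded) auto
  then show "(\<Sum>k. (E h k)\<^sup>2) \<le> l2_norm_sq (norm2_coords h)" using part by (rule suminf_le_const)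
qed

text \<open>Cauchy-Schwarz between the geometric sequence and \<open>E\<close>; its constant is the
  reciprocal of the one in the norm bound to be proved.\<close>

lemma majorant:
  assumes "h \<in> M"
  shows "summable (\<lambda>k. \<rho> ^ k * E h k)" "(\<Sum>k. \<rho> ^ k * E h k) \<le> sqrt (1 / (1 - \<rho>\<^sup>2)) * sqrt (l2_norm_sq (norm2_coords h))"
proof -
  have r2: "\<rho>\<^sup>2 < 1" using \<rho> by (simp add: abs_square_less_1)
  have g: "(\<lambda>k. (\<rho> ^ k)\<^sup>2) sums (1 / (1 - \<rho>\<^sup>2))"
    using geometric_sums[of "\<rho>\<^sup>2"] r2 by (simp add: power_mult[symmetric] mult.commute)
  then have gs: "summable (\<lambda>k. (\<rho> ^ k)\<^sup>2)" "(\<Sum>k. (\<rho> ^ k)\<^sup>2) = 1 / (1 - \<rho>\<^sup>2)" by (auto simp: sums_iff)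
  have nn: "\<bar>\<rho> ^ k * E h k\<bar> = \<rho> ^ k * E h k" for k using \<rho> E_nonneg[of h k] by simp
  show "summable (\<lambda>k. \<rho> ^ k * E h k)" using summable_mult_L2[OF gs(1) E_summable(1)[OF assms]] by (simp only: nn)
  have "(\<Sum>k. \<rho> ^ k * E h k) \<le> sqrt (1 / (1 - \<rho>\<^sup>2)) * sqrt (\<Sum>k. (E h k)\<^sup>2)"
    using suminf_Cauchy_Schwarz[OF gs(1) E_summable(1)[OF assms]] by (simp only: nn gs(2))
  also have "\<dots> \<le> sqrt (1 / (1 - \<rho>\<^sup>2)) * sqrt (l2_norm_sq (norm2_coords h))"
    using r2 by (intro mult_left_mono real_sqrt_le_mono E_summable assms) auto
  finally show "(\<Sum>k. \<rho> ^ k * E h k) \<le> sqrt (1 / (1 - \<rho>\<^sup>2)) * sqrt (l2_norm_sq (norm2_coords h))" .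
qed

lemma term_bound:
  assumes "z \<in> cball 0 s"
  shows "cmod (B z) ^ k * norm (lead_row (iter k h)) \<le> \<rho> ^ k * E h k"
    "cmod (B z ^ k * lead_coord (iter k h) i) \<le> \<rho> ^ k * E h k"
proof -
  have "cmod (B z) ^ k \<le> (\<rho> * \<gamma>) ^ k" by (intro power_mono B_bound assms) auto
  then have "cmod (B z) ^ k * norm (lead_row (iter k h)) \<le> (\<rho> * \<gamma>) ^ k * norm (lead_row (iter k h))"
    by (intro mult_right_mono) auto
  then show *: "cmod (B z) ^ k * norm (lead_row (iter k h)) \<le> \<rho> ^ k * E h k"
    by (simp add: E_def power_mult_distrib mult_ac)
  have "cmod (lead_coord (iter k h) i) \<le> norm (lead_row (iter k h))"
    using Finite_Cartesian_Product.norm_nth_le[of "lead_row (iter k h)" i] by (simp add: lead_row_def)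
  then have "cmod (B z ^ k * lead_coord (iter k h) i) \<le> cmod (B z) ^ k * norm (lead_row (iter k h))"
    unfolding norm_mult norm_power by (intro mult_left_mono) auto
  then show "cmod (B z ^ k * lead_coord (iter k h) i) \<le> \<rho> ^ k * E h k" using * by linarith
qed

section \<open>The row series and its regularity\<close>

definition Q :: "(complex \<Rightarrow> complex) \<Rightarrow> complex \<Rightarrow> complex ^ 'l" where
  "Q h z = (\<chi> i. \<Sum>k. B z ^ k * lead_coord (iter k h) i)"

lemma Q_sums:
  assumes "h \<in> M" "z \<in> cball 0 s"
  shows "(\<lambda>k. B z ^ k * lead_coord (iter k h) i) sums (Q h z $ i)"
proof -
  have "summable (\<lambda>k. B z ^ k * lead_coord (iter k h) i)"
    by (rule summable_comparison_test'[OF majorant(1)[OF assms(1)], of 0]) (rule term_bound(2)[OF assms(2)])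
  then show ?thesis by (simp add: Q_def summable_sums)
qed

text \<open>The bound is for the Euclidean norm of the partial sums as vectors, so no dimension
  constant enters.\<close>

lemma norm_Q:
  assumes "h \<in> M" "z \<in> cball 0 s"
  shows "norm (Q h z) \<le> sqrt (1 / (1 - \<rho>\<^sup>2)) * sqrt (l2_norm_sq (norm2_coords h))"
proof (rule tendsto_upperbound)
  show "(\<lambda>n. norm (\<chi> i. \<Sum>k<n. B z ^ k * lead_coord (iter k h) i)) \<longlonglongrightarrow> norm (Q h z)"
    by (intro tendsto_norm vec_tendstoI) (use Q_sums[OF assms] in \<open>simp add: sums_def\<close>)
  show "\<forall>\<^sub>F n in sequentially. norm (\<chi> i. \<Sum>k<n. B z ^ k * lead_coord (iter k h) i) \<le> sqrt (1 / (1 - \<rho>\<^sup>2)) * sqrt (l2_norm_sq (norm2_coords h))"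
  proof (rule always_eventually, rule allI)
    fix n
    have "(\<chi> i. \<Sum>k<n. B z ^ k * lead_coord (iter k h) i) = (\<Sum>k<n. B z ^ k *s lead_row (iter k h))"
      by (simp add: vec_eq_iff lead_row_def sum_component)
    then have "norm (\<chi> i. \<Sum>k<n. B z ^ k * lead_coord (iter k h) i) \<le> (\<Sum>k<n. norm (B z ^ k *s lead_row (iter k h)))"
      by (simp only: norm_sum)
    also have "\<dots> = (\<Sum>k<n. cmod (B z) ^ k * norm (lead_row (iter k h)))"
    proof (intro sum.cong refl)
      fix k
      have "norm (p *s v) = cmod p * norm v" for p and v :: "complex ^ 'l"
        by (simp add: norm_vec_def norm_mult L2_set_def power_mult_distrib sum_distrib_left[symmetric] real_sqrt_mult)
      then show "norm (B z ^ k *s lead_row (iter k h)) = cmod (B z) ^ k * norm (lead_row (iter k h))" by (simp add: norm_power)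
    qed
    also have "\<dots> \<le> (\<Sum>k<n. \<rho> ^ k * E h k)" by (intro sum_mono term_bound assms)
    also have "\<dots> \<le> (\<Sum>k. \<rho> ^ k * E h k)"
      using \<rho> E_nonneg by (intro sum_le_suminf majorant assms) auto
    also have "\<dots> \<le> sqrt (1 / (1 - \<rho>\<^sup>2)) * sqrt (l2_norm_sq (norm2_coords h))" by (rule majorant[OF assms(1)])
    finally show "norm (\<chi> i. \<Sum>k<n. B z ^ k * lead_coord (iter k h) i) \<le> sqrt (1 / (1 - \<rho>\<^sup>2)) * sqrt (l2_norm_sq (norm2_coords h))" .
  qed
qed simp

lemma Q_regular:
  assumes "h \<in> M"
  shows "continuous_on (cball 0 s) (Q h)" "(\<lambda>z. Q h z $ i) holomorphic_on ball 0 s"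
proof -
  have u: "uniform_limit (cball 0 s) (\<lambda>n z. \<Sum>k<n. B z ^ k * lead_coord (iter k h) i) (\<lambda>z. Q h z $ i) sequentially" for i
    unfolding Q_def vec_lambda_beta
    by (rule Weierstrass_m_test[OF _ majorant(1)[OF assms]]) (rule term_bound(2))
  have "continuous_on (cball 0 s) (\<lambda>z. Q h z $ i) \<and> (\<lambda>z. Q h z $ i) holomorphic_on ball 0 s" for i
  proof -
    have "B holomorphic_on ball 0 s" by (rule holomorphic_on_subset[OF B_hol]) (use s in auto)
    then have "\<forall>\<^sub>F n in sequentially. continuous_on (cball 0 s) (\<lambda>z. \<Sum>k<n. B z ^ k * lead_coord (iter k h) i) \<and>
        (\<lambda>z. \<Sum>k<n. B z ^ k * lead_coord (iter k h) i) holomorphic_on ball 0 s"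
      by (intro always_eventually allI conjI continuous_intros holomorphic_intros B_cont)
    from holomorphic_uniform_limit[OF this u] show ?thesis by auto
  qed
  then have c: "\<And>i. continuous_on (cball 0 s) (\<lambda>z. Q h z $ i)" and h: "\<And>i. (\<lambda>z. Q h z $ i) holomorphic_on ball 0 s" by auto
  have "continuous_on (cball 0 s) (\<lambda>z. \<chi> i. Q h z $ i)" by (rule continuous_on_vec_lambda) (rule c)
  then show "continuous_on (cball 0 s) (Q h)" by simp
  show "(\<lambda>z. Q h z $ i) holomorphic_on ball 0 s" by (rule h)
qed

text \<open>Division by \<open>B\<close> after removing the constant row corresponds to
  \<open>rest\<close> on \<open>M\<close>; this drives the Toeplitz computation.\<close>

lemma Q_rest:
  assumes "h \<in> M" "z \<in> cball 0 s"
  shows "Q h z = lead_row h + B z *s Q (rest h) z"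
proof -
  have "Q h z $ i = lead_coord h i + B z * (Q (rest h) z $ i)" for i
  proof -
    have "(\<lambda>k. B z * (B z ^ k * lead_coord (iter k (rest h)) i)) sums (B z * (Q (rest h) z $ i))"
      by (intro sums_mult Q_sums rest(1) assms)
    then have "(\<lambda>k. B z ^ Suc k * lead_coord (iter (Suc k) h) i) sums (B z * (Q (rest h) z $ i))"
      by (simp add: iter_simps(3) mult.assoc)
    from sums_Suc[OF this] show ?thesis
      using Q_sums[OF assms, of i] by (simp add: iter_simps(1) sums_unique2 add.commute)
  qed
  then show ?thesis by (simp add: vec_eq_iff lead_row_def)
qed

lemma Q_add:
  assumes "f \<in> M" "h \<in> M" "z \<in> cball 0 s"
  shows "Q (\<lambda>z. f z + p * h z) z = Q f z + p *s Q h z"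
proof -
  have "Q (\<lambda>z. f z + p * h z) z $ i = Q f z $ i + p * (Q h z $ i)" for i
  proof (rule sums_unique2[OF Q_sums])
    have "(\<lambda>k. B z ^ k * lead_coord (iter k f) i + p * (B z ^ k * lead_coord (iter k h) i)) sums (Q f z $ i + p * (Q h z $ i))"
      by (intro sums_add sums_mult Q_sums assms)
    then show "(\<lambda>k. B z ^ k * lead_coord (iter k (\<lambda>z. f z + p * h z)) i) sums (Q f z $ i + p * (Q h z $ i))"
      using assms by (simp add: iter_add lead_coord_add iter_mem algebra_simps)
  qed (use assms M_add in auto)
  then show ?thesis by (simp add: vec_eq_iff)
qed

lemma Q_zero: "z \<in> cball 0 s \<Longrightarrow> Q (\<lambda>z. 0) z = 0"
  using Q_add[OF M_zero M_zero, of z "-1"] by (simp add: vec_eq_iff)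

lemma Q_lead: "z \<in> cball 0 s \<Longrightarrow> Q (lead h) z = lead_row h"
  using Q_rest[OF lead_mem, of z h] by (simp add: rest_lead Q_zero lead_row_def lead_coord_lead)

text \<open>In the \<open>n\<close>-fold decomposition the energy bound on the iterate cancels the
  powers of \<open>\<gamma>\<close> from the bound on \<open>B\<close>, and
  \<open>\<rho> ^ n\<close> is left.\<close>

lemma Q_represents:
  assumes "h \<in> M" "z \<in> ball 0 s"
  shows "h z = (\<Sum>i\<in>UNIV. Q h z $ i * g i z)"
proof -
  have z: "z \<in> cball 0 s" "z \<in> ball 0 1" using assms(2) s by auto
  obtain C where C: "0 \<le> C" "\<And>f. f \<in> dirichlet \<alpha> \<Longrightarrow> cmod (f z) \<le> C * sqrt (l2_norm_sq (norm2_coords f))"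
    by (rule norm2_pointwise_bound[OF z(2)]) (rule that; blast)
  have rem: "cmod (B z ^ n * iter n h z) \<le> \<rho> ^ n * (C * sqrt (l2_norm_sq (norm2_coords h)))" for n
  proof -
    have "(\<gamma> ^ n)\<^sup>2 * l2_norm_sq (norm2_coords (iter n h)) \<le> l2_norm_sq (norm2_coords h)"
      using iter_energy[OF assms(1), of n] sum_nonneg[of "{..<n}" "\<lambda>k. (\<gamma> ^ k * norm (lead_row (iter k h)))\<^sup>2"] by simp
    then have "sqrt ((\<gamma> ^ n)\<^sup>2 * l2_norm_sq (norm2_coords (iter n h))) \<le> sqrt (l2_norm_sq (norm2_coords h))" by (rule real_sqrt_le_mono)
    then have e: "\<gamma> ^ n * sqrt (l2_norm_sq (norm2_coords (iter n h))) \<le> sqrt (l2_norm_sq (norm2_coords h))"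
      using \<gamma>_pos by (simp add: real_sqrt_mult)
    have "cmod (B z ^ n * iter n h z) \<le> (\<rho> * \<gamma>) ^ n * (C * sqrt (l2_norm_sq (norm2_coords (iter n h))))"
      unfolding norm_mult norm_power
      by (intro mult_mono power_mono B_bound z C M_dirichlet iter_mem assms) (use \<rho> \<gamma>_pos in auto)
    also have "\<dots> = \<rho> ^ n * (C * (\<gamma> ^ n * sqrt (l2_norm_sq (norm2_coords (iter n h)))))"
      by (simp add: power_mult_distrib mult_ac)
    also have "\<dots> \<le> \<rho> ^ n * (C * sqrt (l2_norm_sq (norm2_coords h)))"
      using \<rho> C by (intro mult_left_mono e) auto
    finally show ?thesis .
  qed
  have "(\<lambda>n. \<rho> ^ n * (C * sqrt (l2_norm_sq (norm2_coords h)))) \<longlonglongrightarrow> 0 * (C * sqrt (l2_norm_sq (norm2_coords h)))"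
    using \<rho> by (intro tendsto_mult tendsto_const LIMSEQ_power_zero) auto
  then have "(\<lambda>n. \<rho> ^ n * (C * sqrt (l2_norm_sq (norm2_coords h)))) \<longlonglongrightarrow> 0" by simp
  then have r0: "(\<lambda>n. B z ^ n * iter n h z) \<longlonglongrightarrow> 0"
    by (rule Lim_null_comparison[OF always_eventually, rotated]) (use rem in blast)
  have "(\<lambda>n. \<Sum>i\<in>UNIV. (\<Sum>k<n. B z ^ k * lead_coord (iter k h) i) * g i z) \<longlonglongrightarrow> (\<Sum>i\<in>UNIV. Q h z $ i * g i z)"
    using Q_sums[OF assms(1) z(1)] by (intro tendsto_sum tendsto_mult tendsto_const) (simp add: sums_def)
  moreover have "(\<Sum>i\<in>UNIV. (\<Sum>k<n. B z ^ k * lead_coord (iter k h) i) * g i z) = h z - B z ^ n * iter n h z" for n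
  proof -
    have "(\<Sum>i\<in>UNIV. (\<Sum>k<n. B z ^ k * lead_coord (iter k h) i) * g i z) = (\<Sum>k<n. B z ^ k * lead (iter k h) z)"
      unfolding lead_def sum_distrib_right sum_distrib_left by (subst sum.swap) (simp add: mult.assoc)
    then show ?thesis using iter_expansion[OF assms(1), of z n] by simp
  qed
  moreover have "(\<lambda>n. h z - B z ^ n * iter n h z) \<longlonglongrightarrow> h z - 0" by (intro tendsto_intros r0)
  ultimately show ?thesis using LIMSEQ_unique by simp
qed

definition row_fun :: "(complex \<Rightarrow> complex) \<Rightarrow> complex \<Rightarrow> complex ^ 'l" where
  "row_fun h = (\<lambda>z. if z \<in> ball 0 s then Q h z else 0)"

lemma row_fun_hardy:
  assumes "h \<in> M"
  shows "row_fun h \<in> hardy_vec s" "hardy_vec_norm s (row_fun h) \<le> sqrt (1 / (1 - \<rho>\<^sup>2)) * sqrt (l2_norm_sq (norm2_coords h))"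
  unfolding row_fun_def
  using hardy_vec_sup_bound[OF s(1) Q_regular(2)[OF assms] Q_regular(1)[OF assms] norm_Q[OF assms]] by auto

lemma row_fun_add: "f \<in> M \<Longrightarrow> h \<in> M \<Longrightarrow> row_fun (\<lambda>z. f z + p * h z) = (\<lambda>z. row_fun f z + p *s row_fun h z)"
  by (rule ext) (auto simp: row_fun_def Q_add)

lemma row_fun_zero: "row_fun (\<lambda>z. 0) = (\<lambda>z. 0)"
  by (rule ext) (auto simp: row_fun_def Q_zero)

section \<open>Reflection in the circle of radius \<open>s\<close>\<close>

lemma zero_less_s: "cmod (zero n) < s"
proof -
  have z: "zero n \<in> ball 0 1" using zero_less1 by simp
  have "n mod m < m" using m by simp
  then have "Psi m (zero n) = 0"
    unfolding Psi_def using factor_zero[of "n mod m"] by (intro prod_zero) (auto simp: zero_def intro!: bexI[of _ "n mod m"])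
  then show ?thesis using zeros[OF z] B_eq[OF z] by simp
qed

text \<open>Uses that the zeros lie strictly inside the disc of radius \<open>s\<close>: a vanishing
  denominator would force a zero of modulus at least \<open>s\<close>.\<close>

lemma denominator_reflected: "cmod z \<le> s \<Longrightarrow> 1 - cnj (zero n) * (z / of_real (s\<^sup>2)) \<noteq> 0"
proof
  assume z: "cmod z \<le> s" and "1 - cnj (zero n) * (z / of_real (s\<^sup>2)) = 0"
  then have "cmod (cnj (zero n) * (z / of_real (s\<^sup>2))) = 1" by (metis eq_iff_diff_eq_0 norm_one)
  then have "cmod (zero n) * cmod z = s\<^sup>2" using s by (simp add: norm_mult norm_divide norm_power field_simps)
  moreover have "cmod (zero n) * cmod z \<le> cmod (zero n) * s" using z by (intro mult_left_mono) auto
  moreover have "cmod (zero n) * s < s * s" using s zero_less_s by (intro mult_strict_right_mono) auto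
  ultimately show False by (simp add: power2_eq_square)
qed

text \<open>On the circle \<open>z / of_real (s\<^sup>2)\<close> is the reciprocal of
  \<open>cnj z\<close>, so this is the symmetry of a Blaschke factor in the unit circle. The
  right-hand side is holomorphic in the disc of radius \<open>s\<close>.\<close>

lemma factor_reflected:
  assumes z: "cmod z = s"
  shows "cnj (inverse (factor n z)) = factor n (z / of_real (s\<^sup>2))"
proof -
  define p \<kappa> where "p = zero n" and "\<kappa> = (if n mod m = 0 then c else 1)"
  have \<kappa>: "inverse (cnj \<kappa>) = \<kappa>"
  proof -
    have "\<kappa> * cnj \<kappa> = 1" using c by (simp add: \<kappa>_def complex_norm_square[symmetric])
    then show ?thesis by (metis inverse_unique mult.commute)
  qed
  have z0: "z \<noteq> 0" using z s by auto
  have zc: "cnj z = of_real (s\<^sup>2) / z"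
  proof -
    have "z * cnj z = of_real (s\<^sup>2)" using complex_norm_square[of z] z by simp
    then show ?thesis using z0 by (simp add: field_simps)
  qed
  have s0: "complex_of_real (s\<^sup>2) \<noteq> 0" using s by simp
  have d: "1 - cnj p * (z / of_real (s\<^sup>2)) \<noteq> 0" using denominator_reflected[of z n] z by (simp add: p_def)
  have "cnj (inverse (factor n z)) = inverse (cnj \<kappa>) * ((1 - p * cnj z) / (cnj z - cnj p))"
    unfolding factor_def moebius_def p_def[symmetric] \<kappa>_def[symmetric]
    by (simp add: divide_inverse mult_ac)
  also have "(1 - p * cnj z) / (cnj z - cnj p) = (z / of_real (s\<^sup>2) - p) / (1 - cnj p * (z / of_real (s\<^sup>2)))"
  proof -
    have "cnj z - cnj p = (of_real (s\<^sup>2) / z) * (1 - cnj p * (z / of_real (s\<^sup>2)))"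
      unfolding zc using z0 s0 by (simp add: field_simps)
    moreover have "1 - p * cnj z = (of_real (s\<^sup>2) / z) * (z / of_real (s\<^sup>2) - p)"
      unfolding zc using z0 s0 by (simp add: field_simps)
    ultimately show ?thesis using z0 s0 by simp
  qed
  finally show ?thesis unfolding \<kappa> by (simp add: factor_def moebius_def p_def \<kappa>_def)
qed

lemma B_reflected:
  assumes "cmod z = s"
  shows "cnj (inverse (B z)) = Psi m (z / of_real (s\<^sup>2))"
proof -
  have "z \<in> ball 0 1" using assms s by simp
  then have "cnj (inverse (B z)) = (\<Prod>i<m. cnj (inverse (factor i z)))"
    by (simp add: B_eq Psi_def prod_inversef[symmetric] o_def)
  then show ?thesis by (simp only: factor_reflected[OF assms] Psi_def)
qed

text \<open>The operator acts on the power series in \<open>B\<close> by removing the constant term, except that the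
  constant is multiplied by the value \<open>cnj (B 0)\<close> of \<open>1 / B\<close> at infinity.\<close>

lemma toeplitz_row_fun:
  assumes h: "h \<in> M"
  shows "toeplitz s (\<lambda>\<zeta>. inverse (B \<zeta>)) (row_fun h) = row_fun (\<lambda>z. rest h z + cnj (B 0) * lead h z)"
  unfolding row_fun_def
proof (rule toeplitz_eqI[OF s(1)])
  define k where "k = (\<lambda>z. rest h z + cnj (B 0) * lead h z)"
  have k: "k \<in> M" unfolding k_def by (intro M_add rest(1) lead_mem h)
  show "continuous_on (cball 0 s) (Q h)" by (rule Q_regular[OF h])
  show "continuous_on (cball 0 s) (Q (\<lambda>z. rest h z + cnj (B 0) * lead h z))"
    using Q_regular(1)[OF k] by (simp add: k_def)
  have Bn: "B z \<noteq> 0" if "z \<in> sphere 0 s" for z using zeros[of z] that s by auto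
  show "continuous_on (sphere 0 s) (\<lambda>\<zeta>. inverse (B \<zeta>))"
    by (intro continuous_on_inverse continuous_on_subset[OF B_cont]) (use Bn in auto)
  show "(\<lambda>z. if z \<in> ball 0 s then Q (\<lambda>z. rest h z + cnj (B 0) * lead h z) z else 0) \<in> hardy_vec s"
    using row_fun_hardy(1)[OF k] by (simp add: row_fun_def k_def)
  fix u :: "complex \<Rightarrow> complex ^ 'l" and r :: real
  assume u: "u \<in> hardy_vec s" and r: "0 < r" "r < 1"
  have rs: "s * r < s * 1" using s r by (intro mult_strict_left_mono) auto
  \<comment> \<open>The conjugate of the scalar part of the integrand, extended holomorphically by
    \<open>B_reflected\<close>. It vanishes at 0, so its mean over the circle is zero; subtracting
    \<open>B 0\<close> is what fixes the constant term.\<close>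
  define T where "T i z = (Psi m (z / of_real (s\<^sup>2)) - B 0) * (u (of_real r * z) $ i)" for i z
  have u_hol: "(\<lambda>z. u z $ i) holomorphic_on ball 0 s" for i
    using u by (simp add: hardy_vec_def hardy_def analytic_on_disc_def)
  have ur: "(\<lambda>z. u (of_real r * z) $ i) holomorphic_on ball 0 s" "continuous_on (cball 0 s) (\<lambda>z. u (of_real r * z) $ i)" for i
  proof -
    have in': "of_real r * z \<in> ball 0 s" if "z \<in> cball 0 s" for z :: complex
    proof -
      have "r * cmod z \<le> r * s" using that r by (intro mult_left_mono) auto
      moreover have "norm (of_real r * z) = r * cmod z" using r by (simp add: norm_mult)
      moreover have "r * s < s" using rs by (simp add: mult.commute)
      ultimately have "norm (of_real r * z) < s" by linarith
      then show ?thesis by simp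
    qed
    show "(\<lambda>z. u (of_real r * z) $ i) holomorphic_on ball 0 s"
      by (rule holomorphic_on_compose_gen[OF _ u_hol, unfolded o_def]) (use in' in \<open>auto intro!: holomorphic_intros\<close>)
    show "continuous_on (cball 0 s) (\<lambda>z. u (of_real r * z) $ i)"
      by (rule continuous_on_compose2[OF holomorphic_on_imp_continuous_on[OF u_hol]]) (use in' in \<open>auto intro!: continuous_intros\<close>)
  qed
  have P: "(\<lambda>z. Psi m (z / of_real (s\<^sup>2))) holomorphic_on ball 0 s" "continuous_on (cball 0 s) (\<lambda>z. Psi m (z / of_real (s\<^sup>2)))"
  proof -
    show "(\<lambda>z. Psi m (z / of_real (s\<^sup>2))) holomorphic_on ball 0 s"
      unfolding Psi_def factor_def moebius_def using denominator_reflected s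
      by (intro holomorphic_intros) auto
    show "continuous_on (cball 0 s) (\<lambda>z. Psi m (z / of_real (s\<^sup>2)))"
      unfolding Psi_def factor_def moebius_def using denominator_reflected s
      by (intro continuous_intros) auto
  qed
  have T0: "(LINT \<theta>|circ. on_circle s (T i) \<theta>) = 0" for i
  proof -
    have hT: "T i holomorphic_on ball 0 s" and cT: "continuous_on (cball 0 s) (T i)"
      unfolding T_def[abs_def] by (intro holomorphic_intros continuous_intros P ur)+
    have "B 0 = Psi m 0" by (rule B_eq) simp
    then have "T i 0 = 0" by (simp add: T_def)
    then show ?thesis using taylor_coeff_circle[OF s(1) hT cT, of 0] by (simp add: circ_def)
  qed
  have "(LINT \<theta>|circ. vec_inner (on_circle s (\<lambda>\<zeta>. inverse (B \<zeta>) *s Q h \<zeta> - Q k \<zeta>) \<theta>) (dilate s u r \<theta>)) =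
      (LINT \<theta>|circ. (\<Sum>i\<in>UNIV. lead_coord h i * cnj (on_circle s (T i) \<theta>)))"
  proof (rule Bochner_Integration.integral_cong[OF refl])
    fix \<theta>
    define z where "z = of_real s * cis \<theta>"
    have zs: "cmod z = s" using s by (simp add: z_def norm_mult)
    have z: "z \<in> cball 0 s" "z \<in> sphere 0 s" using zs by auto
    have "Q k z = Q (rest h) z + cnj (B 0) *s lead_row h"
      unfolding k_def using Q_add[OF rest(1)[OF h] lead_mem z(1)] by (simp add: Q_lead[OF z(1)])
    moreover have "inverse (B z) *s Q h z = inverse (B z) *s lead_row h + Q (rest h) z"
      using Bn[OF z(2)] by (simp add: Q_rest[OF h z(1)] vec_eq_iff distrib_left)
    \<comment> \<open>The terms with \<open>rest h\<close> cancel, and only the constant row times a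
      scalar function is left.\<close>
    ultimately have "inverse (B z) *s Q h z - Q k z = (inverse (B z) - cnj (B 0)) *s lead_row h"
      by (simp add: vec_eq_iff algebra_simps)
    then have "vec_inner (inverse (B z) *s Q h z - Q k z) (u (of_real r * z)) =
        vec_inner ((inverse (B z) - cnj (B 0)) *s lead_row h) (u (of_real r * z))" by (simp only:)
    also have "\<dots> = (\<Sum>i\<in>UNIV. lead_coord h i * ((inverse (B z) - cnj (B 0)) * cnj (u (of_real r * z) $ i)))"
      unfolding vec_inner_def by (simp add: lead_row_def algebra_simps)
    finally have e: "vec_inner (inverse (B z) *s Q h z - Q k z) (u (of_real r * z)) =
        (\<Sum>i\<in>UNIV. lead_coord h i * ((inverse (B z) - cnj (B 0)) * cnj (u (of_real r * z) $ i)))" .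
    have iB: "cnj (Psi m (z / of_real (s\<^sup>2))) = inverse (B z)"
      using B_reflected[OF zs] by (metis complex_cnj_cnj)
    show "vec_inner (on_circle s (\<lambda>\<zeta>. inverse (B \<zeta>) *s Q h \<zeta> - Q k \<zeta>) \<theta>) (dilate s u r \<theta>) =
        (\<Sum>i\<in>UNIV. lead_coord h i * cnj (on_circle s (T i) \<theta>))"
      unfolding z_def[symmetric] e T_def complex_cnj_mult complex_cnj_diff iB by (rule refl)
  qed
  also have "\<dots> = (\<Sum>i\<in>UNIV. LINT \<theta>|circ. lead_coord h i * cnj (on_circle s (T i) \<theta>))"
  proof (rule Bochner_Integration.integral_sum)
    fix i
    have "continuous_on (cball 0 s) (T i)" unfolding T_def[abs_def] by (intro continuous_intros P ur)
    then show "integrable circ (\<lambda>\<theta>. lead_coord h i * cnj (on_circle s (T i) \<theta>))"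
      unfolding circ_def using s by (intro continuous_imp_integrable_real continuous_intros circle_continuous) auto
  qed
  also have "\<dots> = (\<Sum>i\<in>UNIV. lead_coord h i * cnj (LINT \<theta>|circ. on_circle s (T i) \<theta>))"
    by (simp only: integral_mult_right_zero Bochner_Integration.integral_cnj)
  also have "\<dots> = 0" by (simp add: T0)
  finally show "(LINT \<theta>|circ. vec_inner (on_circle s (\<lambda>\<zeta>. inverse (B \<zeta>) *s Q h \<zeta> - Q (\<lambda>z. rest h z + cnj (B 0) * lead h z) \<zeta>) \<theta>)
      (dilate s u r \<theta>)) = 0"
    by (simp add: k_def)
qed

end

subsection \<open>Dilations\<close>

lemma taylor_coeff_dilation:
  assumes "0 < s" "f holomorphic_on ball 0 s"
  shows "taylor_coeff (\<lambda>z. f (of_real s * z)) k = taylor_coeff f k * of_real (s ^ k)"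
proof (rule taylor_coeff_unique[OF zero_less_one])
  fix z :: complex assume z: "z \<in> ball 0 1"
  have "s * cmod z < s * 1" using assms(1) z by (intro mult_strict_left_mono) auto
  then have "of_real s * z \<in> ball 0 s" using assms(1) by (simp add: norm_mult)
  from taylor_coeff_sums[OF assms(2) this]
  show "(\<lambda>k. taylor_coeff f k * of_real (s ^ k) * z ^ k) sums f (of_real s * z)"
    by (simp add: power_mult_distrib mult.assoc)
qed

lemma hardy_vec_inner_dilation:
  assumes s: "0 < s" and u: "u \<in> hardy_vec s" and v: "v \<in> hardy_vec s"
  shows "hardy_vec_inner 1 (dilation s u) (dilation s v) = hardy_vec_inner s u v"
proof -
  have "(\<lambda>z. u z $ i) holomorphic_on ball 0 s" "(\<lambda>z. v z $ i) holomorphic_on ball 0 s" for i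
    using u v by (auto simp: hardy_vec_def hardy_def analytic_on_disc_def)
  then show ?thesis
    by (simp add: hardy_vec_inner_def dilation_def hardy_inner_def taylor_coeff_dilation[OF s, of "\<lambda>z. u z $ _"]
        taylor_coeff_dilation[OF s, of "\<lambda>z. v z $ _"])
qed

text \<open>Dilation preserves inner products, so \<open>q\<close> is a candidate for the
  \<open>THE\<close>; pairing any other candidate with monomials in a single component forces
  equality.\<close>

lemma dilation_adjoint_dilation:
  fixes q :: "complex \<Rightarrow> complex ^ 'l"
  assumes s: "0 < s" and q: "q \<in> hardy_vec s"
  shows "dilation_adjoint s (dilation s q) = q"
  unfolding dilation_adjoint_def hilbert_adjoint_def
proof (rule the_equality)
  show "q \<in> hardy_vec s \<and> (\<forall>u\<in>hardy_vec s. hardy_vec_inner 1 (dilation s u) (dilation s q) = hardy_vec_inner s u q)"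
    using q by (simp add: hardy_vec_inner_dilation[OF s])
  fix v :: "complex \<Rightarrow> complex ^ 'l"
  assume v: "v \<in> hardy_vec s \<and> (\<forall>u\<in>hardy_vec s. hardy_vec_inner 1 (dilation s u) (dilation s q) = hardy_vec_inner s u v)"
  have coeff: "taylor_coeff (\<lambda>z. v z $ i) n = taylor_coeff (\<lambda>z. q z $ i) n" for i n
  proof -
    define u :: "complex \<Rightarrow> complex ^ 'l" where "u z = (if z \<in> ball 0 s then axis i (z ^ n) else 0)" for z
    have tu: "taylor_coeff (\<lambda>z. u z $ j) k = (if j = i \<and> k = n then 1 else 0)" for j k
    proof -
      have "taylor_coeff (\<lambda>z. u z $ j) k = taylor_coeff (\<lambda>z. if j = i then z ^ n else 0) k"
        by (rule taylor_coeff_cong[OF s]) (simp add: u_def axis_def)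
      then show ?thesis by (cases "j = i") (simp_all add: taylor_coeff_monomial)
    qed
    have "(\<lambda>z. u z $ j) \<in> hardy s" for j
    proof -
      have "(\<lambda>z. if j = i then z ^ n else 0) holomorphic_on ball 0 s"
        by (cases "j = i") (auto intro!: holomorphic_intros)
      then have "(\<lambda>z. u z $ j) holomorphic_on ball 0 s"
        by (rule holomorphic_transform) (simp add: u_def axis_def)
      moreover have "summable (\<lambda>k. (cmod (taylor_coeff (\<lambda>z. u z $ j) k) * s ^ k)\<^sup>2)"
        unfolding tu by (rule summable_finite[of "{n}"]) auto
      ultimately show ?thesis by (auto simp: hardy_def analytic_on_disc_def u_def)
    qed
    then have u: "u \<in> hardy_vec s" by (simp add: hardy_vec_def)
    have ip: "hardy_vec_inner s u w = of_real (s ^ n) * cnj (taylor_coeff (\<lambda>z. w z $ i) n * of_real (s ^ n))" for w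
    proof -
      have "hardy_inner s (\<lambda>z. u z $ j) (\<lambda>z. w z $ j) =
          (if j = i then of_real (s ^ n) * cnj (taylor_coeff (\<lambda>z. w z $ i) n * of_real (s ^ n)) else 0)" for j
        unfolding hardy_inner_def tu by (subst suminf_finite[of "{n}"]) auto
      then show ?thesis by (simp add: hardy_vec_inner_def)
    qed
    have "hardy_vec_inner s u v = hardy_vec_inner s u q"
      using v u q by (simp add: hardy_vec_inner_dilation[OF s])
    then show ?thesis unfolding ip using s by simp
  qed
  have "(\<lambda>z. v z $ i) = (\<lambda>z. q z $ i)" for i
    by (rule analytic_on_disc_eqI[of _ s]) (use q v coeff in \<open>auto simp: hardy_vec_def hardy_def\<close>)
  then show "v = q" by (auto simp: fun_eq_iff vec_eq_iff)
qed

theorem theorem3p7: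
  fixes \<alpha> s \<gamma>\<^sub>2 :: real
    and m N :: nat
    and B :: "complex \<Rightarrow> complex"
    and M :: "(complex \<Rightarrow> complex) set"
    and g :: "'l::finite \<Rightarrow> complex \<Rightarrow> complex"
  assumes "-1 \<le> \<alpha>" and "\<alpha> < 0"
    and "1 \<le> m" and "blaschke_product m B"
    and "0 < s" and "s < 1"
    and "\<forall>z\<in>ball 0 1. B z = 0 \<longrightarrow> z \<in> ball 0 s"
    and "1 \<le> N"
    and "\<gamma>\<^sub>2 = (1 - 1 / (real N + 1)) powr (- \<alpha> / 2)"
    and "Hinf_norm s (\<lambda>z. of_real (inverse \<gamma>\<^sub>2) * B z) < 1"
    and "closed_subspace (norm2 \<alpha> B N) (dirichlet \<alpha>) M"
    and "M \<noteq> {\<lambda>z. 0}"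
    and "nearly_inverse_invariant \<alpha> B M"
    and "orthonormal_basis (inner2 \<alpha> B N)
           (ominus (inner2 \<alpha> B N) M (M \<inter> mult_op B ` dirichlet \<alpha>)) g"
  shows "\<exists>\<N> :: (complex \<Rightarrow> complex ^ 'l) set.
           linear_submanifold (*s) (hardy_vec s) \<N> \<and>
           (\<lambda>h. restrict h (ball 0 s)) ` M = (\<lambda>q. restrict (row_mult q g) (ball 0 s)) ` \<N> \<and>
           (\<forall>h\<in>M. \<exists>q\<in>\<N>.
              (\<forall>z\<in>ball 0 s. h z = row_mult q g z) \<and>
              norm2 \<alpha> B N h \<ge>
                sqrt (1 - (Hinf_norm s (\<lambda>z. of_real (inverse \<gamma>\<^sub>2) * B z))\<^sup>2) * hardy_vec_norm s q) \<and>
           toeplitz s (\<lambda>\<zeta>. inverse (B \<zeta>)) ` \<N> \<subseteq> \<N> \<and>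
           (dilation s \<circ> toeplitz s (\<lambda>\<zeta>. inverse (B \<zeta>)) \<circ> dilation_adjoint s) ` (dilation s ` \<N>)
             \<subseteq> dilation s ` \<N>"
proof -
  from assms(4) obtain c a where ca: "cmod c = 1" "\<And>j. j < m \<Longrightarrow> cmod (a j) < 1"
    "\<And>z. z \<in> ball 0 1 \<Longrightarrow> B z = c * (\<Prod>j<m. (z - a j) / (1 - cnj (a j) * z))"
    unfolding blaschke_product_def by blast
  interpret bd: blaschke_dirichlet m B c a \<alpha> N
    by unfold_locales (use assms(2,3,8) ca in auto)
  have \<gamma>: "\<gamma>\<^sub>2 = bd.\<gamma>" by (simp add: assms(9) bd.\<gamma>_def)
  interpret nearly_invariant_disc m B c a \<alpha> N M g s
    by unfold_locales (use assms(5,6,7,10-14) in \<open>auto simp: \<gamma>\<close>)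
  \<comment> \<open>The linear image of \<open>M\<close> serves as the manifold; closedness of the
    image is not claimed.\<close>
  define K where "K = row_fun ` M"
  have \<rho>_eq: "Hinf_norm s (\<lambda>z. of_real (inverse \<gamma>\<^sub>2) * B z) = \<rho>" by (simp add: \<rho>_def \<gamma>)
  have K_hardy: "K \<subseteq> hardy_vec s" by (auto simp: K_def row_fun_hardy)
  have sub: "linear_submanifold (*s) (hardy_vec s) K"
    unfolding linear_submanifold_def
  proof (intro conjI ballI allI K_hardy)
    show "(\<lambda>z. 0) \<in> K" unfolding K_def by (rule image_eqI[where x = "\<lambda>z. 0"]) (simp_all add: row_fun_zero M_zero)
    fix p q assume "p \<in> K"
    then obtain f where f: "f \<in> M" "p = row_fun f" by (auto simp: K_def)
    show "(\<lambda>z. x *s p z) \<in> K" for x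
    proof -
      \<comment> \<open>Homogeneity is the case of \<open>row_fun_add\<close> with the zero function
        as first summand.\<close>
      have "row_fun (\<lambda>z. 0 + x * f z) = (\<lambda>z. 0 + x *s p z)"
        using row_fun_add[OF M_zero f(1), of x] by (simp only: row_fun_zero f(2))
      then show ?thesis using imageI[OF M_cmult[OF f(1), of x], of row_fun] by (simp add: K_def)
    qed
    assume "q \<in> K"
    then obtain h where h: "h \<in> M" "q = row_fun h" by (auto simp: K_def)
    have "row_fun (\<lambda>z. f z + 1 * h z) = (\<lambda>z. p z + 1 *s q z)" by (simp only: row_fun_add[OF f(1) h(1)] f(2) h(2))
    then show "(\<lambda>z. p z + q z) \<in> K" using imageI[OF M_add[OF f(1) h(1), of 1], of row_fun] by (simp add: K_def)
  qed
  have rep: "h z = row_mult (row_fun h) g z" if "h \<in> M" "z \<in> ball 0 s" for h z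
    using Q_represents[OF that] that(2) by (simp add: row_mult_def row_fun_def)
  have eqM: "(\<lambda>h. restrict h (ball 0 s)) ` M = (\<lambda>q. restrict (row_mult q g) (ball 0 s)) ` K"
    unfolding K_def image_image by (intro image_cong refl restrict_ext rep)
  have bound: "sqrt (1 - \<rho>\<^sup>2) * hardy_vec_norm s (row_fun h) \<le> norm2 \<alpha> B N h" if "h \<in> M" for h
  proof -
    have r2: "\<rho>\<^sup>2 < 1" using \<rho> by (simp add: abs_square_less_1)

    have "sqrt (1 - \<rho>\<^sup>2) * hardy_vec_norm s (row_fun h) \<le>
        sqrt (1 - \<rho>\<^sup>2) * (sqrt (1 / (1 - \<rho>\<^sup>2)) * sqrt (l2_norm_sq (bd.norm2_coords h)))"
      by (rule mult_left_mono[OF row_fun_hardy(2)[OF that]]) (use r2 in simp)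
    also have "\<dots> = sqrt (l2_norm_sq (bd.norm2_coords h))" using r2 by (simp add: real_sqrt_divide)
    finally show ?thesis by (simp add: bd.norm2_eq M_dirichlet that)
  qed
  have inv: "toeplitz s (\<lambda>\<zeta>. inverse (B \<zeta>)) ` K \<subseteq> K"
    unfolding K_def by (auto simp: toeplitz_row_fun intro!: imageI M_add rest(1) lead_mem)
  \<comment> \<open>On dilated rows the adjoint undoes the dilation, so the second invariance is the
    dilated image of the first.\<close>
  have "(dilation s \<circ> toeplitz s (\<lambda>\<zeta>. inverse (B \<zeta>)) \<circ> dilation_adjoint s) ` (dilation s ` K) =
      dilation s ` toeplitz s (\<lambda>\<zeta>. inverse (B \<zeta>)) ` K"
    unfolding image_image comp_def
    by (intro image_cong refl) (use K_hardy in \<open>simp add: dilation_adjoint_dilation[OF s(1)] subset_iff\<close>)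
  then have inv': "(dilation s \<circ> toeplitz s (\<lambda>\<zeta>. inverse (B \<zeta>)) \<circ> dilation_adjoint s) ` (dilation s ` K) \<subseteq> dilation s ` K"
    using image_mono[OF inv, of "dilation s"] by (simp only:)
  have "\<forall>h\<in>M. \<exists>q\<in>K. (\<forall>z\<in>ball 0 s. h z = row_mult q g z) \<and> norm2 \<alpha> B N h \<ge> sqrt (1 - \<rho>\<^sup>2) * hardy_vec_norm s q"
  proof
    fix h assume "h \<in> M"
    then show "\<exists>q\<in>K. (\<forall>z\<in>ball 0 s. h z = row_mult q g z) \<and> norm2 \<alpha> B N h \<ge> sqrt (1 - \<rho>\<^sup>2) * hardy_vec_norm s q"
      using rep bound unfolding K_def by (intro bexI[of _ "row_fun h"] conjI) auto
  qed
  then show ?thesis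
    unfolding \<rho>_eq using sub eqM inv inv' by (intro exI[of _ K] conjI)
qed

end
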